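(* Let $k$ be a field and let $H$ be a Hopf algebra over $k$. Let $A$ be a right normal Hopf subalgebra of $H$ and let $B$ be a right normal right coideal subalgebra of $H$ such that $B \subseteq A$. Then $\pi_B(A)$ is a right normal Hopf subalgebra of $H/HB^+$ and the following hold: (i) $\pi_A$ induces an isomorphism of Hopf algebras $$\dfrac{H/HB^+}{(H/HB^+)\, \pi_B(A)^+} \cong H/HA^+.$$ (ii) Assume that $H$ is left faithfully flat over $B$ and $A$ is right faithfully coflat over $\pi_B(A)$. Then $\pi_B$ induces an isomorphism of Hopf algebras $A/AB^+ \cong \pi_B(A)$.
   Context: A subspace $K\subseteq H$ is right normal if it is stable under the right adjoint action of $H$: $\mathcal S(h_{(1)})ah_{(2)}\in K$ for all $a\in K$, $h\in H$. A right coideal subalgebra of $H$ is a subalgebra $K$ with $\Delta(K)\subseteq K\otimes H$. Put $K^+=K\cap\ker\epsilon$. If $K$ is a right normal right coideal subalgebra of $H$, then $HK^+$ is a Hopf ideal of $H$, and $\pi_K:H\to H/HK^+$ denotes the canonical Hopf algebra map. $H$ is left faithfully flat over $B$ if it is faithfully flat as a left $B$-module. $A$ is right faithfully coflat over $\pi_B(A)$ if $A$, viewed as a right $\pi_B(A)$-comodule via $(\mathrm{id}\otimes\pi_B|_A)\Delta$, is faithfully coflat, i.e. the cotensor functor $A\,\square_{\pi_B(A)}\,-$ on left comodules preserves and reflects exact sequences. $H$ need not be finite dimensional. *)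

theory Defs
  imports "HOL-Algebra.Module" "HOL-Algebra.Subrings" "HOL-Algebra.Ideal_Product" "HOL.Hull"
begin

section \<open>Vector spaces, quotients and tensor products\<close>

text \<open>
  A vector space over the field \<open>K\<close> is a \<^locale>\<open>module\<close> over \<open>K\<close>. The fields \<open>mult\<close> and \<open>one\<close> of the
  record are irrelevant unless the space is also required to be a ring.
\<close>

definition ground_space :: "('k, 'z) ring_scheme \<Rightarrow> ('k, 'k) module"
  where "ground_space K = \<lparr>carrier = carrier K, mult = mult K, one = \<one>\<^bsub>K\<^esub>,
           zero = \<zero>\<^bsub>K\<^esub>, add = add K, smult = mult K\<rparr>"

definition lin_maps ::
  "('k, 'z) ring_scheme \<Rightarrow> ('k, 'm, 'a) module_scheme \<Rightarrow> ('k, 'n, 'b) module_scheme \<Rightarrow> ('m \<Rightarrow> 'n) set"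
  where "lin_maps K M N = {f. f \<in> carrier M \<rightarrow> carrier N
     \<and> (\<forall>x\<in>carrier M. \<forall>y\<in>carrier M. f (x \<oplus>\<^bsub>M\<^esub> y) = f x \<oplus>\<^bsub>N\<^esub> f y)
     \<and> (\<forall>a\<in>carrier K. \<forall>x\<in>carrier M. f (a \<odot>\<^bsub>M\<^esub> x) = a \<odot>\<^bsub>N\<^esub> f x)}"

definition subspace_span ::
  "('k, 'z) ring_scheme \<Rightarrow> ('k, 'm, 'a) module_scheme \<Rightarrow> 'm set \<Rightarrow> 'm set"
  where "subspace_span K M X = (\<lambda>V. submodule V K M) hull X"

text \<open>
  The common value of \<open>\<phi>\<close> on a coset \<open>X\<close>: the map induced by \<open>\<phi>\<close> on a quotient. It is only
  meaningful when \<open>\<phi>\<close> is constant on the cosets.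
\<close>

definition coset_lift :: "('m \<Rightarrow> 'n) \<Rightarrow> 'm set \<Rightarrow> 'n"
  where "coset_lift \<phi> X = the_elem (\<phi> ` X)"

definition quot_space :: "('k, 'm, 'a) module_scheme \<Rightarrow> 'm set \<Rightarrow> ('k, 'm set) module"
  where "quot_space M N = \<lparr>carrier = carrier (M Quot N), mult = mult (M Quot N),
           one = \<one>\<^bsub>M Quot N\<^esub>, zero = \<zero>\<^bsub>M Quot N\<^esub>, add = add (M Quot N),
           smult = (\<lambda>a. coset_lift (\<lambda>x. N +>\<^bsub>M\<^esub> (a \<odot>\<^bsub>M\<^esub> x)))\<rparr>"

definition free_space :: "('k, 'z) ring_scheme \<Rightarrow> 'x set \<Rightarrow> ('k, 'x \<Rightarrow> 'k) module"
  where "free_space K X = \<lparr>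
           carrier = {f. f \<in> X \<rightarrow> carrier K \<and> (\<forall>x. x \<notin> X \<longrightarrow> f x = \<zero>\<^bsub>K\<^esub>) \<and> finite {x. f x \<noteq> \<zero>\<^bsub>K\<^esub>}},
           mult = undefined, one = undefined,
           zero = (\<lambda>x. \<zero>\<^bsub>K\<^esub>), add = (\<lambda>f g x. f x \<oplus>\<^bsub>K\<^esub> g x),
           smult = (\<lambda>a f x. a \<otimes>\<^bsub>K\<^esub> f x)\<rparr>"

definition basis_vec :: "('k, 'z) ring_scheme \<Rightarrow> 'x \<Rightarrow> 'x \<Rightarrow> 'k"
  where "basis_vec K x = (\<lambda>y. if y = x then \<one>\<^bsub>K\<^esub> else \<zero>\<^bsub>K\<^esub>)"

text \<open>
  \<open>M \<otimes> N\<close> is the space freely generated by the pairs \<open>(m, n)\<close> modulo the bilinearity relations.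
\<close>

definition tensor_rel ::
  "('k, 'z) ring_scheme \<Rightarrow> ('k, 'm, 'a) module_scheme \<Rightarrow> ('k, 'n, 'b) module_scheme
    \<Rightarrow> ('m \<times> 'n \<Rightarrow> 'k) set"
  where "tensor_rel K M N =
    (let F = free_space K (carrier M \<times> carrier N); e = basis_vec K in
      subspace_span K F
       ({e (x \<oplus>\<^bsub>M\<^esub> x', y) \<ominus>\<^bsub>F\<^esub> (e (x, y) \<oplus>\<^bsub>F\<^esub> e (x', y)) | x x' y.
            x \<in> carrier M \<and> x' \<in> carrier M \<and> y \<in> carrier N}
      \<union> {e (x, y \<oplus>\<^bsub>N\<^esub> y') \<ominus>\<^bsub>F\<^esub> (e (x, y) \<oplus>\<^bsub>F\<^esub> e (x, y')) | x y y'.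
            x \<in> carrier M \<and> y \<in> carrier N \<and> y' \<in> carrier N}
      \<union> {e (a \<odot>\<^bsub>M\<^esub> x, y) \<ominus>\<^bsub>F\<^esub> a \<odot>\<^bsub>F\<^esub> e (x, y) | a x y.
            a \<in> carrier K \<and> x \<in> carrier M \<and> y \<in> carrier N}
      \<union> {e (x, a \<odot>\<^bsub>N\<^esub> y) \<ominus>\<^bsub>F\<^esub> a \<odot>\<^bsub>F\<^esub> e (x, y) | a x y.
            a \<in> carrier K \<and> x \<in> carrier M \<and> y \<in> carrier N}))"

definition tensor ::
  "('k, 'z) ring_scheme \<Rightarrow> ('k, 'm, 'a) module_scheme \<Rightarrow> ('k, 'n, 'b) module_scheme
    \<Rightarrow> ('k, ('m \<times> 'n \<Rightarrow> 'k) set) module"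
  where "tensor K M N = quot_space (free_space K (carrier M \<times> carrier N)) (tensor_rel K M N)"

definition pure_tensor ::
  "('k, 'z) ring_scheme \<Rightarrow> ('k, 'm, 'a) module_scheme \<Rightarrow> ('k, 'n, 'b) module_scheme
    \<Rightarrow> 'm \<Rightarrow> 'n \<Rightarrow> ('m \<times> 'n \<Rightarrow> 'k) set"
  where "pure_tensor K M N x y =
    tensor_rel K M N +>\<^bsub>free_space K (carrier M \<times> carrier N)\<^esub> basis_vec K (x, y)"

text \<open>
  The linear map on a tensor product with values in \<open>P\<close> that is induced by a bilinear map \<open>\<beta>\<close>.
\<close>

definition tensor_lift ::
  "('k, 'z) ring_scheme \<Rightarrow> ('k, 'p, 'c) module_scheme \<Rightarrow> ('m \<Rightarrow> 'n \<Rightarrow> 'p)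
    \<Rightarrow> ('m \<times> 'n \<Rightarrow> 'k) set \<Rightarrow> 'p"
  where "tensor_lift K P \<beta> =
    coset_lift (\<lambda>f. \<Oplus>\<^bsub>P\<^esub>p\<in>{p. f p \<noteq> \<zero>\<^bsub>K\<^esub>}. f p \<odot>\<^bsub>P\<^esub> \<beta> (fst p) (snd p))"

text \<open>\<open>f \<otimes> g\<close>, as a map into \<open>M \<otimes> N\<close>.\<close>

definition tensor_map ::
  "('k, 'z) ring_scheme \<Rightarrow> ('k, 'm, 'a) module_scheme \<Rightarrow> ('k, 'n, 'b) module_scheme
    \<Rightarrow> ('x \<Rightarrow> 'm) \<Rightarrow> ('y \<Rightarrow> 'n) \<Rightarrow> ('x \<times> 'y \<Rightarrow> 'k) set \<Rightarrow> ('m \<times> 'n \<Rightarrow> 'k) set"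
  where "tensor_map K M N f g =
    tensor_lift K (tensor K M N) (\<lambda>x y. pure_tensor K M N (f x) (g y))"

text \<open>The canonical map from \<open>(L \<otimes> M) \<otimes> N\<close> to \<open>L \<otimes> (M \<otimes> N)\<close>.\<close>

definition tensor_assoc ::
  "('k, 'z) ring_scheme \<Rightarrow> ('k, 'l, 'a) module_scheme \<Rightarrow> ('k, 'm, 'b) module_scheme
    \<Rightarrow> ('k, 'n, 'c) module_scheme \<Rightarrow> (('l \<times> 'm \<Rightarrow> 'k) set \<times> 'n \<Rightarrow> 'k) set
    \<Rightarrow> ('l \<times> ('m \<times> 'n \<Rightarrow> 'k) set \<Rightarrow> 'k) set"
  where "tensor_assoc K L M N =
    (let T = tensor K L (tensor K M N) in
      tensor_lift K T (\<lambda>t z. tensor_lift K T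
        (\<lambda>x y. pure_tensor K L (tensor K M N) x (pure_tensor K M N y z)) t))"


section \<open>Hopf algebras\<close>

record ('k, 'c) coalg = "('k, 'c) module" +
  comult :: "'c \<Rightarrow> ('c \<times> 'c \<Rightarrow> 'k) set"
  counit :: "'c \<Rightarrow> 'k"

record ('k, 'h) hopf = "('k, 'h) coalg" +
  antipode :: "'h \<Rightarrow> 'h"

text \<open>Unital associative algebras; \<^locale>\<open>algebra\<close> requires commutativity.\<close>

locale assoc_algebra = K: field K + module K H + H: ring H
  for K :: "('k, 'z) ring_scheme" and H :: "('k, 'h, 'a) module_scheme" +
  assumes smult_mult_left: "\<lbrakk>a \<in> carrier K; x \<in> carrier H; y \<in> carrier H\<rbrakk>
      \<Longrightarrow> (a \<odot>\<^bsub>H\<^esub> x) \<otimes>\<^bsub>H\<^esub> y = a \<odot>\<^bsub>H\<^esub> (x \<otimes>\<^bsub>H\<^esub> y)"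
    and smult_mult_right: "\<lbrakk>a \<in> carrier K; x \<in> carrier H; y \<in> carrier H\<rbrakk>
      \<Longrightarrow> x \<otimes>\<^bsub>H\<^esub> (a \<odot>\<^bsub>H\<^esub> y) = a \<odot>\<^bsub>H\<^esub> (x \<otimes>\<^bsub>H\<^esub> y)"

locale coalgebra = K: field K + module K C
  for K :: "('k, 'z) ring_scheme" and C :: "('k, 'c, 'a) coalg_scheme" +
  assumes comult_linear: "comult C \<in> lin_maps K C (tensor K C C)"
    and counit_linear: "counit C \<in> lin_maps K C (ground_space K)"
    and coassoc: "c \<in> carrier C \<Longrightarrow>
      tensor_assoc K C C C (tensor_map K (tensor K C C) C (comult C) id (comult C c))
        = tensor_map K C (tensor K C C) id (comult C) (comult C c)"
    and counit_left: "c \<in> carrier C \<Longrightarrow>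
      tensor_lift K C (\<lambda>x y. counit C x \<odot>\<^bsub>C\<^esub> y) (comult C c) = c"
    and counit_right: "c \<in> carrier C \<Longrightarrow>
      tensor_lift K C (\<lambda>x y. counit C y \<odot>\<^bsub>C\<^esub> x) (comult C c) = c"

text \<open>The product \<open>(a \<otimes> b) (c \<otimes> d) = ac \<otimes> bd\<close> of \<open>H \<otimes> H\<close>.\<close>

definition tensor_mult ::
  "('k, 'z) ring_scheme \<Rightarrow> ('k, 'h, 'a) module_scheme
    \<Rightarrow> ('h \<times> 'h \<Rightarrow> 'k) set \<Rightarrow> ('h \<times> 'h \<Rightarrow> 'k) set \<Rightarrow> ('h \<times> 'h \<Rightarrow> 'k) set"
  where "tensor_mult K H s t =
    tensor_lift K (tensor K H H) (\<lambda>a b. tensor_lift K (tensor K H H)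
      (\<lambda>c d. pure_tensor K H H (a \<otimes>\<^bsub>H\<^esub> c) (b \<otimes>\<^bsub>H\<^esub> d)) t) s"

locale hopf_algebra = assoc_algebra K H + coalgebra K H
  for K :: "('k, 'z) ring_scheme" and H :: "('k, 'h, 'a) hopf_scheme" +
  assumes comult_one: "comult H \<one>\<^bsub>H\<^esub> = pure_tensor K H H \<one>\<^bsub>H\<^esub> \<one>\<^bsub>H\<^esub>"
    and comult_mult: "\<lbrakk>x \<in> carrier H; y \<in> carrier H\<rbrakk> \<Longrightarrow>
      comult H (x \<otimes>\<^bsub>H\<^esub> y) = tensor_mult K H (comult H x) (comult H y)"
    and counit_one: "counit H \<one>\<^bsub>H\<^esub> = \<one>\<^bsub>K\<^esub>"
    and counit_mult: "\<lbrakk>x \<in> carrier H; y \<in> carrier H\<rbrakk> \<Longrightarrow>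
      counit H (x \<otimes>\<^bsub>H\<^esub> y) = counit H x \<otimes>\<^bsub>K\<^esub> counit H y"
    and antipode_linear: "antipode H \<in> lin_maps K H H"
    and antipode_left: "x \<in> carrier H \<Longrightarrow>
      tensor_lift K H (\<lambda>y z. antipode H y \<otimes>\<^bsub>H\<^esub> z) (comult H x) = counit H x \<odot>\<^bsub>H\<^esub> \<one>\<^bsub>H\<^esub>"
    and antipode_right: "x \<in> carrier H \<Longrightarrow>
      tensor_lift K H (\<lambda>y z. y \<otimes>\<^bsub>H\<^esub> antipode H z) (comult H x) = counit H x \<odot>\<^bsub>H\<^esub> \<one>\<^bsub>H\<^esub>"

definition hopf_hom ::
  "('k, 'z) ring_scheme \<Rightarrow> ('k, 'g, 'a) hopf_scheme \<Rightarrow> ('k, 'h, 'b) hopf_scheme \<Rightarrow> ('g \<Rightarrow> 'h) set"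
  where "hopf_hom K G H = {f. f \<in> lin_maps K G H \<and> f \<in> ring_hom G H
     \<and> (\<forall>x\<in>carrier G. comult H (f x) = tensor_map K H H f f (comult G x))
     \<and> (\<forall>x\<in>carrier G. counit H (f x) = counit G x)
     \<and> (\<forall>x\<in>carrier G. antipode H (f x) = f (antipode G x))}"

definition hopf_iso ::
  "('k, 'z) ring_scheme \<Rightarrow> ('k, 'g, 'a) hopf_scheme \<Rightarrow> ('k, 'h, 'b) hopf_scheme \<Rightarrow> ('g \<Rightarrow> 'h) set"
  where "hopf_iso K G H = {f. hopf_algebra K G \<and> hopf_algebra K H
     \<and> f \<in> hopf_hom K G H \<and> bij_betw f (carrier G) (carrier H)}"


section \<open>Subobjects and quotients\<close>

definition subalg :: "('k, 'z) ring_scheme \<Rightarrow> ('k, 'h, 'a) module_scheme \<Rightarrow> 'h set \<Rightarrow> bool"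
  where "subalg K H X \<longleftrightarrow> submodule X K H \<and> subring X H"

text \<open>
  For subspaces \<open>X\<close> and \<open>Y\<close> of \<open>M\<close> and \<open>N\<close>, the subspace \<open>X \<otimes> Y\<close> of \<open>M \<otimes> N\<close>. It is the image of the
  tensor product of \<open>X\<close> and \<open>Y\<close>, whose elements are cosets for a different relation.
\<close>

definition tensor_sub ::
  "('k, 'z) ring_scheme \<Rightarrow> ('k, 'm, 'a) module_scheme \<Rightarrow> ('k, 'n, 'b) module_scheme
    \<Rightarrow> 'm set \<Rightarrow> 'n set \<Rightarrow> ('m \<times> 'n \<Rightarrow> 'k) set set"
  where "tensor_sub K M N X Y =
    tensor_map K M N id id ` carrier (tensor K (M\<lparr>carrier := X\<rparr>) (N\<lparr>carrier := Y\<rparr>))"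

definition right_coideal_subalgebra ::
  "('k, 'z) ring_scheme \<Rightarrow> ('k, 'h, 'a) hopf_scheme \<Rightarrow> 'h set \<Rightarrow> bool"
  where "right_coideal_subalgebra K H X \<longleftrightarrow>
     subalg K H X \<and> comult H ` X \<subseteq> tensor_sub K H H X (carrier H)"

definition hopf_subalgebra ::
  "('k, 'z) ring_scheme \<Rightarrow> ('k, 'h, 'a) hopf_scheme \<Rightarrow> 'h set \<Rightarrow> bool"
  where "hopf_subalgebra K H X \<longleftrightarrow>
     subalg K H X \<and> comult H ` X \<subseteq> tensor_sub K H H X X \<and> antipode H ` X \<subseteq> X"

definition right_normal :: "('k, 'z) ring_scheme \<Rightarrow> ('k, 'h, 'a) hopf_scheme \<Rightarrow> 'h set \<Rightarrow> bool"
  where "right_normal K H X \<longleftrightarrow> submodule X K H \<and>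
     (\<forall>a\<in>X. \<forall>h\<in>carrier H.
        tensor_lift K H (\<lambda>x y. antipode H x \<otimes>\<^bsub>H\<^esub> a \<otimes>\<^bsub>H\<^esub> y) (comult H h) \<in> X)"

text \<open>
  A Hopf subalgebra as a Hopf algebra in its own right: its comultiplication takes values in
  \<open>X \<otimes> X\<close>, and not in the subspace of \<open>H \<otimes> H\<close> with which this tensor product is identified.
\<close>

definition sub_hopf ::
  "('k, 'z) ring_scheme \<Rightarrow> ('k, 'h) hopf \<Rightarrow> 'h set \<Rightarrow> ('k, 'h) hopf"
  where "sub_hopf K H X = H\<lparr>carrier := X,
     comult := (\<lambda>x. inv_into (carrier (tensor K (H\<lparr>carrier := X\<rparr>) (H\<lparr>carrier := X\<rparr>)))
                      (tensor_map K H H id id) (comult H x))\<rparr>"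

definition augmentation :: "('k, 'z) ring_scheme \<Rightarrow> ('k, 'h, 'a) hopf_scheme \<Rightarrow> 'h set \<Rightarrow> 'h set"
  where "augmentation K H X = {x \<in> X. counit H x = \<zero>\<^bsub>K\<^esub>}"

text \<open>\<open>H X\<^sup>+\<close>, the set of all finite sums of products.\<close>

definition aug_ideal :: "('k, 'z) ring_scheme \<Rightarrow> ('k, 'h, 'a) hopf_scheme \<Rightarrow> 'h set \<Rightarrow> 'h set"
  where "aug_ideal K H X = carrier H \<cdot>\<^bsub>H\<^esub> augmentation K H X"

definition quot_map :: "('k, 'z) ring_scheme \<Rightarrow> ('k, 'h, 'a) hopf_scheme \<Rightarrow> 'h set \<Rightarrow> 'h \<Rightarrow> 'h set"
  where "quot_map K H X h = aug_ideal K H X +>\<^bsub>H\<^esub> h"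

text \<open>\<open>H / H X\<^sup>+\<close> with the structure induced from \<open>H\<close>.\<close>

definition quot_hopf ::
  "('k, 'z) ring_scheme \<Rightarrow> ('k, 'h, 'a) hopf_scheme \<Rightarrow> 'h set \<Rightarrow> ('k, 'h set) hopf"
  where "quot_hopf K H X =
    (let Q = quot_space H (aug_ideal K H X); \<pi> = quot_map K H X in
      \<lparr>carrier = carrier Q, mult = mult Q, one = \<one>\<^bsub>Q\<^esub>, zero = \<zero>\<^bsub>Q\<^esub>, add = add Q, smult = smult Q,
       comult = coset_lift (\<lambda>h. tensor_map K Q Q \<pi> \<pi> (comult H h)),
       counit = coset_lift (counit H),
       antipode = coset_lift (\<lambda>h. \<pi> (antipode H h))\<rparr>)"


section \<open>Faithful flatness and faithful coflatness\<close>

definition exact_at ::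
  "('k, 'l, 'a) module_scheme \<Rightarrow> ('k, 'm, 'b) module_scheme \<Rightarrow> ('k, 'n, 'c) module_scheme
    \<Rightarrow> ('l \<Rightarrow> 'm) \<Rightarrow> ('m \<Rightarrow> 'n) \<Rightarrow> bool"
  where "exact_at L M N f g \<longleftrightarrow> f ` carrier L = {x \<in> carrier M. g x = \<zero>\<^bsub>N\<^esub>}"

text \<open>
  Modules over a \<open>K\<close>-algebra \<open>S\<close>, which need not be commutative. Their \<open>K\<close>-space structure is the one
  obtained by restriction of scalars, by linearity of the action in the second variable.
\<close>

locale right_module = S: assoc_algebra K S + M: module K M
  for K :: "('k, 'z) ring_scheme" and S :: "('k, 's, 'a) module_scheme"
    and M :: "('k, 'm, 'b) module_scheme" and act :: "'m \<Rightarrow> 's \<Rightarrow> 'm" +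
  assumes act_linear_left: "s \<in> carrier S \<Longrightarrow> (\<lambda>x. act x s) \<in> lin_maps K M M"
    and act_linear_right: "x \<in> carrier M \<Longrightarrow> act x \<in> lin_maps K S M"
    and act_mult: "\<lbrakk>x \<in> carrier M; s \<in> carrier S; t \<in> carrier S\<rbrakk>
      \<Longrightarrow> act x (s \<otimes>\<^bsub>S\<^esub> t) = act (act x s) t"
    and act_one: "x \<in> carrier M \<Longrightarrow> act x \<one>\<^bsub>S\<^esub> = x"

definition right_module_hom ::
  "('k, 'z) ring_scheme \<Rightarrow> ('k, 's, 'a) module_scheme
    \<Rightarrow> ('k, 'm, 'b) module_scheme \<Rightarrow> ('m \<Rightarrow> 's \<Rightarrow> 'm)
    \<Rightarrow> ('k, 'n, 'c) module_scheme \<Rightarrow> ('n \<Rightarrow> 's \<Rightarrow> 'n) \<Rightarrow> ('m \<Rightarrow> 'n) set"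
  where "right_module_hom K S M r N r' = {f. f \<in> lin_maps K M N
     \<and> (\<forall>x\<in>carrier M. \<forall>s\<in>carrier S. f (r x s) = r' (f x) s)}"

text \<open>\<open>M \<otimes>\<^sub>S N\<close> for a right action \<open>r\<close> on \<open>M\<close> and a left action \<open>l\<close> on \<open>N\<close>.\<close>

definition balanced_rel ::
  "('k, 'z) ring_scheme \<Rightarrow> ('k, 's, 'a) module_scheme
    \<Rightarrow> ('k, 'm, 'b) module_scheme \<Rightarrow> ('m \<Rightarrow> 's \<Rightarrow> 'm)
    \<Rightarrow> ('k, 'n, 'c) module_scheme \<Rightarrow> ('s \<Rightarrow> 'n \<Rightarrow> 'n) \<Rightarrow> ('m \<times> 'n \<Rightarrow> 'k) set set"
  where "balanced_rel K S M r N l = subspace_span K (tensor K M N)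
     {pure_tensor K M N (r x s) y \<ominus>\<^bsub>tensor K M N\<^esub> pure_tensor K M N x (l s y) | x s y.
        x \<in> carrier M \<and> s \<in> carrier S \<and> y \<in> carrier N}"

definition balanced_tensor ::
  "('k, 'z) ring_scheme \<Rightarrow> ('k, 's, 'a) module_scheme
    \<Rightarrow> ('k, 'm, 'b) module_scheme \<Rightarrow> ('m \<Rightarrow> 's \<Rightarrow> 'm)
    \<Rightarrow> ('k, 'n, 'c) module_scheme \<Rightarrow> ('s \<Rightarrow> 'n \<Rightarrow> 'n) \<Rightarrow> ('k, ('m \<times> 'n \<Rightarrow> 'k) set set) module"
  where "balanced_tensor K S M r N l = quot_space (tensor K M N) (balanced_rel K S M r N l)"

text \<open>\<open>f \<otimes>\<^sub>S id\<close>, as a map into \<open>M \<otimes>\<^sub>S N\<close>.\<close>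

definition balanced_map ::
  "('k, 'z) ring_scheme \<Rightarrow> ('k, 's, 'a) module_scheme
    \<Rightarrow> ('k, 'm, 'b) module_scheme \<Rightarrow> ('m \<Rightarrow> 's \<Rightarrow> 'm)
    \<Rightarrow> ('k, 'n, 'c) module_scheme \<Rightarrow> ('s \<Rightarrow> 'n \<Rightarrow> 'n) \<Rightarrow> ('x \<Rightarrow> 'm)
    \<Rightarrow> ('x \<times> 'n \<Rightarrow> 'k) set set \<Rightarrow> ('m \<times> 'n \<Rightarrow> 'k) set set"
  where "balanced_map K S M r N l f =
    coset_lift (\<lambda>t. balanced_rel K S M r N l +>\<^bsub>tensor K M N\<^esub> tensor_map K M N f id t)"

text \<open>
  The left \<open>S\<close>-module \<open>N\<close> is faithfully flat if tensoring with \<open>N\<close> preserves and reflects exactness.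
  HOL has no quantifier over types, so the modules tested are those whose elements belong to a
  fixed type \<open>'u\<close>. This is faithful flatness as soon as every cyclic right \<open>S\<close>-module and every
  right ideal of \<open>S\<close> has an isomorphic copy in \<open>'u\<close>.
\<close>

definition faithfully_flat_left ::
  "'u itself \<Rightarrow> ('k, 'z) ring_scheme \<Rightarrow> ('k, 's, 'a) module_scheme
    \<Rightarrow> ('k, 'n, 'c) module_scheme \<Rightarrow> ('s \<Rightarrow> 'n \<Rightarrow> 'n) \<Rightarrow> bool"
  where "faithfully_flat_left _ K S N l \<longleftrightarrow>
    (\<forall>(M1 :: ('k, 'u) module) (M2 :: ('k, 'u) module) (M3 :: ('k, 'u) module) r1 r2 r3 f g.
       right_module K S M1 r1 \<and> right_module K S M2 r2 \<and> right_module K S M3 r3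
       \<and> f \<in> right_module_hom K S M1 r1 M2 r2 \<and> g \<in> right_module_hom K S M2 r2 M3 r3
       \<longrightarrow> (exact_at M1 M2 M3 f g \<longleftrightarrow>
            exact_at (balanced_tensor K S M1 r1 N l) (balanced_tensor K S M2 r2 N l)
              (balanced_tensor K S M3 r3 N l)
              (balanced_map K S M2 r2 N l f) (balanced_map K S M3 r3 N l g)))"

locale left_comodule = C: coalgebra K C + W: module K W
  for K :: "('k, 'z) ring_scheme" and C :: "('k, 'c, 'a) coalg_scheme"
    and W :: "('k, 'w, 'b) module_scheme" and coact :: "'w \<Rightarrow> ('c \<times> 'w \<Rightarrow> 'k) set" +
  assumes coact_linear: "coact \<in> lin_maps K W (tensor K C W)"
    and coact_coassoc: "w \<in> carrier W \<Longrightarrow>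
      tensor_assoc K C C W (tensor_map K (tensor K C C) W (comult C) id (coact w))
        = tensor_map K C (tensor K C W) id coact (coact w)"
    and coact_counit: "w \<in> carrier W \<Longrightarrow>
      tensor_lift K W (\<lambda>c x. counit C c \<odot>\<^bsub>W\<^esub> x) (coact w) = w"

definition left_comodule_hom ::
  "('k, 'z) ring_scheme \<Rightarrow> ('k, 'c, 'a) coalg_scheme
    \<Rightarrow> ('k, 'v, 'b) module_scheme \<Rightarrow> ('v \<Rightarrow> ('c \<times> 'v \<Rightarrow> 'k) set)
    \<Rightarrow> ('k, 'w, 'd) module_scheme \<Rightarrow> ('w \<Rightarrow> ('c \<times> 'w \<Rightarrow> 'k) set) \<Rightarrow> ('v \<Rightarrow> 'w) set"
  where "left_comodule_hom K C V \<delta> W \<delta>' = {f. f \<in> lin_maps K V W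
     \<and> (\<forall>x\<in>carrier V. \<delta>' (f x) = tensor_map K C W id f (\<delta> x))}"

text \<open>
  The cotensor product over \<open>C\<close> of a right comodule \<open>V\<close> with coaction \<open>\<rho>\<close> and a left comodule \<open>W\<close> with
  coaction \<open>\<delta>\<close>: the equalizer of \<open>\<rho> \<otimes> id\<close> and \<open>id \<otimes> \<delta>\<close> on \<open>V \<otimes> W\<close>.
\<close>

definition cotensor ::
  "('k, 'z) ring_scheme \<Rightarrow> ('k, 'c, 'a) coalg_scheme
    \<Rightarrow> ('k, 'v, 'b) module_scheme \<Rightarrow> ('v \<Rightarrow> ('v \<times> 'c \<Rightarrow> 'k) set)
    \<Rightarrow> ('k, 'w, 'd) module_scheme \<Rightarrow> ('w \<Rightarrow> ('c \<times> 'w \<Rightarrow> 'k) set)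
    \<Rightarrow> ('k, ('v \<times> 'w \<Rightarrow> 'k) set) module"
  where "cotensor K C V \<rho> W \<delta> = (tensor K V W)\<lparr>carrier :=
     {t \<in> carrier (tensor K V W).
        tensor_assoc K V C W (tensor_map K (tensor K V C) W \<rho> id t)
          = tensor_map K V (tensor K C W) id \<delta> t}\<rparr>"

text \<open>
  As for faithful flatness, the left comodules tested are those whose elements belong to \<open>'u\<close>. This is
  faithful coflatness as soon as every finite-dimensional \<open>K\<close>-space has an isomorphic copy in \<open>'u\<close>.
\<close>

definition faithfully_coflat_right ::
  "'u itself \<Rightarrow> ('k, 'z) ring_scheme \<Rightarrow> ('k, 'c, 'a) coalg_scheme
    \<Rightarrow> ('k, 'v, 'b) module_scheme \<Rightarrow> ('v \<Rightarrow> ('v \<times> 'c \<Rightarrow> 'k) set) \<Rightarrow> bool"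
  where "faithfully_coflat_right _ K C V \<rho> \<longleftrightarrow>
    (\<forall>(W1 :: ('k, 'u) module) (W2 :: ('k, 'u) module) (W3 :: ('k, 'u) module) \<delta>1 \<delta>2 \<delta>3 f g.
       left_comodule K C W1 \<delta>1 \<and> left_comodule K C W2 \<delta>2 \<and> left_comodule K C W3 \<delta>3
       \<and> f \<in> left_comodule_hom K C W1 \<delta>1 W2 \<delta>2 \<and> g \<in> left_comodule_hom K C W2 \<delta>2 W3 \<delta>3
       \<longrightarrow> (exact_at W1 W2 W3 f g \<longleftrightarrow>
            exact_at (cotensor K C V \<rho> W1 \<delta>1) (cotensor K C V \<rho> W2 \<delta>2) (cotensor K C V \<rho> W3 \<delta>3)
              (tensor_map K V W2 id f) (tensor_map K V W3 id g)))"

text \<open>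
  The test modules and comodules below have their elements in \<open>(nat \<Rightarrow> 'h) set\<close>. Up to
  isomorphism, these include all quotients of submodules of \<open>B\<^sup>n\<close>, as sets of sequences supported in
  the first \<open>n\<close> places, and all finite-dimensional spaces, since \<open>K\<close> embeds into \<open>H\<close>.
\<close>

definition faithfully_flat_over ::
  "('k, 'z) ring_scheme \<Rightarrow> ('k, 'h) hopf \<Rightarrow> 'h set \<Rightarrow> bool"
  where "faithfully_flat_over K H B \<longleftrightarrow>
    faithfully_flat_left TYPE((nat \<Rightarrow> 'h) set) K (H\<lparr>carrier := B\<rparr>) H (mult H)"

text \<open>\<open>A\<close> is a right comodule over \<open>\<pi>\<^sub>B(A)\<close> via \<open>(id \<otimes> \<pi>\<^sub>B) \<Delta>\<close>.\<close>

definition faithfully_coflat_over_image ::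
  "('k, 'z) ring_scheme \<Rightarrow> ('k, 'h) hopf \<Rightarrow> 'h set \<Rightarrow> 'h set \<Rightarrow> bool"
  where "faithfully_coflat_over_image K H A B \<longleftrightarrow>
    (let A' = sub_hopf K H A;
         D = sub_hopf K (quot_hopf K H B) (quot_map K H B ` A)
     in faithfully_coflat_right TYPE((nat \<Rightarrow> 'h) set) K D A'
          (\<lambda>a. tensor_map K A' D id (quot_map K H B) (comult A' a)))"

end

theory Submission
  imports Defs
begin

text \<open>
  Write \<open>I\<close> for \<open>HB\<^sup>+\<close> and \<open>\<pi>\<close> for the projection \<open>H \<rightarrow> H/I\<close>.

  \<^emph>\<open>The ideal is a Hopf ideal.\<close> It is a right ideal because \<open>b h = h\<^sub>1 (S(h\<^sub>2) b h\<^sub>3)\<close> and the bracket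
  lies in \<open>B\<^sup>+\<close> by right normality (\<open>aug_mult_mem\<close>). As \<open>\<Delta>(b)\<close> lies in \<open>B \<otimes> H\<close> and \<open>\<pi>(c) = \<epsilon>(c) 1\<close> for
  \<open>c \<in> B\<close>, it is \<open>1 \<otimes> b\<close> modulo \<open>I \<otimes> H\<close>; so \<open>I\<close> is a coideal (\<open>I_comult\<close>), and the antipode axiom gives
  \<open>\<pi>(S(b)) = \<epsilon>(b) 1\<close> (\<open>antipode_aug\<close>). With the anti-multiplicativity of \<open>S\<close> (\<open>antipode_mult\<close>), \<open>S\<close>
  preserves \<open>I\<close>. The Hopf axioms of \<open>H/I\<close> are the images of those of \<open>H\<close> (\<open>hopf_algebra_image\<close>), and
  \<open>\<pi>(A)\<close> inherits its properties from \<open>A\<close>. Conversely a Hopf subalgebra satisfies the axioms because it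
  embeds and, over a field, its tensor powers embed too (\<open>hopf_algebra_preimage\<close>).

  \<^emph>\<open>Isomorphisms.\<close> Two surjections of Hopf algebras with the same source and the same kernel have
  isomorphic targets (\<open>hopf_iso_of_same_kernel\<close>). In part (i), \<open>\<pi>(A)\<^sup>+ = \<pi>(A\<^sup>+)\<close> because \<open>\<epsilon> = \<epsilon> \<circ> \<pi>\<close>, hence
  \<open>(H/I) \<pi>(A)\<^sup>+\<close> is the image of \<open>HA\<^sup>+\<close>, which contains \<open>I\<close>; the two maps out of \<open>H\<close> thus have kernel
  \<open>HA\<^sup>+\<close>.

  \<^emph>\<open>Part (ii)\<close> amounts to \<open>A \<inter> HB\<^sup>+ \<subseteq> AB\<^sup>+\<close> (\<open>flat_kernel\<close>). By flatness of \<open>H\<close> as a left \<open>B\<close>-module,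
  \<open>A \<otimes>\<^sub>B H \<rightarrow> H \<otimes>\<^sub>B H\<close> is injective. For \<open>a \<in> A\<close> consider \<open>t = a\<^sub>1 \<otimes> S(a\<^sub>2)\<close> in \<open>A \<otimes>\<^sub>B H\<close>. The map
  \<open>x \<mapsto> x\<^sub>1 \<otimes> S(x\<^sub>2)\<close> from \<open>H\<close> to \<open>H \<otimes>\<^sub>B H\<close> kills \<open>HB\<^sup>+\<close>: for \<open>x = hb\<close> its value is
  \<open>h\<^sub>1 b\<^sub>1 \<otimes> S(b\<^sub>2) S(h\<^sub>2) = h\<^sub>1 \<otimes> b\<^sub>1 S(b\<^sub>2) S(h\<^sub>2) = \<epsilon>(b) h\<^sub>1 \<otimes> S(h\<^sub>2)\<close>, where \<open>b\<^sub>1 \<in> B\<close> moves across the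
  tensor sign. So if \<open>a \<in> HB\<^sup>+\<close>, then \<open>t\<close> has image zero and is itself zero. The map
  \<open>x \<otimes> h \<mapsto> \<epsilon>(h) x\<close> from \<open>A \<otimes>\<^sub>B H\<close> to \<open>A/AB\<^sup>+\<close> is well defined and sends \<open>t\<close> to the class of \<open>a\<close>,
  whence \<open>a \<in> AB\<^sup>+\<close>.

  \<^emph>\<open>Computation with tensors.\<close> A Sweedler sum of \<open>\<beta>(h\<^sub>1, h\<^sub>2)\<close> is \<^term>\<open>tensor_lift K P \<beta> (comult H h)\<close>.
  Everything rests on the universal property of \<^const>\<open>tensor\<close>: a bilinear map has a linear lift with the
  expected values on pure tensors, and linear maps that agree on pure tensors are equal.
\<close>

section \<open>Linear maps and subspaces\<close>

lemma lin_mapsI: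
  assumes "\<And>x. x \<in> carrier M \<Longrightarrow> f x \<in> carrier N"
    and "\<And>x y. x \<in> carrier M \<Longrightarrow> y \<in> carrier M \<Longrightarrow> f (x \<oplus>\<^bsub>M\<^esub> y) = f x \<oplus>\<^bsub>N\<^esub> f y"
    and "\<And>a x. a \<in> carrier K \<Longrightarrow> x \<in> carrier M \<Longrightarrow> f (a \<odot>\<^bsub>M\<^esub> x) = a \<odot>\<^bsub>N\<^esub> f x"
  shows "f \<in> lin_maps K M N"
  using assms unfolding lin_maps_def by auto

lemma lin_closed: "f \<in> lin_maps K M N \<Longrightarrow> x \<in> carrier M \<Longrightarrow> f x \<in> carrier N"
  and lin_add: "f \<in> lin_maps K M N \<Longrightarrow> x \<in> carrier M \<Longrightarrow> y \<in> carrier M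
      \<Longrightarrow> f (x \<oplus>\<^bsub>M\<^esub> y) = f x \<oplus>\<^bsub>N\<^esub> f y"
  and lin_smult: "f \<in> lin_maps K M N \<Longrightarrow> a \<in> carrier K \<Longrightarrow> x \<in> carrier M
      \<Longrightarrow> f (a \<odot>\<^bsub>M\<^esub> x) = a \<odot>\<^bsub>N\<^esub> f x"
  unfolding lin_maps_def by auto

lemma module_zero_closed: "module K M \<Longrightarrow> \<zero>\<^bsub>M\<^esub> \<in> carrier M"
  and module_add_closed: "module K M \<Longrightarrow> x \<in> carrier M \<Longrightarrow> y \<in> carrier M \<Longrightarrow> x \<oplus>\<^bsub>M\<^esub> y \<in> carrier M"
  and module_smult_closed: "module K M \<Longrightarrow> a \<in> carrier K \<Longrightarrow> x \<in> carrier M \<Longrightarrow> a \<odot>\<^bsub>M\<^esub> x \<in> carrier M"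
  and module_uminus_closed: "module K M \<Longrightarrow> x \<in> carrier M \<Longrightarrow> \<ominus>\<^bsub>M\<^esub> x \<in> carrier M"
  and module_minus_closed: "module K M \<Longrightarrow> x \<in> carrier M \<Longrightarrow> y \<in> carrier M \<Longrightarrow> x \<ominus>\<^bsub>M\<^esub> y \<in> carrier M"
  and module_abelian_group: "module K M \<Longrightarrow> abelian_group M"
proof -
  assume "module K M"
  then interpret M: module K M .
  show "\<zero>\<^bsub>M\<^esub> \<in> carrier M" "abelian_group M"
    "x \<in> carrier M \<Longrightarrow> y \<in> carrier M \<Longrightarrow> x \<oplus>\<^bsub>M\<^esub> y \<in> carrier M"
    "x \<in> carrier M \<Longrightarrow> \<ominus>\<^bsub>M\<^esub> x \<in> carrier M"
    "x \<in> carrier M \<Longrightarrow> y \<in> carrier M \<Longrightarrow> x \<ominus>\<^bsub>M\<^esub> y \<in> carrier M"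
    "a \<in> carrier K \<Longrightarrow> x \<in> carrier M \<Longrightarrow> a \<odot>\<^bsub>M\<^esub> x \<in> carrier M"
    by (simp_all add: M.abelian_group_axioms)
qed

lemma module_eq_iff_minus:
  assumes "module K M" "x \<in> carrier M" "y \<in> carrier M"
  shows "x = y \<longleftrightarrow> x \<ominus>\<^bsub>M\<^esub> y = \<zero>\<^bsub>M\<^esub>"
proof -
  interpret M: module K M by fact
  show ?thesis using assms(2,3) 
    by (metis a_minus_def M.add.inv_closed M.minus_equality M.minus_minus M.r_neg)
qed

lemma module_diff_add:
  assumes "module K M" "x \<in> carrier M" "y \<in> carrier M"
  shows "(x \<ominus>\<^bsub>M\<^esub> y) \<oplus>\<^bsub>M\<^esub> y = x"
proof -
  interpret M: module K M by fact
  show ?thesis using assms(2,3)  by (simp add: a_minus_def M.a_assoc M.l_neg)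
qed

lemma lin_zero:
  assumes "module K M" "module K N" "f \<in> lin_maps K M N"
  shows "f \<zero>\<^bsub>M\<^esub> = \<zero>\<^bsub>N\<^esub>"
proof -
  interpret M: module K M by fact
  interpret N: module K N by fact
  have "f (\<zero>\<^bsub>K\<^esub> \<odot>\<^bsub>M\<^esub> \<zero>\<^bsub>M\<^esub>) = \<zero>\<^bsub>K\<^esub> \<odot>\<^bsub>N\<^esub> f \<zero>\<^bsub>M\<^esub>"
    using assms(3) by (simp add: lin_smult del: M.smult_l_null M.smult_r_null)
  then show ?thesis using lin_closed[OF assms(3)] by simp
qed

lemma lin_uminus:
  assumes "module K M" "module K N" "f \<in> lin_maps K M N" "x \<in> carrier M"
  shows "f (\<ominus>\<^bsub>M\<^esub> x) = \<ominus>\<^bsub>N\<^esub> f x"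
proof -
  interpret M: module K M by fact
  interpret N: module K N by fact
  have "f (\<ominus>\<^bsub>M\<^esub> x) \<oplus>\<^bsub>N\<^esub> f x = \<zero>\<^bsub>N\<^esub>"
    using assms(4) lin_add[OF assms(3), of "\<ominus>\<^bsub>M\<^esub> x" x] lin_zero[OF assms(1-3)] by (simp add: M.l_neg)
  then show ?thesis using assms(4) lin_closed[OF assms(3)] by (metis M.add.inv_closed N.minus_equality)
qed

lemma lin_minus:
  assumes "module K M" "module K N" "f \<in> lin_maps K M N" "x \<in> carrier M" "y \<in> carrier M"
  shows "f (x \<ominus>\<^bsub>M\<^esub> y) = f x \<ominus>\<^bsub>N\<^esub> f y"
  using assms by (simp add: a_minus_def lin_add lin_uminus module_uminus_closed)

lemma lin_id: "(\<lambda>x. x) \<in> lin_maps K M M"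
  by (rule lin_mapsI) auto

lemma lin_comp: "g \<in> lin_maps K N P \<Longrightarrow> f \<in> lin_maps K M N \<Longrightarrow> (\<lambda>x. g (f x)) \<in> lin_maps K M P"
  by (rule lin_mapsI) (auto simp: lin_closed lin_add lin_smult)

lemma lin_cong: "f \<in> lin_maps K M N \<Longrightarrow> module K M \<Longrightarrow> (\<And>x. x \<in> carrier M \<Longrightarrow> f x = g x) \<Longrightarrow> g \<in> lin_maps K M N"
  by (rule lin_mapsI) (metis lin_closed lin_add lin_smult module_add_closed module_smult_closed)+

lemma submodule_subset: "submodule V K M \<Longrightarrow> V \<subseteq> carrier M"
  by (metis partial_object.select_convs(1) submodule_def subgroup_def)

lemma submodule_memD:
  assumes "submodule V K M"
  shows "x \<in> V \<Longrightarrow> x \<in> carrier M"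
    and "\<zero>\<^bsub>M\<^esub> \<in> V"
    and "x \<in> V \<Longrightarrow> y \<in> V \<Longrightarrow> x \<oplus>\<^bsub>M\<^esub> y \<in> V"
    and "a \<in> carrier K \<Longrightarrow> x \<in> V \<Longrightarrow> a \<odot>\<^bsub>M\<^esub> x \<in> V"
    and "x \<in> V \<Longrightarrow> \<ominus>\<^bsub>M\<^esub> x \<in> V"
    and "x \<in> V \<Longrightarrow> y \<in> V \<Longrightarrow> x \<ominus>\<^bsub>M\<^esub> y \<in> V"
proof -
  have sg: "subgroup V (add_monoid M)" and sm: "\<And>a x. a \<in> carrier K \<Longrightarrow> x \<in> V \<Longrightarrow> a \<odot>\<^bsub>M\<^esub> x \<in> V"
    using assms by (auto simp: submodule_def submodule_axioms_def)
  show "x \<in> V \<Longrightarrow> x \<in> carrier M" using submodule_subset[OF assms] by auto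
  show "\<zero>\<^bsub>M\<^esub> \<in> V" using subgroup.one_closed[OF sg] by simp
  show add: "x \<in> V \<Longrightarrow> y \<in> V \<Longrightarrow> x \<oplus>\<^bsub>M\<^esub> y \<in> V" for x y using subgroup.m_closed[OF sg] by simp
  show inv: "x \<in> V \<Longrightarrow> \<ominus>\<^bsub>M\<^esub> x \<in> V" for x using subgroup.m_inv_closed[OF sg] by (simp add: a_inv_def)
  show "x \<in> V \<Longrightarrow> y \<in> V \<Longrightarrow> x \<ominus>\<^bsub>M\<^esub> y \<in> V" using add inv by (simp add: a_minus_def)
  show "a \<in> carrier K \<Longrightarrow> x \<in> V \<Longrightarrow> a \<odot>\<^bsub>M\<^esub> x \<in> V" by (rule sm)
qed

text \<open>
  Over a module, negatives need no separate condition: they are multiples by \<open>-1\<close>.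
\<close>

lemma submodule_by_closure:
  assumes "module K M" "V \<subseteq> carrier M" "\<zero>\<^bsub>M\<^esub> \<in> V"
    and "\<And>x y. x \<in> V \<Longrightarrow> y \<in> V \<Longrightarrow> x \<oplus>\<^bsub>M\<^esub> y \<in> V"
    and "\<And>a x. a \<in> carrier K \<Longrightarrow> x \<in> V \<Longrightarrow> a \<odot>\<^bsub>M\<^esub> x \<in> V"
  shows "submodule V K M"
proof -
  interpret M: module K M by fact
  have neg: "\<ominus>\<^bsub>M\<^esub> x \<in> V" if "x \<in> V" for x
  proof -
    have x: "x \<in> carrier M" using that assms(2) by auto
    have "(\<ominus>\<^bsub>K\<^esub> \<one>\<^bsub>K\<^esub>) \<odot>\<^bsub>M\<^esub> x = \<ominus>\<^bsub>M\<^esub> x" using x by (simp add: M.smult_l_minus)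
    then show ?thesis using assms(5)[of "\<ominus>\<^bsub>K\<^esub> \<one>\<^bsub>K\<^esub>" x] that by simp
  qed
  show ?thesis by (rule M.submoduleI) (use assms neg in auto)
qed

lemma submodule_preimage:
  assumes "module K M" "module K N" "f \<in> lin_maps K M N" "submodule V K N"
  shows "submodule {x \<in> carrier M. f x \<in> V} K M"
proof (rule submodule_by_closure[OF assms(1)])
  show "\<zero>\<^bsub>M\<^esub> \<in> {x \<in> carrier M. f x \<in> V}"
    using assms by (simp add: module_zero_closed lin_zero submodule_memD)
qed (use assms in \<open>auto simp: lin_add lin_smult module_add_closed module_smult_closed submodule_memD\<close>)

lemma submodule_image:
  assumes "module K M" "module K N" "f \<in> lin_maps K M N" "submodule V K M"
  shows "submodule (f ` V) K N"
proof (rule submodule_by_closure[OF assms(2)])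
  have V: "\<And>x. x \<in> V \<Longrightarrow> x \<in> carrier M" using submodule_memD[OF assms(4)] by auto
  show "f ` V \<subseteq> carrier N" using V lin_closed[OF assms(3)] by auto
  show "\<zero>\<^bsub>N\<^esub> \<in> f ` V" using submodule_memD(2)[OF assms(4)] lin_zero[OF assms(1-3)] by (metis imageI)
  show "x \<oplus>\<^bsub>N\<^esub> y \<in> f ` V" if "x \<in> f ` V" "y \<in> f ` V" for x y
    using that V lin_add[OF assms(3)] submodule_memD(3)[OF assms(4)] by (smt (verit) image_iff)
  show "a \<odot>\<^bsub>N\<^esub> x \<in> f ` V" if "a \<in> carrier K" "x \<in> f ` V" for a x
    using that V lin_smult[OF assms(3)] submodule_memD(4)[OF assms(4)] by (smt (verit) image_iff)
qed

lemma submodule_zero: "module K M \<Longrightarrow> submodule {\<zero>\<^bsub>M\<^esub>} K M"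
proof -
  assume "module K M"
  then interpret M: module K M .
  show ?thesis by (rule submodule_by_closure[OF M.module_axioms]) auto
qed

lemma submodule_span:
  assumes "module K M" "X \<subseteq> carrier M"
  shows "submodule (subspace_span K M X) K M"
proof -
  interpret M: module K M by fact
  let ?F = "{t. submodule t K M \<and> X \<subseteq> t}"
  have c: "carrier M \<in> ?F" using M.carrier_is_submodule assms(2) by auto
  show ?thesis unfolding subspace_span_def hull_def
  proof (rule submodule_by_closure[OF assms(1)])
    show "\<Inter>?F \<subseteq> carrier M" using c by blast
  qed (auto simp: submodule_memD)
qed

lemma span_superset: "X \<subseteq> subspace_span K M X"
  unfolding subspace_span_def by (rule hull_subset)

lemma span_minimal: "X \<subseteq> V \<Longrightarrow> submodule V K M \<Longrightarrow> subspace_span K M X \<subseteq> V"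
  unfolding subspace_span_def by (rule hull_minimal)


section \<open>Quotient spaces\<close>

lemma submodule_abelian_subgroup:
  assumes "module K M" "submodule N K M"
  shows "abelian_subgroup N M"
  using assms by (meson abelian_subgroupI3 additive_subgroup.intro module_abelian_group submodule.axioms(1))

lemma coset_eq_iff:
  assumes "module K M" "submodule N K M" "x \<in> carrier M" "y \<in> carrier M"
  shows "N +>\<^bsub>M\<^esub> x = N +>\<^bsub>M\<^esub> y \<longleftrightarrow> x \<ominus>\<^bsub>M\<^esub> y \<in> N"
proof -
  interpret N: abelian_subgroup N M by (rule submodule_abelian_subgroup) fact+
  show ?thesis
    using assms(3,4) N.a_rcos_module[of y x] N.a_rcos_self[of x]
    by (auto simp: a_minus_def dest: N.a_repr_independence')
qed

lemma coset_zero_iff: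
  assumes "module K M" "submodule N K M" "x \<in> carrier M"
  shows "N +>\<^bsub>M\<^esub> x = N \<longleftrightarrow> x \<in> N"
proof -
  interpret N: abelian_subgroup N M by (rule submodule_abelian_subgroup) fact+
  show ?thesis
    using assms(3) N.a_rcos_self[OF assms(3)] N.a_coset_join2[OF assms(3)] 
    by (metis N.is_additive_subgroup additive_subgroup.a_subgroup)
qed

lemma the_elem_image_const: "X \<noteq> {} \<Longrightarrow> (\<And>y. y \<in> X \<Longrightarrow> \<phi> y = c) \<Longrightarrow> coset_lift \<phi> X = c"
  unfolding coset_lift_def by (metis (no_types, lifting) image_constant_conv image_cong the_elem_eq)

lemma coset_mem_iff:
  assumes "module K M" "submodule N K M" "x \<in> carrier M"
  shows "y \<in> N +>\<^bsub>M\<^esub> x \<longleftrightarrow> y \<in> carrier M \<and> y \<ominus>\<^bsub>M\<^esub> x \<in> N"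
proof -
  interpret N: abelian_subgroup N M by (rule submodule_abelian_subgroup) fact+
  show ?thesis
    using assms(3) N.a_rcos_module[of x y] N.a_elemrcos_carrier[of x y]
    by (auto simp: a_minus_def)
qed

lemma coset_lift_coset:
  assumes "module K M" "submodule N K M" "x \<in> carrier M"
    and "\<And>y. y \<in> carrier M \<Longrightarrow> y \<ominus>\<^bsub>M\<^esub> x \<in> N \<Longrightarrow> \<phi> y = \<phi> x"
  shows "coset_lift \<phi> (N +>\<^bsub>M\<^esub> x) = \<phi> x"
proof (rule the_elem_image_const)
  have "x \<in> N +>\<^bsub>M\<^esub> x"
    using assms abelian_subgroup.a_rcos_self submodule_abelian_subgroup by metis
  then show "N +>\<^bsub>M\<^esub> x \<noteq> {}" by auto
qed (use assms coset_mem_iff[OF assms(1-3)] in auto)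

lemma quot_space_carrier: "carrier (quot_space M N) = (\<lambda>x. N +>\<^bsub>M\<^esub> x) ` carrier M"
  by (auto simp: quot_space_def FactRing_def A_RCOSETS_def' a_r_coset_def')

lemma quot_space_zero: "\<zero>\<^bsub>quot_space M N\<^esub> = N"
  by (simp add: quot_space_def FactRing_def)

lemma quot_space_coset_closed: "x \<in> carrier M \<Longrightarrow> N +>\<^bsub>M\<^esub> x \<in> carrier (quot_space M N)"
  by (simp add: quot_space_carrier)

lemma quot_space_add:
  assumes "module K M" "submodule N K M" "x \<in> carrier M" "y \<in> carrier M"
  shows "(N +>\<^bsub>M\<^esub> x) \<oplus>\<^bsub>quot_space M N\<^esub> (N +>\<^bsub>M\<^esub> y) = N +>\<^bsub>M\<^esub> (x \<oplus>\<^bsub>M\<^esub> y)"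
proof -
  interpret N: abelian_subgroup N M by (rule submodule_abelian_subgroup) fact+
  show ?thesis using N.a_rcos_sum[OF assms(3,4)] by (simp add: quot_space_def FactRing_def)
qed

lemma quot_space_smult:
  assumes "module K M" "submodule N K M" "a \<in> carrier K" "x \<in> carrier M"
  shows "a \<odot>\<^bsub>quot_space M N\<^esub> (N +>\<^bsub>M\<^esub> x) = N +>\<^bsub>M\<^esub> (a \<odot>\<^bsub>M\<^esub> x)"
proof -
  interpret M: module K M by fact
  have "N +>\<^bsub>M\<^esub> (a \<odot>\<^bsub>M\<^esub> y) = N +>\<^bsub>M\<^esub> (a \<odot>\<^bsub>M\<^esub> x)" if "y \<in> carrier M" "y \<ominus>\<^bsub>M\<^esub> x \<in> N" for y
  proof -
    have "a \<odot>\<^bsub>M\<^esub> y \<ominus>\<^bsub>M\<^esub> a \<odot>\<^bsub>M\<^esub> x = a \<odot>\<^bsub>M\<^esub> (y \<ominus>\<^bsub>M\<^esub> x)"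
      using that assms by (simp add: a_minus_def M.smult_r_distr M.smult_r_minus)
    then show ?thesis
      using that assms submodule_memD(4)[OF assms(2,3) that(2)] by (subst coset_eq_iff[OF assms(1,2)]) auto
  qed
  then show ?thesis
    using coset_lift_coset[OF assms(1,2,4), of "\<lambda>x. N +>\<^bsub>M\<^esub> (a \<odot>\<^bsub>M\<^esub> x)"] by (simp add: quot_space_def)
qed

lemma module_quot_space:
  assumes "module K M" "submodule N K M"
  shows "module K (quot_space M N)"
proof -
  interpret M: module K M by fact
  note s = quot_space_add[OF assms] quot_space_smult[OF assms] quot_space_carrier
  have z: "\<zero>\<^bsub>quot_space M N\<^esub> = N +>\<^bsub>M\<^esub> \<zero>\<^bsub>M\<^esub>"
    using coset_zero_iff[OF assms M.zero_closed] submodule_memD(2)[OF assms(2)] by (simp add: quot_space_zero)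
  have inv: "\<exists>Y\<in>carrier (quot_space M N). Y \<oplus>\<^bsub>quot_space M N\<^esub> X = \<zero>\<^bsub>quot_space M N\<^esub>"
    if X: "X \<in> carrier (quot_space M N)" for X
  proof -
    obtain x where x: "X = N +>\<^bsub>M\<^esub> x" "x \<in> carrier M" using X by (auto simp: s)
    have "(N +>\<^bsub>M\<^esub> (\<ominus>\<^bsub>M\<^esub> x)) \<oplus>\<^bsub>quot_space M N\<^esub> X = \<zero>\<^bsub>quot_space M N\<^esub>"
      using x by (simp add: s z M.l_neg)
    then show ?thesis using x by (auto simp: s)
  qed
  show ?thesis
  proof (rule moduleI)
    show "abelian_group (quot_space M N)"
    proof (rule abelian_groupI)
      show "\<exists>Y\<in>carrier (quot_space M N). Y \<oplus>\<^bsub>quot_space M N\<^esub> X = \<zero>\<^bsub>quot_space M N\<^esub>"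
        if "X \<in> carrier (quot_space M N)" for X
        using that by (rule inv)
    qed (auto simp: s z M.a_ac)
  qed (auto simp: s M.smult_l_distr M.smult_r_distr M.smult_assoc1 M.R.is_cring)
qed

lemma coset_lin: "module K M \<Longrightarrow> submodule N K M \<Longrightarrow> (\<lambda>x. N +>\<^bsub>M\<^esub> x) \<in> lin_maps K M (quot_space M N)"
  by (rule lin_mapsI) (auto simp: quot_space_coset_closed quot_space_add quot_space_smult)

text \<open>
  Maps out of a quotient are obtained from this lemma throughout: the lift of a linear map that kills
  \<open>N\<close> does not depend on the representative.
\<close>

lemma lin_coset_lift:
  assumes "module K M" "submodule N K M" "module K P" "f \<in> lin_maps K M P"
    and "\<And>x. x \<in> N \<Longrightarrow> f x = \<zero>\<^bsub>P\<^esub>"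
  shows coset_lift_lin: "coset_lift f \<in> lin_maps K (quot_space M N) P"
    and coset_lift_value: "x \<in> carrier M \<Longrightarrow> coset_lift f (N +>\<^bsub>M\<^esub> x) = f x"
proof -
  have v: "coset_lift f (N +>\<^bsub>M\<^esub> x) = f x" if x: "x \<in> carrier M" for x
  proof (rule coset_lift_coset[OF assms(1,2) x])
    fix y assume y: "y \<in> carrier M" "y \<ominus>\<^bsub>M\<^esub> x \<in> N"
    then have "f y \<ominus>\<^bsub>P\<^esub> f x = \<zero>\<^bsub>P\<^esub>"
      using assms(5)[OF y(2)] lin_minus[OF assms(1,3,4) y(1) x] by simp
    then show "f y = f x"
      using module_eq_iff_minus[OF assms(3)] lin_closed[OF assms(4)] x y by blast
  qed
  show "coset_lift f (N +>\<^bsub>M\<^esub> x) = f x" if "x \<in> carrier M" using v that .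
  show "coset_lift f \<in> lin_maps K (quot_space M N) P"
    by (rule lin_mapsI)
      (use assms v in \<open>auto simp: quot_space_carrier quot_space_add[OF assms(1,2)]
        quot_space_smult[OF assms(1,2)] lin_closed lin_add lin_smult module_add_closed module_smult_closed\<close>)
qed

section \<open>The universal property of the tensor product\<close>

lemma free_space_simps:
  "carrier (free_space K X) = {f. f \<in> X \<rightarrow> carrier K \<and> (\<forall>x. x \<notin> X \<longrightarrow> f x = \<zero>\<^bsub>K\<^esub>) \<and> finite {x. f x \<noteq> \<zero>\<^bsub>K\<^esub>}}"
  "\<zero>\<^bsub>free_space K X\<^esub> = (\<lambda>x. \<zero>\<^bsub>K\<^esub>)"
  "f \<oplus>\<^bsub>free_space K X\<^esub> g = (\<lambda>x. f x \<oplus>\<^bsub>K\<^esub> g x)"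
  "a \<odot>\<^bsub>free_space K X\<^esub> f = (\<lambda>x. a \<otimes>\<^bsub>K\<^esub> f x)"
  by (simp_all add: free_space_def)

lemma free_space_val:
  assumes "cring K" "f \<in> carrier (free_space K X)"
  shows "f x \<in> carrier K"
proof -
  interpret K: cring K by fact
  show ?thesis using assms(2) by (cases "x \<in> X") (auto simp: free_space_simps)
qed

lemma module_free_space:
  assumes "cring K"
  shows "module K (free_space K X)"
proof -
  interpret K: cring K by fact
  let ?F = "free_space K X"
  note v = free_space_val[OF assms, of _ X]
  have add: "f \<oplus>\<^bsub>?F\<^esub> g \<in> carrier ?F" if "f \<in> carrier ?F" "g \<in> carrier ?F" for f g
  proof -
    have "finite {x. f x \<oplus>\<^bsub>K\<^esub> g x \<noteq> \<zero>\<^bsub>K\<^esub>}"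
      by (rule finite_subset[of _ "{x. f x \<noteq> \<zero>\<^bsub>K\<^esub>} \<union> {x. g x \<noteq> \<zero>\<^bsub>K\<^esub>}"])
        (use that in \<open>auto simp: free_space_simps\<close>)
    then show ?thesis using that by (auto simp: free_space_simps)
  qed
  have smult: "a \<odot>\<^bsub>?F\<^esub> f \<in> carrier ?F" if "a \<in> carrier K" "f \<in> carrier ?F" for a f
  proof -
    have "finite {x. a \<otimes>\<^bsub>K\<^esub> f x \<noteq> \<zero>\<^bsub>K\<^esub>}"
      by (rule finite_subset[of _ "{x. f x \<noteq> \<zero>\<^bsub>K\<^esub>}"]) (use that in \<open>auto simp: free_space_simps\<close>)
    then show ?thesis using that by (auto simp: free_space_simps)
  qed
  have zero: "\<zero>\<^bsub>?F\<^esub> \<in> carrier ?F" by (simp add: free_space_simps)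
  have neg: "\<exists>g\<in>carrier ?F. g \<oplus>\<^bsub>?F\<^esub> f = \<zero>\<^bsub>?F\<^esub>" if f: "f \<in> carrier ?F" for f
  proof
    show "(\<ominus>\<^bsub>K\<^esub> \<one>\<^bsub>K\<^esub>) \<odot>\<^bsub>?F\<^esub> f \<in> carrier ?F" using f by (intro smult) auto
    show "((\<ominus>\<^bsub>K\<^esub> \<one>\<^bsub>K\<^esub>) \<odot>\<^bsub>?F\<^esub> f) \<oplus>\<^bsub>?F\<^esub> f = \<zero>\<^bsub>?F\<^esub>"
      using v[OF f] by (simp add: free_space_simps K.l_minus K.l_neg)
  qed
  show ?thesis
  proof (rule moduleI)
    show "abelian_group ?F"
    proof (rule abelian_groupI)
      show "\<exists>g\<in>carrier ?F. g \<oplus>\<^bsub>?F\<^esub> f = \<zero>\<^bsub>?F\<^esub>" if "f \<in> carrier ?F" for f using neg that .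
    qed (use add zero v in \<open>auto simp: free_space_simps(2-4) K.a_ac\<close>)
  qed (use assms smult v in \<open>auto simp: free_space_simps(2-4) K.l_distr K.r_distr K.m_assoc\<close>)
qed

lemma basis_vec_closed:
  assumes "cring K" "x \<in> X"
  shows "basis_vec K x \<in> carrier (free_space K X)"
proof -
  interpret K: cring K by fact
  have "finite {y. basis_vec K x y \<noteq> \<zero>\<^bsub>K\<^esub>}"
    by (rule finite_subset[of _ "{x}"]) (auto simp: basis_vec_def)
  then show ?thesis using assms(2) by (auto simp: free_space_simps basis_vec_def)
qed

text \<open>
  Removing one point of the support at a time shows that the basis vectors span. Membership in a
  subspace is the form that applies both to kernels and to spans.
\<close>

lemma free_space_induct:
  assumes "cring K" "submodule V K (free_space K X)" "\<And>x. x \<in> X \<Longrightarrow> basis_vec K x \<in> V"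
    and "f \<in> carrier (free_space K X)"
  shows "f \<in> V"
proof -
  interpret K: cring K by fact
  have "finite S \<Longrightarrow> f \<in> carrier (free_space K X) \<Longrightarrow> {x. f x \<noteq> \<zero>\<^bsub>K\<^esub>} \<subseteq> S \<Longrightarrow> f \<in> V" for S f
  proof (induction S arbitrary: f rule: finite_induct)
    case empty
    then have "f = \<zero>\<^bsub>free_space K X\<^esub>" by (auto simp: free_space_simps)
    then show ?case using submodule_memD(2)[OF assms(2)] by simp
  next
    case (insert s S)
    note v = free_space_val[OF assms(1) insert.prems(1)]
    show ?case
    proof (cases "s \<in> X")
      case True
      let ?g = "f(s := \<zero>\<^bsub>K\<^esub>)"
      have "finite {x. ?g x \<noteq> \<zero>\<^bsub>K\<^esub>}"
        by (rule finite_subset[of _ "{x. f x \<noteq> \<zero>\<^bsub>K\<^esub>}"])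
          (use insert.prems(1) in \<open>auto simp: free_space_simps\<close>)
      then have "?g \<in> carrier (free_space K X)"
        using insert.prems(1) by (auto simp: free_space_simps)
      moreover have "{x. ?g x \<noteq> \<zero>\<^bsub>K\<^esub>} \<subseteq> S" using insert.prems(2) by auto
      ultimately have "?g \<in> V" using insert.IH by blast
      moreover have "f s \<odot>\<^bsub>free_space K X\<^esub> basis_vec K s \<in> V"
        using submodule_memD(4)[OF assms(2)] assms(3)[OF True] v by simp
      ultimately have "?g \<oplus>\<^bsub>free_space K X\<^esub> (f s \<odot>\<^bsub>free_space K X\<^esub> basis_vec K s) \<in> V"
        using submodule_memD(3)[OF assms(2)] by blast
      moreover have "?g \<oplus>\<^bsub>free_space K X\<^esub> (f s \<odot>\<^bsub>free_space K X\<^esub> basis_vec K s) = f"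
        using v by (auto simp: free_space_simps basis_vec_def)
      ultimately show ?thesis by simp
    next
      case False
      then have "f s = \<zero>\<^bsub>K\<^esub>" using insert.prems(1) by (auto simp: free_space_simps)
      then show ?thesis using insert.prems by (intro insert.IH) auto
    qed
  qed
  from this[of "{x. f x \<noteq> \<zero>\<^bsub>K\<^esub>}" f] assms(4) show ?thesis by (simp add: free_space_simps)
qed

text \<open>
  The sum runs over the support, exactly as in \<^const>\<open>tensor_lift\<close>, which is the \<^const>\<open>coset_lift\<close> of this map.
\<close>

definition free_lift ::
  "('k, 'z) ring_scheme \<Rightarrow> ('k, 'p, 'c) module_scheme \<Rightarrow> ('x \<Rightarrow> 'p) \<Rightarrow> ('x \<Rightarrow> 'k) \<Rightarrow> 'p"
  where "free_lift K P \<phi> f = (\<Oplus>\<^bsub>P\<^esub>p\<in>{p. f p \<noteq> \<zero>\<^bsub>K\<^esub>}. f p \<odot>\<^bsub>P\<^esub> \<phi> p)"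

text \<open>
  The support varies with \<open>f\<close>; linearity is proved by summing over a common finite superset.
\<close>

lemma free_lift_superset:
  assumes "module K P" "\<And>x. x \<in> X \<Longrightarrow> \<phi> x \<in> carrier P" "f \<in> carrier (free_space K X)"
    and "finite S" "S \<subseteq> X" "{p. f p \<noteq> \<zero>\<^bsub>K\<^esub>} \<subseteq> S"
  shows "free_lift K P \<phi> f = (\<Oplus>\<^bsub>P\<^esub>p\<in>S. f p \<odot>\<^bsub>P\<^esub> \<phi> p)"
proof -
  interpret P: module K P by fact
  note v = free_space_val[OF P.R.is_cring assms(3)]
  show ?thesis unfolding free_lift_def
    by (rule P.add.finprod_mono_neutral_cong_left[OF assms(4) assms(6)]) (use assms(2,5) v in auto)
qed

lemma free_lift_lin:
  assumes "module K P" "\<And>x. x \<in> X \<Longrightarrow> \<phi> x \<in> carrier P"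
  shows "free_lift K P \<phi> \<in> lin_maps K (free_space K X) P"
proof -
  interpret P: module K P by fact
  let ?F = "free_space K X"
  interpret F: module K ?F by (rule module_free_space) (rule P.R.is_cring)
  have v: "f x \<in> carrier K" if "f \<in> carrier ?F" for f x using free_space_val[OF P.R.is_cring that] .
  have fin: "finite {p. f p \<noteq> \<zero>\<^bsub>K\<^esub>}" and sup: "{p. f p \<noteq> \<zero>\<^bsub>K\<^esub>} \<subseteq> X" if "f \<in> carrier ?F" for f
    using that by (auto simp: free_space_simps)
  have sum: "free_lift K P \<phi> f = (\<Oplus>\<^bsub>P\<^esub>p\<in>S. f p \<odot>\<^bsub>P\<^esub> \<phi> p)"
    if "f \<in> carrier ?F" "finite S" "S \<subseteq> X" "{p. f p \<noteq> \<zero>\<^bsub>K\<^esub>} \<subseteq> S" for f S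
    by (rule free_lift_superset[OF assms(1) _ that]) (rule assms(2))
  show ?thesis
  proof (rule lin_mapsI)
    fix f assume f: "f \<in> carrier ?F"
    show "free_lift K P \<phi> f \<in> carrier P"
      unfolding free_lift_def by (rule P.finsum_closed) (use assms(2) v[OF f] sup[OF f] in auto)
  next
    fix f g assume f: "f \<in> carrier ?F" and g: "g \<in> carrier ?F"
    let ?S = "{p. f p \<noteq> \<zero>\<^bsub>K\<^esub>} \<union> {p. g p \<noteq> \<zero>\<^bsub>K\<^esub>}"
    have S: "finite ?S" "?S \<subseteq> X" using fin sup f g by auto
    have fg: "f \<oplus>\<^bsub>?F\<^esub> g \<in> carrier ?F" using f g by simp
    have "free_lift K P \<phi> (f \<oplus>\<^bsub>?F\<^esub> g) = (\<Oplus>\<^bsub>P\<^esub>p\<in>?S. (f \<oplus>\<^bsub>?F\<^esub> g) p \<odot>\<^bsub>P\<^esub> \<phi> p)"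
      by (rule sum[OF fg S]) (auto simp: free_space_simps)
    also have "\<dots> = (\<Oplus>\<^bsub>P\<^esub>p\<in>?S. f p \<odot>\<^bsub>P\<^esub> \<phi> p \<oplus>\<^bsub>P\<^esub> g p \<odot>\<^bsub>P\<^esub> \<phi> p)"
      by (rule P.finsum_cong) (use S assms(2) v f g in \<open>auto simp: free_space_simps(3) P.smult_l_distr simp_implies_def\<close>)
    also have "\<dots> = (\<Oplus>\<^bsub>P\<^esub>p\<in>?S. f p \<odot>\<^bsub>P\<^esub> \<phi> p) \<oplus>\<^bsub>P\<^esub> (\<Oplus>\<^bsub>P\<^esub>p\<in>?S. g p \<odot>\<^bsub>P\<^esub> \<phi> p)"
      by (rule P.finsum_addf) (use S assms(2) v f g in auto)
    also have "\<dots> = free_lift K P \<phi> f \<oplus>\<^bsub>P\<^esub> free_lift K P \<phi> g"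
      using sum[OF f S] sum[OF g S] by auto
    finally show "free_lift K P \<phi> (f \<oplus>\<^bsub>?F\<^esub> g) = free_lift K P \<phi> f \<oplus>\<^bsub>P\<^esub> free_lift K P \<phi> g" .
  next
    fix a f assume a: "a \<in> carrier K" and f: "f \<in> carrier ?F"
    let ?S = "{p. f p \<noteq> \<zero>\<^bsub>K\<^esub>}"
    note S = fin[OF f] sup[OF f]
    have af: "a \<odot>\<^bsub>?F\<^esub> f \<in> carrier ?F" using a f by simp
    have "free_lift K P \<phi> (a \<odot>\<^bsub>?F\<^esub> f) = (\<Oplus>\<^bsub>P\<^esub>p\<in>?S. (a \<odot>\<^bsub>?F\<^esub> f) p \<odot>\<^bsub>P\<^esub> \<phi> p)"
      by (rule sum[OF af S]) (use a in \<open>auto simp: free_space_simps\<close>)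
    also have "\<dots> = (\<Oplus>\<^bsub>P\<^esub>p\<in>?S. a \<odot>\<^bsub>P\<^esub> (f p \<odot>\<^bsub>P\<^esub> \<phi> p))"
      by (rule P.finsum_cong) (use S assms(2) v f a in \<open>auto simp: free_space_simps(4) P.smult_assoc1 simp_implies_def\<close>)
    also have "\<dots> = a \<odot>\<^bsub>P\<^esub> free_lift K P \<phi> f"
      unfolding free_lift_def
      by (rule P.finsum_smult_ldistr[symmetric]) (use S assms(2) v f a in auto)
    finally show "free_lift K P \<phi> (a \<odot>\<^bsub>?F\<^esub> f) = a \<odot>\<^bsub>P\<^esub> free_lift K P \<phi> f" .
  qed
qed

lemma free_lift_basis:
  assumes "module K P" "\<And>x. x \<in> X \<Longrightarrow> \<phi> x \<in> carrier P" "x \<in> X"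
  shows "free_lift K P \<phi> (basis_vec K x) = \<phi> x"
proof -
  interpret P: module K P by fact
  have "free_lift K P \<phi> (basis_vec K x) = (\<Oplus>\<^bsub>P\<^esub>p\<in>{x}. basis_vec K x p \<odot>\<^bsub>P\<^esub> \<phi> p)"
    by (rule free_lift_superset[OF assms(1,2)])
      (use assms(3) basis_vec_closed[OF P.R.is_cring] in \<open>auto simp: basis_vec_def\<close>)
  also have "\<dots> = \<phi> x"
    using assms(2,3) by (simp add: basis_vec_def)
  finally show ?thesis .
qed

definition bilin ::
  "('k, 'z) ring_scheme \<Rightarrow> ('k, 'm, 'a) module_scheme \<Rightarrow> ('k, 'n, 'b) module_scheme
    \<Rightarrow> ('k, 'p, 'c) module_scheme \<Rightarrow> ('m \<Rightarrow> 'n \<Rightarrow> 'p) \<Rightarrow> bool"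
  where "bilin K M N P \<beta> \<longleftrightarrow> (\<forall>x\<in>carrier M. (\<lambda>y. \<beta> x y) \<in> lin_maps K N P)
     \<and> (\<forall>y\<in>carrier N. (\<lambda>x. \<beta> x y) \<in> lin_maps K M P)"

lemma bilinI:
  "(\<And>x. x \<in> carrier M \<Longrightarrow> (\<lambda>y. \<beta> x y) \<in> lin_maps K N P)
    \<Longrightarrow> (\<And>y. y \<in> carrier N \<Longrightarrow> (\<lambda>x. \<beta> x y) \<in> lin_maps K M P) \<Longrightarrow> bilin K M N P \<beta>"
  unfolding bilin_def by auto

lemma bilin_left: "bilin K M N P \<beta> \<Longrightarrow> y \<in> carrier N \<Longrightarrow> (\<lambda>x. \<beta> x y) \<in> lin_maps K M P"
  and bilin_right: "bilin K M N P \<beta> \<Longrightarrow> x \<in> carrier M \<Longrightarrow> (\<lambda>y. \<beta> x y) \<in> lin_maps K N P"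
  and bilin_closed: "bilin K M N P \<beta> \<Longrightarrow> x \<in> carrier M \<Longrightarrow> y \<in> carrier N \<Longrightarrow> \<beta> x y \<in> carrier P"
  unfolding bilin_def by (auto intro: lin_closed)

text \<open>
  The generating set inside \<^const>\<open>tensor_rel\<close>, made explicit so that minimality of the span can be used.
\<close>

definition tensor_gens ::
  "('k, 'z) ring_scheme \<Rightarrow> ('k, 'm, 'a) module_scheme \<Rightarrow> ('k, 'n, 'b) module_scheme
    \<Rightarrow> ('m \<times> 'n \<Rightarrow> 'k) set"
  where "tensor_gens K M N =
    (let F = free_space K (carrier M \<times> carrier N); e = basis_vec K in
       ({e (x \<oplus>\<^bsub>M\<^esub> x', y) \<ominus>\<^bsub>F\<^esub> (e (x, y) \<oplus>\<^bsub>F\<^esub> e (x', y)) | x x' y.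
            x \<in> carrier M \<and> x' \<in> carrier M \<and> y \<in> carrier N}
      \<union> {e (x, y \<oplus>\<^bsub>N\<^esub> y') \<ominus>\<^bsub>F\<^esub> (e (x, y) \<oplus>\<^bsub>F\<^esub> e (x, y')) | x y y'.
            x \<in> carrier M \<and> y \<in> carrier N \<and> y' \<in> carrier N}
      \<union> {e (a \<odot>\<^bsub>M\<^esub> x, y) \<ominus>\<^bsub>F\<^esub> a \<odot>\<^bsub>F\<^esub> e (x, y) | a x y.
            a \<in> carrier K \<and> x \<in> carrier M \<and> y \<in> carrier N}
      \<union> {e (x, a \<odot>\<^bsub>N\<^esub> y) \<ominus>\<^bsub>F\<^esub> a \<odot>\<^bsub>F\<^esub> e (x, y) | a x y.
            a \<in> carrier K \<and> x \<in> carrier M \<and> y \<in> carrier N}))"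

lemma tensor_rel_span: "tensor_rel K M N = subspace_span K (free_space K (carrier M \<times> carrier N)) (tensor_gens K M N)"
  by (simp add: tensor_rel_def tensor_gens_def Let_def)

context
  fixes K :: "('k, 'z) ring_scheme" and M :: "('k, 'm, 'a) module_scheme"
    and N :: "('k, 'n, 'b) module_scheme"
  assumes M: "module K M" and N: "module K N"
begin

interpretation M: module K M by (rule M)
interpretation N: module K N by (rule N)

abbreviation (input) "FMN \<equiv> free_space K (carrier M \<times> carrier N)"
lemmas FMN_module = module_free_space[OF M.R.is_cring, of "carrier M \<times> carrier N"]
interpretation F: module K "free_space K (carrier M \<times> carrier N)" by (rule FMN_module)

lemma basis_pair: "x \<in> carrier M \<Longrightarrow> y \<in> carrier N \<Longrightarrow> basis_vec K (x, y) \<in> carrier FMN"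
  by (rule basis_vec_closed[OF M.R.is_cring]) auto

lemma tensor_gens_closed: "tensor_gens K M N \<subseteq> carrier FMN"
  unfolding tensor_gens_def Let_def by (auto intro!: F.minus_closed F.a_closed F.smult_closed basis_pair)

lemma tensor_rel_submodule: "submodule (tensor_rel K M N) K FMN"
  unfolding tensor_rel_span by (rule submodule_span[OF FMN_module tensor_gens_closed])

lemma module_tensor: "module K (tensor K M N)"
  unfolding tensor_def by (rule module_quot_space[OF FMN_module tensor_rel_submodule])

lemma coset_tensor_lin: "(\<lambda>f. tensor_rel K M N +>\<^bsub>FMN\<^esub> f) \<in> lin_maps K FMN (tensor K M N)"
  unfolding tensor_def by (rule coset_lin[OF FMN_module tensor_rel_submodule])

lemma tensor_gen_rel: 
  assumes "u \<ominus>\<^bsub>FMN\<^esub> v \<in> tensor_gens K M N" "u \<in> carrier FMN" "v \<in> carrier FMN"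
  shows "tensor_rel K M N +>\<^bsub>FMN\<^esub> u = tensor_rel K M N +>\<^bsub>FMN\<^esub> v"
proof -
  have "u \<ominus>\<^bsub>FMN\<^esub> v \<in> tensor_rel K M N"
    using assms(1) span_superset unfolding tensor_rel_span by (rule subsetD[rotated])
  then show ?thesis using coset_eq_iff[OF FMN_module tensor_rel_submodule assms(2,3)] by blast
qed

lemma pure_tensor_bilin: "bilin K M N (tensor K M N) (pure_tensor K M N)"
proof -
  let ?c = "\<lambda>f. tensor_rel K M N +>\<^bsub>FMN\<^esub> f"
  note l = lin_add[OF coset_tensor_lin] lin_smult[OF coset_tensor_lin]
  have cl: "pure_tensor K M N x y \<in> carrier (tensor K M N)" if "x \<in> carrier M" "y \<in> carrier N" for x y
    unfolding pure_tensor_def using that by (intro lin_closed[OF coset_tensor_lin] basis_pair)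
  show ?thesis
  proof (rule bilinI; rule lin_mapsI)
    fix x y y' assume *: "x \<in> carrier M" "y \<in> carrier N" "y' \<in> carrier N"
    have "?c (basis_vec K (x, y \<oplus>\<^bsub>N\<^esub> y')) = ?c (basis_vec K (x, y) \<oplus>\<^bsub>FMN\<^esub> basis_vec K (x, y'))"
      using * by (intro tensor_gen_rel) (auto simp: tensor_gens_def Let_def basis_pair)
    then show "pure_tensor K M N x (y \<oplus>\<^bsub>N\<^esub> y') = pure_tensor K M N x y \<oplus>\<^bsub>tensor K M N\<^esub> pure_tensor K M N x y'"
      using * by (simp add: pure_tensor_def l basis_pair)
  next
    fix x y a assume *: "x \<in> carrier M" "y \<in> carrier N" "a \<in> carrier K"
    have "?c (basis_vec K (x, a \<odot>\<^bsub>N\<^esub> y)) = ?c (a \<odot>\<^bsub>FMN\<^esub> basis_vec K (x, y))"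
      using * by (intro tensor_gen_rel) (auto simp: tensor_gens_def Let_def basis_pair)
    then show "pure_tensor K M N x (a \<odot>\<^bsub>N\<^esub> y) = a \<odot>\<^bsub>tensor K M N\<^esub> pure_tensor K M N x y"
      using * by (simp add: pure_tensor_def l basis_pair)
  next
    fix x y x' assume *: "y \<in> carrier N" "x \<in> carrier M" "x' \<in> carrier M"
    have "?c (basis_vec K (x \<oplus>\<^bsub>M\<^esub> x', y)) = ?c (basis_vec K (x, y) \<oplus>\<^bsub>FMN\<^esub> basis_vec K (x', y))"
      using * by (intro tensor_gen_rel) (auto simp: tensor_gens_def Let_def basis_pair)
    then show "pure_tensor K M N (x \<oplus>\<^bsub>M\<^esub> x') y = pure_tensor K M N x y \<oplus>\<^bsub>tensor K M N\<^esub> pure_tensor K M N x' y"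
      using * by (simp add: pure_tensor_def l basis_pair)
  next
    fix x y a assume *: "y \<in> carrier N" "a \<in> carrier K" "x \<in> carrier M" 
    have "?c (basis_vec K (a \<odot>\<^bsub>M\<^esub> x, y)) = ?c (a \<odot>\<^bsub>FMN\<^esub> basis_vec K (x, y))"
      using * by (intro tensor_gen_rel) (auto simp: tensor_gens_def Let_def basis_pair)
    then show "pure_tensor K M N (a \<odot>\<^bsub>M\<^esub> x) y = a \<odot>\<^bsub>tensor K M N\<^esub> pure_tensor K M N x y"
      using * by (simp add: pure_tensor_def l basis_pair)
  qed (use cl in auto)
qed

lemma pure_tensor_closed: "x \<in> carrier M \<Longrightarrow> y \<in> carrier N \<Longrightarrow> pure_tensor K M N x y \<in> carrier (tensor K M N)"
  by (rule bilin_closed[OF pure_tensor_bilin])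

text \<open>Pure tensors span, since they are the images of the basis vectors of the free space.\<close>

lemma tensor_submodule_eqI:
  assumes "submodule V K (tensor K M N)"
    and "\<And>x y. x \<in> carrier M \<Longrightarrow> y \<in> carrier N \<Longrightarrow> pure_tensor K M N x y \<in> V"
    and "t \<in> carrier (tensor K M N)"
  shows "t \<in> V"
proof -
  obtain f where f: "f \<in> carrier FMN" "t = tensor_rel K M N +>\<^bsub>FMN\<^esub> f"
    using assms(3) by (auto simp: tensor_def quot_space_carrier)
  let ?W = "{f \<in> carrier FMN. tensor_rel K M N +>\<^bsub>FMN\<^esub> f \<in> V}"
  have "submodule ?W K FMN"
    by (rule submodule_preimage[OF FMN_module module_tensor coset_tensor_lin assms(1)])
  then have "f \<in> ?W"
    by (rule free_space_induct[OF M.R.is_cring]) (use assms(2) f in \<open>auto simp: basis_pair pure_tensor_def\<close>)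
  then show ?thesis using f by simp
qed

lemma tensor_lin_eqI:
  assumes "module K P" "f \<in> lin_maps K (tensor K M N) P" "g \<in> lin_maps K (tensor K M N) P"
    and "\<And>x y. x \<in> carrier M \<Longrightarrow> y \<in> carrier N \<Longrightarrow> f (pure_tensor K M N x y) = g (pure_tensor K M N x y)"
    and "t \<in> carrier (tensor K M N)"
  shows "f t = g t"
proof -
  interpret P: module K P by fact
  interpret T: module K "tensor K M N" by (rule module_tensor)
  let ?V = "{t \<in> carrier (tensor K M N). f t = g t}"
  have "submodule ?V K (tensor K M N)"
    by (rule submodule_by_closure[OF module_tensor])
      (use assms(2,3) lin_zero[OF module_tensor assms(1) assms(2)] lin_zero[OF module_tensor assms(1) assms(3)]
        in \<open>auto simp: lin_add lin_smult\<close>)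
  then have "t \<in> ?V"
    by (rule tensor_submodule_eqI) (use assms(4,5) in \<open>auto simp: pure_tensor_closed\<close>)
  then show ?thesis by simp
qed

text \<open>
  The universal property: bilinearity of \<open>\<beta>\<close> says precisely that its linear extension to the free space
  kills the generators of the relations, hence their span.
\<close>

lemma
  assumes P: "module K P" and \<beta>: "bilin K M N P \<beta>"
  shows tensor_lift_lin: "tensor_lift K P \<beta> \<in> lin_maps K (tensor K M N) P"
    and tensor_lift_pure: "x \<in> carrier M \<Longrightarrow> y \<in> carrier N \<Longrightarrow> tensor_lift K P \<beta> (pure_tensor K M N x y) = \<beta> x y"
proof -
  interpret P: module K P by fact
  let ?\<phi> = "\<lambda>p. \<beta> (fst p) (snd p)" let ?f = "free_lift K P ?\<phi>"
  have eq: "tensor_lift K P \<beta> = coset_lift ?f"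
    by (simp add: tensor_lift_def free_lift_def[abs_def])
  have c: "?\<phi> p \<in> carrier P" if "p \<in> carrier M \<times> carrier N" for p
    using that bilin_closed[OF \<beta>] by auto
  have lin: "?f \<in> lin_maps K FMN P" by (rule free_lift_lin[OF P c])
  have b: "?f (basis_vec K (x, y)) = \<beta> x y" if "x \<in> carrier M" "y \<in> carrier N" for x y
    using free_lift_basis[OF P c, where x="(x,y)"] that by auto
  have "tensor_gens K M N \<subseteq> {f \<in> carrier FMN. ?f f \<in> {\<zero>\<^bsub>P\<^esub>}}"
  proof
    fix g assume g: "g \<in> tensor_gens K M N"
    have z: "p \<ominus>\<^bsub>P\<^esub> p = \<zero>\<^bsub>P\<^esub>" if "p \<in> carrier P" for p
      using that by (simp add: a_minus_def P.r_neg)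
    note cl = bilin_closed[OF \<beta>]
    have "?f g = \<zero>\<^bsub>P\<^esub>"
      using g unfolding tensor_gens_def Let_def
      by (auto simp: lin_minus[OF FMN_module P lin] lin_add[OF lin] lin_smult[OF lin] b basis_pair z cl
            lin_add[OF bilin_left[OF \<beta>]] lin_smult[OF bilin_left[OF \<beta>]]
            lin_add[OF bilin_right[OF \<beta>]] lin_smult[OF bilin_right[OF \<beta>]])
    then show "g \<in> {f \<in> carrier FMN. ?f f \<in> {\<zero>\<^bsub>P\<^esub>}}" using g tensor_gens_closed by auto
  qed
  then have "tensor_rel K M N \<subseteq> {f \<in> carrier FMN. ?f f \<in> {\<zero>\<^bsub>P\<^esub>}}"
    unfolding tensor_rel_span
    by (rule span_minimal) (rule submodule_preimage[OF FMN_module P lin submodule_zero[OF P]])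
  then have k: "\<And>f. f \<in> tensor_rel K M N \<Longrightarrow> ?f f = \<zero>\<^bsub>P\<^esub>" by auto
  show "tensor_lift K P \<beta> \<in> lin_maps K (tensor K M N) P"
    unfolding eq tensor_def by (rule coset_lift_lin[OF FMN_module tensor_rel_submodule P lin k])
  show "tensor_lift K P \<beta> (pure_tensor K M N x y) = \<beta> x y" if "x \<in> carrier M" "y \<in> carrier N"
    unfolding eq pure_tensor_def
    using coset_lift_value[OF FMN_module tensor_rel_submodule P lin k basis_pair[OF that]] b[OF that] by simp
qed

lemma tensor_lift_closed:
  "module K P \<Longrightarrow> bilin K M N P \<beta> \<Longrightarrow> t \<in> carrier (tensor K M N) \<Longrightarrow> tensor_lift K P \<beta> t \<in> carrier P"
  by (rule lin_closed[OF tensor_lift_lin])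

lemma tensor_lift_unique:
  assumes "module K P" "bilin K M N P \<beta>" "f \<in> lin_maps K (tensor K M N) P"
    and "\<And>x y. x \<in> carrier M \<Longrightarrow> y \<in> carrier N \<Longrightarrow> f (pure_tensor K M N x y) = \<beta> x y"
    and "t \<in> carrier (tensor K M N)"
  shows "tensor_lift K P \<beta> t = f t"
  by (rule tensor_lin_eqI[OF assms(1) tensor_lift_lin[OF assms(1,2)] assms(3) _ assms(5)])
    (simp add: tensor_lift_pure[OF assms(1,2)] assms(4))

lemma bilin_cong:
  assumes "bilin K M N P \<beta>"
    and "\<And>x y. x \<in> carrier M \<Longrightarrow> y \<in> carrier N \<Longrightarrow> \<beta> x y = \<beta>' x y"
  shows "bilin K M N P \<beta>'"
proof (rule bilinI)
  show "(\<lambda>y. \<beta>' x y) \<in> lin_maps K N P" if "x \<in> carrier M" for x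
    by (rule lin_cong[OF bilin_right[OF assms(1) that] N]) (rule assms(2)[OF that])
  show "(\<lambda>x. \<beta>' x y) \<in> lin_maps K M P" if "y \<in> carrier N" for y
    by (rule lin_cong[OF bilin_left[OF assms(1) that] M]) (rule assms(2)[OF _ that])
qed

text \<open>
  Only the values on the carriers matter, although the lift itself is defined from the map on the whole type.
\<close>

lemma tensor_lift_cong:
  assumes "module K P" "bilin K M N P \<beta>"
    and "\<And>x y. x \<in> carrier M \<Longrightarrow> y \<in> carrier N \<Longrightarrow> \<beta> x y = \<beta>' x y"
    and "t \<in> carrier (tensor K M N)"
  shows "tensor_lift K P \<beta> t = tensor_lift K P \<beta>' t"
proof (rule tensor_lift_unique[OF assms(1,2) tensor_lift_lin[OF assms(1)] _ assms(4)])
  show \<beta>': "bilin K M N P \<beta>'" by (rule bilin_cong[OF assms(2,3)])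
  show "tensor_lift K P \<beta>' (pure_tensor K M N x y) = \<beta> x y" if "x \<in> carrier M" "y \<in> carrier N" for x y
    using that assms(3) by (simp add: tensor_lift_pure[OF assms(1) \<beta>'])
qed

lemma bilin_comp_lin: "f \<in> lin_maps K P Q \<Longrightarrow> bilin K M N P \<beta> \<Longrightarrow> bilin K M N Q (\<lambda>x y. f (\<beta> x y))"
  by (rule bilinI) (auto intro: lin_comp bilin_left bilin_right)

text \<open>Linear maps commute with the formal sums that tensors stand for.\<close>

lemma lin_tensor_lift:
  assumes "module K P" "module K Q" "bilin K M N P \<beta>" "f \<in> lin_maps K P Q" "t \<in> carrier (tensor K M N)"
  shows "f (tensor_lift K P \<beta> t) = tensor_lift K Q (\<lambda>x y. f (\<beta> x y)) t"
  by (rule tensor_lift_unique[symmetric, OF assms(2) bilin_comp_lin[OF assms(4,3)] lin_comp[OF assms(4) tensor_lift_lin]])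
    (use assms in \<open>auto simp: tensor_lift_pure\<close>)

end

section \<open>Maps between tensor products\<close>

lemma lin_bilin_left: "bilin K M N P \<beta> \<Longrightarrow> f \<in> lin_maps K X M \<Longrightarrow> y \<in> carrier N \<Longrightarrow> (\<lambda>x. \<beta> (f x) y) \<in> lin_maps K X P"
  using lin_comp[OF bilin_left] .

lemma lin_bilin_right: "bilin K M N P \<beta> \<Longrightarrow> x \<in> carrier M \<Longrightarrow> f \<in> lin_maps K X N \<Longrightarrow> (\<lambda>y. \<beta> x (f y)) \<in> lin_maps K X P"
  using lin_comp[OF bilin_right] .

lemmas lin_pure_left = lin_bilin_left[OF pure_tensor_bilin]
  and lin_pure_right = lin_bilin_right[OF pure_tensor_bilin]

lemma bilin_precomp:
  "bilin K M N P \<beta> \<Longrightarrow> f \<in> lin_maps K X M \<Longrightarrow> g \<in> lin_maps K Y N \<Longrightarrow> bilin K X Y P (\<lambda>x y. \<beta> (f x) (g y))"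
  by (rule bilinI; erule lin_bilin_left lin_bilin_right; simp add: lin_closed[of f] lin_closed[of g])

text \<open>
  Nested sums are lifts of bilinear maps whose coefficients depend linearly on an outer variable; this
  lemma gives the linearity of the inner sum in that variable.
\<close>

lemma lin_tensor_lift_param:
  assumes "module K M" "module K N" "module K P" "module K X" "t \<in> carrier (tensor K M N)"
    and "\<And>x. x \<in> carrier X \<Longrightarrow> bilin K M N P (\<beta> x)"
    and "\<And>u v. u \<in> carrier M \<Longrightarrow> v \<in> carrier N \<Longrightarrow> (\<lambda>x. \<beta> x u v) \<in> lin_maps K X P"
  shows "(\<lambda>x. tensor_lift K P (\<beta> x) t) \<in> lin_maps K X P"
proof -
  interpret P: module K P by fact
  interpret X: module K X by fact
  note cl = tensor_lift_closed[OF assms(1-3)]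
  note pure = tensor_lift_pure[OF assms(1-3)]
  note lin = tensor_lift_lin[OF assms(1-3)]
  show ?thesis
  proof (rule lin_mapsI)
    fix x assume "x \<in> carrier X"
    then show "tensor_lift K P (\<beta> x) t \<in> carrier P" using cl assms(5,6) by blast
  next
    fix x y assume xy: "x \<in> carrier X" "y \<in> carrier X"
    show "tensor_lift K P (\<beta> (x \<oplus>\<^bsub>X\<^esub> y)) t = tensor_lift K P (\<beta> x) t \<oplus>\<^bsub>P\<^esub> tensor_lift K P (\<beta> y) t"
    proof (rule tensor_lift_unique[OF assms(1-3) _ _ _ assms(5)])
      show "(\<lambda>t. tensor_lift K P (\<beta> x) t \<oplus>\<^bsub>P\<^esub> tensor_lift K P (\<beta> y) t) \<in> lin_maps K (tensor K M N) P"
        by (rule lin_mapsI)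
          (auto simp: lin_add[OF lin[OF assms(6)]] lin_smult[OF lin[OF assms(6)]] cl[OF assms(6)] xy P.a_ac P.smult_r_distr)
    qed (use xy in \<open>auto simp: assms(6) pure lin_add[OF assms(7)]\<close>)
  next
    fix a x assume ax: "a \<in> carrier K" "x \<in> carrier X"
    show "tensor_lift K P (\<beta> (a \<odot>\<^bsub>X\<^esub> x)) t = a \<odot>\<^bsub>P\<^esub> tensor_lift K P (\<beta> x) t"
    proof (rule tensor_lift_unique[OF assms(1-3) _ _ _ assms(5)])
      show "(\<lambda>t. a \<odot>\<^bsub>P\<^esub> tensor_lift K P (\<beta> x) t) \<in> lin_maps K (tensor K M N) P"
        by (rule lin_mapsI)
          (auto simp: lin_add[OF lin[OF assms(6)]] lin_smult[OF lin[OF assms(6)]] cl[OF assms(6)] ax P.a_ac P.smult_r_distr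
            P.smult_assoc1[symmetric] P.R.m_comm)
    qed (use ax in \<open>auto simp: assms(6) pure lin_smult[OF assms(7)]\<close>)
  qed
qed

lemma tensor_map_bilin:
  assumes "module K M" "module K N" "f \<in> lin_maps K X M" "g \<in> lin_maps K Y N"
  shows "bilin K X Y (tensor K M N) (\<lambda>x y. pure_tensor K M N (f x) (g y))"
  by (rule bilin_precomp[OF pure_tensor_bilin[OF assms(1,2)] assms(3,4)])

lemma
  assumes "module K X" "module K Y" "module K M" "module K N" "f \<in> lin_maps K X M" "g \<in> lin_maps K Y N"
  shows tensor_map_lin: "tensor_map K M N f g \<in> lin_maps K (tensor K X Y) (tensor K M N)"
    and tensor_map_pure: "x \<in> carrier X \<Longrightarrow> y \<in> carrier Y \<Longrightarrow>
      tensor_map K M N f g (pure_tensor K X Y x y) = pure_tensor K M N (f x) (g y)"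
  unfolding tensor_map_def using assms
  by (simp_all add: tensor_lift_lin tensor_lift_pure module_tensor tensor_map_bilin)

lemma tensor_lift_map:
  assumes "module K X" "module K Y" "module K M" "module K N" "f \<in> lin_maps K X M" "g \<in> lin_maps K Y N"
    and "module K P" "bilin K M N P \<beta>" "t \<in> carrier (tensor K X Y)"
  shows "tensor_lift K P \<beta> (tensor_map K M N f g t) = tensor_lift K P (\<lambda>x y. \<beta> (f x) (g y)) t"
  using assms(5,6)
  by (intro tensor_lift_unique[symmetric, OF assms(1,2,7) bilin_precomp[OF assms(8,5,6)]
        lin_comp[OF tensor_lift_lin[OF assms(3,4,7,8)] tensor_map_lin[OF assms(1-6)]] _ assms(9)])
    (auto simp: tensor_map_pure[OF assms(1-6)] tensor_lift_pure[OF assms(3,4,7,8)] lin_closed[OF assms(5)] lin_closed[OF assms(6)])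

lemma tensor_map_comp:
  assumes "module K X" "module K Y" "module K M" "module K N" "f \<in> lin_maps K X M" "g \<in> lin_maps K Y N"
    and "module K P" "module K Q" "f' \<in> lin_maps K M P" "g' \<in> lin_maps K N Q" "t \<in> carrier (tensor K X Y)"
  shows "tensor_map K P Q f' g' (tensor_map K M N f g t) = tensor_map K P Q (\<lambda>x. f' (f x)) (\<lambda>y. g' (g y)) t"
  by (subst (1 3) tensor_map_def, rule tensor_lift_map[OF assms(1-6) module_tensor[OF assms(7,8)] _ assms(11)])
    (rule tensor_map_bilin[OF assms(7-10)])

lemma tensor_map_cong:
  assumes "module K X" "module K Y" "module K M" "module K N" "f \<in> lin_maps K X M" "g \<in> lin_maps K Y N"
    and "\<And>x. x \<in> carrier X \<Longrightarrow> f x = f' x" "\<And>y. y \<in> carrier Y \<Longrightarrow> g y = g' y" "t \<in> carrier (tensor K X Y)"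
  shows "tensor_map K M N f g t = tensor_map K M N f' g' t"
  unfolding tensor_map_def
  by (rule tensor_lift_cong[OF assms(1,2) module_tensor[OF assms(3,4)] tensor_map_bilin[OF assms(3-6)] _ assms(9)])
    (simp add: assms(7,8))

lemma tensor_map_ident:
  assumes "module K X" "module K Y" "t \<in> carrier (tensor K X Y)"
  shows "tensor_map K X Y (\<lambda>x. x) (\<lambda>y. y) t = t"
  unfolding tensor_map_def
  by (rule tensor_lift_unique[OF assms(1,2) module_tensor[OF assms(1,2)] pure_tensor_bilin[OF assms(1,2)] lin_id _ assms(3)]) simp

lemma
  assumes L: "module K L" and M: "module K M" and N: "module K N"
  shows tensor_assoc_lin: "tensor_assoc K L M N \<in> lin_maps K (tensor K (tensor K L M) N) (tensor K L (tensor K M N))"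
    and tensor_assoc_pure: "x \<in> carrier L \<Longrightarrow> y \<in> carrier M \<Longrightarrow> z \<in> carrier N \<Longrightarrow>
      tensor_assoc K L M N (pure_tensor K (tensor K L M) N (pure_tensor K L M x y) z)
        = pure_tensor K L (tensor K M N) x (pure_tensor K M N y z)"
proof -
  let ?LM = "tensor K L M" and ?MN = "tensor K M N" and ?T = "tensor K L (tensor K M N)"
  note m = L M N module_tensor[OF L M] module_tensor[OF M N] module_tensor[OF L module_tensor[OF M N]]
  let ?\<gamma> = "\<lambda>z x y. pure_tensor K L ?MN x (pure_tensor K M N y z)"
  have \<gamma>: "bilin K L M ?T (?\<gamma> z)" if "z \<in> carrier N" for z
    by (rule bilinI) (use that m in \<open>auto intro!: lin_pure_left lin_pure_right lin_id pure_tensor_closed\<close>)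
  let ?\<beta> = "\<lambda>t z. tensor_lift K ?T (?\<gamma> z) t"
  have \<beta>: "bilin K ?LM N ?T ?\<beta>"
  proof (rule bilinI)
    show "(\<lambda>z. ?\<beta> t z) \<in> lin_maps K N ?T" if "t \<in> carrier ?LM" for t
      by (rule lin_tensor_lift_param[OF L M m(6) N that \<gamma>])
        (use m in \<open>auto intro!: lin_pure_left lin_pure_right lin_id pure_tensor_closed\<close>)
    show "(\<lambda>t. ?\<beta> t z) \<in> lin_maps K ?LM ?T" if "z \<in> carrier N" for z
      by (rule tensor_lift_lin[OF L M m(6) \<gamma>[OF that]])
  qed
  have eq: "tensor_assoc K L M N = tensor_lift K ?T ?\<beta>"
    by (simp add: tensor_assoc_def Let_def)
  show "tensor_assoc K L M N \<in> lin_maps K (tensor K (tensor K L M) N) (tensor K L (tensor K M N))"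
    unfolding eq by (rule tensor_lift_lin[OF m(4) N m(6) \<beta>])
  show "tensor_assoc K L M N (pure_tensor K (tensor K L M) N (pure_tensor K L M x y) z)
        = pure_tensor K L (tensor K M N) x (pure_tensor K M N y z)"
    if "x \<in> carrier L" "y \<in> carrier M" "z \<in> carrier N"
    using that unfolding eq 
    by (simp add: tensor_lift_pure[OF m(4) N m(6) \<beta>] tensor_lift_pure[OF L M m(6) \<gamma>] pure_tensor_closed[OF L M])
qed

lemma tensor_assoc_natural:
  assumes L: "module K L" and M: "module K M" and N: "module K N"
    and L': "module K L'" and M': "module K M'" and N': "module K N'"
    and f: "f \<in> lin_maps K L L'" and g: "g \<in> lin_maps K M M'" and h: "h \<in> lin_maps K N N'"
    and t: "t \<in> carrier (tensor K (tensor K L M) N)"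
  shows "tensor_assoc K L' M' N' (tensor_map K (tensor K L' M') N' (tensor_map K L' M' f g) h t)
    = tensor_map K L' (tensor K M' N') f (tensor_map K M' N' g h) (tensor_assoc K L M N t)"
proof -
  note m = L M N L' M' N' module_tensor[OF L M] module_tensor[OF L' M'] module_tensor[OF M N] module_tensor[OF M' N']
    module_tensor[OF L module_tensor[OF M N]] module_tensor[OF L' module_tensor[OF M' N']]
  note l = tensor_assoc_lin[OF L' M' N'] tensor_assoc_lin[OF L M N]
    tensor_map_lin[OF L M L' M' f g] tensor_map_lin[OF M N M' N' g h]
    tensor_map_lin[OF m(7) N m(8) N' tensor_map_lin[OF L M L' M' f g] h]
    tensor_map_lin[OF L m(9) L' m(10) f tensor_map_lin[OF M N M' N' g h]]
  note p = tensor_map_pure[OF L M L' M' f g] tensor_map_pure[OF M N M' N' g h]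
    tensor_map_pure[OF m(7) N m(8) N' tensor_map_lin[OF L M L' M' f g] h]
    tensor_map_pure[OF L m(9) L' m(10) f tensor_map_lin[OF M N M' N' g h]]
    tensor_assoc_pure[OF L' M' N'] tensor_assoc_pure[OF L M N]
    lin_closed[OF f] lin_closed[OF g] lin_closed[OF h] pure_tensor_closed[OF L M] pure_tensor_closed[OF M N]
  let ?l = "\<lambda>t. tensor_assoc K L' M' N' (tensor_map K (tensor K L' M') N' (tensor_map K L' M' f g) h t)"
  let ?r = "\<lambda>t. tensor_map K L' (tensor K M' N') f (tensor_map K M' N' g h) (tensor_assoc K L M N t)"
  have ll: "?l \<in> lin_maps K (tensor K (tensor K L M) N) (tensor K L' (tensor K M' N'))"
    and rl: "?r \<in> lin_maps K (tensor K (tensor K L M) N) (tensor K L' (tensor K M' N'))"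
    by (rule lin_comp[OF l(1) l(5)], rule lin_comp[OF l(6) l(2)])
  show ?thesis
  proof (rule tensor_lin_eqI[OF m(7) N m(12) ll rl _ t])
    fix s z assume s: "s \<in> carrier (tensor K L M)" and z: "z \<in> carrier N"
    note ps = lin_pure_left[OF m(7) N lin_id z]
    show "?l (pure_tensor K (tensor K L M) N s z) = ?r (pure_tensor K (tensor K L M) N s z)"
      by (rule tensor_lin_eqI[OF L M m(12) lin_comp[OF ll ps] lin_comp[OF rl ps] _ s]) (simp add: p z)
  qed
qed

text \<open>
  The record fields beyond carrier, addition and scalar multiplication do not enter the tensor product.
  So a Hopf algebra and its underlying vector space have the same tensor square.
\<close>

lemma tensor_rel_cong:
  assumes "carrier M = carrier M'" "add M = add M'" "smult M = smult M'"
    and "carrier N = carrier N'" "add N = add N'" "smult N = smult N'"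
  shows "tensor_rel K M N = tensor_rel K M' N'"
  unfolding tensor_rel_def assms ..

lemma
  assumes "carrier M = carrier M'" "add M = add M'" "smult M = smult M'"
    and "carrier N = carrier N'" "add N = add N'" "smult N = smult N'"
  shows tensor_cong: "tensor K M N = tensor K M' N'"
    and tensor_map_structure_cong: "tensor_map K M N f g = tensor_map K M' N' f g"
  using tensor_rel_cong[OF assms, of K] assms
  by (simp_all add: fun_eq_iff tensor_map_def tensor_def pure_tensor_def)

section \<open>Splittings over a field\<close>

text \<open>
  By Zorn's lemma there is a largest subspace \<open>W\<close> that meets \<open>X\<close> trivially. A vector \<open>m\<close> outside \<open>X + W\<close>
  would make \<open>W + Km\<close> larger: a relation \<open>w + a m \<in> X\<close> with \<open>a \<noteq> 0\<close> can be solved for \<open>m\<close>.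
\<close>

lemma submodule_complement:
  assumes K: "field K" and M: "module K M" and X: "submodule X K M"
  obtains W where "submodule W K M" "W \<inter> X = {\<zero>\<^bsub>M\<^esub>}"
    "\<And>m. m \<in> carrier M \<Longrightarrow> \<exists>x\<in>X. \<exists>w\<in>W. m = x \<oplus>\<^bsub>M\<^esub> w"
proof -
  interpret K: field K by fact
  interpret M: module K M by fact
  let ?A = "{W. submodule W K M \<and> W \<inter> X = {\<zero>\<^bsub>M\<^esub>}}"
  note Xm = submodule_memD[OF X]
  have "{\<zero>\<^bsub>M\<^esub>} \<in> ?A" using submodule_zero[OF M] Xm(2) by auto
  then have ne: "?A \<noteq> {}" by blast
  have chain: "\<Union>\<C> \<in> ?A" if C: "\<C> \<noteq> {}" "subset.chain ?A \<C>" for \<C>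
  proof -
    have CA: "\<C> \<subseteq> ?A" and tot: "\<And>U V. U \<in> \<C> \<Longrightarrow> V \<in> \<C> \<Longrightarrow> U \<subseteq> V \<or> V \<subseteq> U"
      using C(2) by (auto simp: subset.chain_def)
    have sub: "submodule U K M" if "U \<in> \<C>" for U using CA that by auto
    have "submodule (\<Union>\<C>) K M"
    proof (rule submodule_by_closure[OF M])
      show "\<Union>\<C> \<subseteq> carrier M" using submodule_subset[OF sub] by auto
      show "\<zero>\<^bsub>M\<^esub> \<in> \<Union>\<C>" using C(1) submodule_memD(2)[OF sub] by auto
      fix x y assume "x \<in> \<Union>\<C>" "y \<in> \<Union>\<C>"
      then obtain U V where "U \<in> \<C>" "V \<in> \<C>" "x \<in> U" "y \<in> V" by auto
      then obtain Z where "Z \<in> \<C>" "x \<in> Z" "y \<in> Z" using tot by blast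
      then show "x \<oplus>\<^bsub>M\<^esub> y \<in> \<Union>\<C>" using submodule_memD(3)[OF sub] by auto
    next
      fix a x assume "a \<in> carrier K" "x \<in> \<Union>\<C>"
      then show "a \<odot>\<^bsub>M\<^esub> x \<in> \<Union>\<C>" using submodule_memD(4)[OF sub] by auto
    qed
    moreover have "\<Union>\<C> \<inter> X = {\<zero>\<^bsub>M\<^esub>}"
    proof -
      have "U \<inter> X = {\<zero>\<^bsub>M\<^esub>}" if "U \<in> \<C>" for U using CA that by auto
      then have "(\<Union>U\<in>\<C>. U \<inter> X) = {\<zero>\<^bsub>M\<^esub>}" using C(1) by simp
      then show ?thesis by auto
    qed
    ultimately show ?thesis by simp
  qed
  have "\<exists>W\<in>?A. \<forall>V\<in>?A. W \<subseteq> V \<longrightarrow> V = W"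
    by (rule subset_Zorn_nonempty[OF ne]) (rule chain)
  then obtain W where WA: "W \<in> ?A" and mx: "\<forall>V\<in>?A. W \<subseteq> V \<longrightarrow> V = W" by (elim bexE)
  note max = mx[rule_format]
  from WA have W: "submodule W K M" and WX: "W \<inter> X = {\<zero>\<^bsub>M\<^esub>}" by auto
  note Wm = submodule_memD[OF W]
  have "\<exists>x\<in>X. \<exists>w\<in>W. m = x \<oplus>\<^bsub>M\<^esub> w" if m: "m \<in> carrier M" for m
  proof (rule ccontr)
    assume no: "\<not> (\<exists>x\<in>X. \<exists>w\<in>W. m = x \<oplus>\<^bsub>M\<^esub> w)"
    (* The subspace generated by W and m. *)
    let ?V = "{w \<oplus>\<^bsub>M\<^esub> a \<odot>\<^bsub>M\<^esub> m | w a. w \<in> W \<and> a \<in> carrier K}"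
    have V: "submodule ?V K M"
    proof (rule submodule_by_closure[OF M])
      show "?V \<subseteq> carrier M" using Wm(1) m by auto
      show "\<zero>\<^bsub>M\<^esub> \<in> ?V"
        by (intro CollectI exI[of _ "\<zero>\<^bsub>M\<^esub>"] exI[of _ "\<zero>\<^bsub>K\<^esub>"] conjI) (use Wm(2) m in auto)
    next
      fix x y assume "x \<in> ?V" "y \<in> ?V"
      then obtain w a v b where *: "x = w \<oplus>\<^bsub>M\<^esub> a \<odot>\<^bsub>M\<^esub> m" "w \<in> W" "a \<in> carrier K" 
        "y = v \<oplus>\<^bsub>M\<^esub> b \<odot>\<^bsub>M\<^esub> m" "v \<in> W" "b \<in> carrier K" by auto
      have "x \<oplus>\<^bsub>M\<^esub> y = (w \<oplus>\<^bsub>M\<^esub> v) \<oplus>\<^bsub>M\<^esub> (a \<oplus>\<^bsub>K\<^esub> b) \<odot>\<^bsub>M\<^esub> m"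
        unfolding *(1,4) using *(3,6) Wm(1)[OF *(2)] Wm(1)[OF *(5)] m by (simp add: M.smult_l_distr M.a_ac)
      then show "x \<oplus>\<^bsub>M\<^esub> y \<in> ?V"
        by (intro CollectI exI[of _ "w \<oplus>\<^bsub>M\<^esub> v"] exI[of _ "a \<oplus>\<^bsub>K\<^esub> b"] conjI)
          (use Wm(3)[OF *(2,5)] *(3,6) in auto)
    next
      fix c x assume c: "c \<in> carrier K" and "x \<in> ?V"
      then obtain w a where *: "x = w \<oplus>\<^bsub>M\<^esub> a \<odot>\<^bsub>M\<^esub> m" "w \<in> W" "a \<in> carrier K" by auto
      have "c \<odot>\<^bsub>M\<^esub> x = c \<odot>\<^bsub>M\<^esub> w \<oplus>\<^bsub>M\<^esub> (c \<otimes>\<^bsub>K\<^esub> a) \<odot>\<^bsub>M\<^esub> m"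
        unfolding *(1) using c *(3) Wm(1)[OF *(2)] m by (simp add: M.smult_r_distr M.smult_assoc1)
      then show "c \<odot>\<^bsub>M\<^esub> x \<in> ?V"
        by (intro CollectI exI[of _ "c \<odot>\<^bsub>M\<^esub> w"] exI[of _ "c \<otimes>\<^bsub>K\<^esub> a"] conjI)
          (use Wm(4)[OF c *(2)] *(3) c in auto)
    qed
    have "v = \<zero>\<^bsub>M\<^esub>" if v: "v \<in> ?V" "v \<in> X" for v
    proof -
      obtain w a where *: "v = w \<oplus>\<^bsub>M\<^esub> a \<odot>\<^bsub>M\<^esub> m" "w \<in> W" "a \<in> carrier K" using v by auto
      note c = Wm(1)[OF *(2)] Xm(1)[OF v(2)]
      have "a = \<zero>\<^bsub>K\<^esub>"
      proof (rule ccontr)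
        assume "a \<noteq> \<zero>\<^bsub>K\<^esub>"
        then have u: "a \<in> Units K" using *(3) K.field_Units by auto
        let ?i = "inv\<^bsub>K\<^esub> a"
        have i: "?i \<in> carrier K" "?i \<otimes>\<^bsub>K\<^esub> a = \<one>\<^bsub>K\<^esub>" using u by auto
        have "m = ?i \<odot>\<^bsub>M\<^esub> (a \<odot>\<^bsub>M\<^esub> m)" using i *(3) m by (simp add: M.smult_assoc1[symmetric])
        also have "a \<odot>\<^bsub>M\<^esub> m = v \<oplus>\<^bsub>M\<^esub> (\<ominus>\<^bsub>M\<^esub> w)"
          unfolding *(1) using *(3) c m by (simp add: M.a_ac M.r_neg1 M.r_neg2)
        also have "?i \<odot>\<^bsub>M\<^esub> \<dots> = ?i \<odot>\<^bsub>M\<^esub> v \<oplus>\<^bsub>M\<^esub> ?i \<odot>\<^bsub>M\<^esub> (\<ominus>\<^bsub>M\<^esub> w)"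
          using i c by (simp add: M.smult_r_distr)
        finally show False using no Xm(4)[OF i(1) v(2)] Wm(4)[OF i(1) Wm(5)[OF *(2)]] by blast
      qed
      then have "v = w" using * c m by simp
      then show ?thesis using *(2) v(2) WX by blast
    qed
    then have "?V \<inter> X \<subseteq> {\<zero>\<^bsub>M\<^esub>}" by (intro subsetI) (simp only: Int_iff singleton_iff)
    then have "?V \<inter> X = {\<zero>\<^bsub>M\<^esub>}" using submodule_memD(2)[OF V] Xm(2) by (intro subset_antisym) simp_all
    moreover have "W \<subseteq> ?V"
    proof
      fix w assume "w \<in> W"
      then show "w \<in> ?V"
        by (intro CollectI exI[of _ w] exI[of _ "\<zero>\<^bsub>K\<^esub>"] conjI) (use Wm(1) m in auto)
    qed
    ultimately have "?V = W" by (intro max CollectI conjI V)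
    moreover have "m \<in> ?V"
      by (intro CollectI exI[of _ "\<zero>\<^bsub>M\<^esub>"] exI[of _ "\<one>\<^bsub>K\<^esub>"] conjI) (use Wm(2) m in auto)
    ultimately have "m \<in> W" by (simp only:)
    moreover have "m = \<zero>\<^bsub>M\<^esub> \<oplus>\<^bsub>M\<^esub> m" using m by simp
    ultimately show False using no Xm(2) by blast
  qed
  with W WX show ?thesis by (rule that)
qed

lemma submodule_retraction:
  assumes K: "field K" and M: "module K M" and X: "submodule X K M"
  obtains p where "p \<in> lin_maps K M M" "\<And>m. m \<in> carrier M \<Longrightarrow> p m \<in> X" "\<And>x. x \<in> X \<Longrightarrow> p x = x"
proof -
  interpret M: module K M by fact
  obtain W where W: "submodule W K M" and WX: "W \<inter> X = {\<zero>\<^bsub>M\<^esub>}"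
    and dec: "\<And>m. m \<in> carrier M \<Longrightarrow> \<exists>x\<in>X. \<exists>w\<in>W. m = x \<oplus>\<^bsub>M\<^esub> w"
    using submodule_complement[OF K M X] by blast
  note Wm = submodule_memD[OF W] and Xm = submodule_memD[OF X]
  define p where "p m = (SOME x. x \<in> X \<and> (\<exists>w\<in>W. m = x \<oplus>\<^bsub>M\<^esub> w))" for m
  have uniq: "x = x'" if *: "x \<in> X" "x' \<in> X" "w \<in> W" "w' \<in> W" "x \<oplus>\<^bsub>M\<^esub> w = x' \<oplus>\<^bsub>M\<^esub> w'" for x x' w w'
  proof -
    note c = Xm(1)[OF *(1)] Xm(1)[OF *(2)] Wm(1)[OF *(3)] Wm(1)[OF *(4)]
    have "x = (x \<oplus>\<^bsub>M\<^esub> w) \<oplus>\<^bsub>M\<^esub> (\<ominus>\<^bsub>M\<^esub> w)" using c by (simp add: M.a_assoc M.r_neg)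
    then have "x = x' \<oplus>\<^bsub>M\<^esub> (w' \<ominus>\<^bsub>M\<^esub> w)" unfolding *(5) using c by (simp add: M.a_assoc a_minus_def)
    then have "x \<ominus>\<^bsub>M\<^esub> x' = (\<ominus>\<^bsub>M\<^esub> x') \<oplus>\<^bsub>M\<^esub> (x' \<oplus>\<^bsub>M\<^esub> (w' \<ominus>\<^bsub>M\<^esub> w))"
      using c by (simp add: a_minus_def M.a_comm)
    also have "\<dots> = w' \<ominus>\<^bsub>M\<^esub> w" using c by (simp add: M.r_neg1)
    finally have "x \<ominus>\<^bsub>M\<^esub> x' \<in> W" using Wm(6)[OF *(4,3)] by simp
    then have "x \<ominus>\<^bsub>M\<^esub> x' \<in> W \<inter> X" using Xm(6)[OF *(1,2)] by simp
    then show ?thesis using module_eq_iff_minus[OF M c(1,2)] WX by blast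
  qed
  have p: "p (x \<oplus>\<^bsub>M\<^esub> w) = x" if "x \<in> X" "w \<in> W" for x w
    unfolding p_def by (rule some_equality) (use that uniq in auto)
  have lin: "p \<in> lin_maps K M M"
  proof (rule lin_mapsI)
    fix m assume "m \<in> carrier M"
    then show "p m \<in> carrier M" using dec[of m] p Xm(1) by auto
  next
    fix m n assume "m \<in> carrier M" "n \<in> carrier M"
    from dec[OF this(1)] dec[OF this(2)]
    obtain x w y v where *: "m = x \<oplus>\<^bsub>M\<^esub> w" "n = y \<oplus>\<^bsub>M\<^esub> v" "x \<in> X" "w \<in> W" "y \<in> X" "v \<in> W"
      by blast
    have "m \<oplus>\<^bsub>M\<^esub> n = (x \<oplus>\<^bsub>M\<^esub> y) \<oplus>\<^bsub>M\<^esub> (w \<oplus>\<^bsub>M\<^esub> v)"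
      using * Xm(1) Wm(1) by (simp add: M.a_ac)
    then show "p (m \<oplus>\<^bsub>M\<^esub> n) = p m \<oplus>\<^bsub>M\<^esub> p n" using * p Xm(3) Wm(3) by simp
  next
    fix a m assume a: "a \<in> carrier K" and "m \<in> carrier M"
    from dec[OF this(2)] obtain x w where *: "m = x \<oplus>\<^bsub>M\<^esub> w" "x \<in> X" "w \<in> W" by blast
    have "a \<odot>\<^bsub>M\<^esub> m = a \<odot>\<^bsub>M\<^esub> x \<oplus>\<^bsub>M\<^esub> a \<odot>\<^bsub>M\<^esub> w" using * a Xm(1) Wm(1) by (simp add: M.smult_r_distr)
    then show "p (a \<odot>\<^bsub>M\<^esub> m) = a \<odot>\<^bsub>M\<^esub> p m" using * a p Xm(4) Wm(4) by simp
  qed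
  show ?thesis
  proof (rule that[OF lin])
    show "p m \<in> X" if "m \<in> carrier M" for m using dec[OF that] p by auto
    show "p x = x" if "x \<in> X" for x using p[OF that Wm(2)] Xm(1)[OF that] by simp
  qed
qed

lemma lin_left_inverse:
  assumes K: "field K" and X: "module K X" and M: "module K M"
    and f: "f \<in> lin_maps K X M" and inj: "inj_on f (carrier X)"
  obtains r where "r \<in> lin_maps K M X" "\<And>x. x \<in> carrier X \<Longrightarrow> r (f x) = x"
proof -
  interpret X: module K X by fact
  have im: "submodule (f ` carrier X) K M"
    by (rule submodule_image[OF X M f X.carrier_is_submodule])
  obtain p where p: "p \<in> lin_maps K M M" "\<And>m. m \<in> carrier M \<Longrightarrow> p m \<in> f ` carrier X"
      "\<And>x. x \<in> f ` carrier X \<Longrightarrow> p x = x"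
    using submodule_retraction[OF K M im] by blast
  let ?r = "\<lambda>m. inv_into (carrier X) f (p m)"
  have r: "?r m \<in> carrier X" "f (?r m) = p m" if "m \<in> carrier M" for m
    using p(2)[OF that] by (auto simp: inv_into_into f_inv_into_f)
  have "?r \<in> lin_maps K M X"
  proof (rule lin_mapsI)
    fix m n assume mn: "m \<in> carrier M" "n \<in> carrier M"
    have "f (?r (m \<oplus>\<^bsub>M\<^esub> n)) = f (?r m \<oplus>\<^bsub>X\<^esub> ?r n)"
      using mn r(1) r(2)[of m] r(2)[of n] r(2)[of "m \<oplus>\<^bsub>M\<^esub> n"] lin_add[OF p(1) mn]
      by (simp only: lin_add[OF f] module_add_closed[OF M])
    then show "?r (m \<oplus>\<^bsub>M\<^esub> n) = ?r m \<oplus>\<^bsub>X\<^esub> ?r n"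
      using mn r inj by (meson X.a_closed inj_onD module_add_closed[OF M])
  next
    fix a m assume mn: "a \<in> carrier K" "m \<in> carrier M"
    have "f (?r (a \<odot>\<^bsub>M\<^esub> m)) = f (a \<odot>\<^bsub>X\<^esub> ?r m)"
      using mn r(1) r(2)[of m] r(2)[of "a \<odot>\<^bsub>M\<^esub> m"] lin_smult[OF p(1) mn]
      by (simp only: lin_smult[OF f] module_smult_closed[OF M])
    then show "?r (a \<odot>\<^bsub>M\<^esub> m) = a \<odot>\<^bsub>X\<^esub> ?r m"
      using mn r inj by (meson X.smult_closed inj_onD module_smult_closed[OF M])
  qed (use r in auto)
  moreover have "?r (f x) = x" if "x \<in> carrier X" for x
    using that p(3) inj by (simp add: inv_into_f_f)
  ultimately show ?thesis by (rule that)
qed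

text \<open>
  An injection of vector spaces has a linear left inverse, and the tensor product of two left inverses is
  a left inverse. This identifies \<open>X \<otimes> Y\<close> with a subspace of \<open>M \<otimes> N\<close>.
\<close>

lemma tensor_map_inj:
  assumes K: "field K" and m: "module K X" "module K Y" "module K M" "module K N"
    and f: "f \<in> lin_maps K X M" "inj_on f (carrier X)" and g: "g \<in> lin_maps K Y N" "inj_on g (carrier Y)"
  shows "inj_on (tensor_map K M N f g) (carrier (tensor K X Y))"
proof -
  obtain r where r: "r \<in> lin_maps K M X" "\<And>x. x \<in> carrier X \<Longrightarrow> r (f x) = x"
    using lin_left_inverse[OF K m(1,3) f] by blast
  obtain s where s: "s \<in> lin_maps K N Y" "\<And>y. y \<in> carrier Y \<Longrightarrow> s (g y) = y"
    using lin_left_inverse[OF K m(2,4) g] by blast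
  have "tensor_map K X Y r s (tensor_map K M N f g t) = t" if t: "t \<in> carrier (tensor K X Y)" for t
  proof -
    have "tensor_map K X Y r s (tensor_map K M N f g t) = tensor_map K X Y (\<lambda>x. r (f x)) (\<lambda>y. s (g y)) t"
      by (rule tensor_map_comp[OF m f(1) g(1) m(1,2) r(1) s(1) t])
    also have "\<dots> = tensor_map K X Y (\<lambda>x. x) (\<lambda>y. y) t"
      by (rule tensor_map_cong[OF m(1,2) m(1,2) lin_comp[OF r(1) f(1)] lin_comp[OF s(1) g(1)] _ _ t]) (simp_all add: r s)
    also have "\<dots> = t" by (rule tensor_map_ident[OF m(1,2) t])
    finally show ?thesis .
  qed
  then show ?thesis by (rule inj_on_inverseI)
qed

section \<open>Tensor products of subspaces\<close>

lemma submodule_module: "module K M \<Longrightarrow> submodule X K M \<Longrightarrow> module K (M\<lparr>carrier := X\<rparr>)"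
  by (rule submodule.submodule_is_module)

lemma inclusion_lin: "submodule X K M \<Longrightarrow> (\<lambda>x. x) \<in> lin_maps K (M\<lparr>carrier := X\<rparr>) M"
  by (rule lin_mapsI) (auto dest: submodule_memD)

lemma id_lin: "submodule X K M \<Longrightarrow> id \<in> lin_maps K (M\<lparr>carrier := X\<rparr>) M"
  using inclusion_lin[of X K M] by (simp add: id_def)

context
  fixes K :: "('k, 'z) ring_scheme" and M :: "('k, 'm, 'a) module_scheme"
    and N :: "('k, 'n, 'b) module_scheme" and X Y
  assumes M: "module K M" and N: "module K N" and X: "submodule X K M" and Y: "submodule Y K N"
begin

lemma tensor_sub_map_lin:
  "tensor_map K M N id id \<in> lin_maps K (tensor K (M\<lparr>carrier := X\<rparr>) (N\<lparr>carrier := Y\<rparr>)) (tensor K M N)"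
  by (rule tensor_map_lin[OF submodule_module[OF M X] submodule_module[OF N Y] M N id_lin[OF X] id_lin[OF Y]])

lemma tensor_sub_submodule: "submodule (tensor_sub K M N X Y) K (tensor K M N)"
  unfolding tensor_sub_def
  by (intro submodule_image[OF _ module_tensor[OF M N] tensor_sub_map_lin]
      module.carrier_is_submodule module_tensor submodule_module M N X Y)

lemma tensor_sub_pure:
  assumes "x \<in> X" "y \<in> Y"
  shows "pure_tensor K M N x y \<in> tensor_sub K M N X Y"
proof -
  note m = submodule_module[OF M X] submodule_module[OF N Y]
  have "pure_tensor K M N x y = tensor_map K M N id id (pure_tensor K (M\<lparr>carrier := X\<rparr>) (N\<lparr>carrier := Y\<rparr>) x y)"
    using tensor_map_pure[OF m M N id_lin[OF X] id_lin[OF Y], of x y] assms by simp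
  moreover have "pure_tensor K (M\<lparr>carrier := X\<rparr>) (N\<lparr>carrier := Y\<rparr>) x y
      \<in> carrier (tensor K (M\<lparr>carrier := X\<rparr>) (N\<lparr>carrier := Y\<rparr>))"
    using pure_tensor_closed[OF m, of x y] assms by simp
  ultimately show ?thesis unfolding tensor_sub_def by (rule image_eqI)
qed

lemma tensor_sub_least:
  assumes V: "submodule V K (tensor K M N)" and p: "\<And>x y. x \<in> X \<Longrightarrow> y \<in> Y \<Longrightarrow> pure_tensor K M N x y \<in> V"
  shows "tensor_sub K M N X Y \<subseteq> V"
proof -
  note m = submodule_module[OF M X] submodule_module[OF N Y]
  have "t \<in> {t \<in> carrier (tensor K (M\<lparr>carrier := X\<rparr>) (N\<lparr>carrier := Y\<rparr>)). tensor_map K M N id id t \<in> V}"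
    if "t \<in> carrier (tensor K (M\<lparr>carrier := X\<rparr>) (N\<lparr>carrier := Y\<rparr>))" for t
    by (rule tensor_submodule_eqI[OF m submodule_preimage[OF module_tensor[OF m] module_tensor[OF M N] tensor_sub_map_lin V] _ that])
      (use p in \<open>auto simp: pure_tensor_closed[OF m] tensor_map_pure[OF m M N id_lin[OF X] id_lin[OF Y]]\<close>)
  then show ?thesis unfolding tensor_sub_def by auto
qed

text \<open>
  On \<open>X \<otimes> Y\<close> only the values at \<open>x \<otimes> y\<close> with \<open>x \<in> X\<close> and \<open>y \<in> Y\<close> matter.
\<close>

lemma tensor_sub_lin_eqI:
  assumes P: "module K P" and f: "f \<in> lin_maps K (tensor K M N) P" and g: "g \<in> lin_maps K (tensor K M N) P"
    and eq: "\<And>x y. x \<in> X \<Longrightarrow> y \<in> Y \<Longrightarrow> f (pure_tensor K M N x y) = g (pure_tensor K M N x y)"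
    and t: "t \<in> tensor_sub K M N X Y"
  shows "f t = g t"
proof -
  note m = submodule_module[OF M X] submodule_module[OF N Y]
  obtain s where s: "s \<in> carrier (tensor K (M\<lparr>carrier := X\<rparr>) (N\<lparr>carrier := Y\<rparr>))" "t = tensor_map K M N id id s"
    using t unfolding tensor_sub_def by auto
  have "f (tensor_map K M N id id s) = g (tensor_map K M N id id s)"
    by (rule tensor_lin_eqI[OF m P lin_comp[OF f tensor_sub_map_lin] lin_comp[OF g tensor_sub_map_lin] _ s(1)])
      (use eq in \<open>auto simp: tensor_map_pure[OF m M N id_lin[OF X] id_lin[OF Y]]\<close>)
  then show ?thesis using s(2) by simp
qed

lemma tensor_sub_lift_cong:
  assumes P: "module K P" and "bilin K M N P \<beta>" "bilin K M N P \<gamma>"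
    and eq: "\<And>x y. x \<in> X \<Longrightarrow> y \<in> Y \<Longrightarrow> \<beta> x y = \<gamma> x y"
    and t: "t \<in> tensor_sub K M N X Y"
  shows "tensor_lift K P \<beta> t = tensor_lift K P \<gamma> t"
proof (rule tensor_sub_lin_eqI[OF P tensor_lift_lin[OF M N P assms(2)] tensor_lift_lin[OF M N P assms(3)] _ t])
  show "tensor_lift K P \<beta> (pure_tensor K M N x y) = tensor_lift K P \<gamma> (pure_tensor K M N x y)"
    if "x \<in> X" "y \<in> Y" for x y
    using submodule_memD(1)[OF X that(1)] submodule_memD(1)[OF Y that(2)] eq[OF that]
    by (simp add: tensor_lift_pure[OF M N P assms(2)] tensor_lift_pure[OF M N P assms(3)])
qed

end

section \<open>Sweedler calculus\<close>

lemma module_ground_space: "cring K \<Longrightarrow> module K (ground_space K)"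
proof -
  assume "cring K"
  then interpret K: cring K .
  show ?thesis
  proof (rule moduleI)
    show "abelian_group (ground_space K)"
    proof (rule abelian_groupI)
      show "\<exists>y\<in>carrier (ground_space K). y \<oplus>\<^bsub>ground_space K\<^esub> x = \<zero>\<^bsub>ground_space K\<^esub>"
        if "x \<in> carrier (ground_space K)" for x
        using that K.l_neg by (auto simp: ground_space_def intro!: bexI[of _ "\<ominus>\<^bsub>K\<^esub> x"])
    qed (auto simp: ground_space_def K.a_ac)
  qed (auto simp: ground_space_def K.l_distr K.r_distr K.m_assoc K.is_cring)
qed

lemma ground_space_simps:
  "carrier (ground_space K) = carrier K" "x \<oplus>\<^bsub>ground_space K\<^esub> y = x \<oplus>\<^bsub>K\<^esub> y"
  "x \<odot>\<^bsub>ground_space K\<^esub> y = x \<otimes>\<^bsub>K\<^esub> y"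
  by (simp_all add: ground_space_def)

lemma lin_smult_const:
  assumes "module K P" "c \<in> carrier K" "f \<in> lin_maps K X P"
  shows "(\<lambda>x. c \<odot>\<^bsub>P\<^esub> f x) \<in> lin_maps K X P"
proof -
  interpret P: module K P by fact
  show ?thesis using assms(2) lin_closed[OF assms(3)]
    by (intro lin_mapsI) (simp_all add: lin_add[OF assms(3)] lin_smult[OF assms(3)] P.smult_r_distr
        P.smult_assoc1[symmetric] P.R.m_comm)
qed

lemma lin_smult_vector:
  assumes "module K P" "p \<in> carrier P" "f \<in> lin_maps K X (ground_space K)"
  shows "(\<lambda>x. f x \<odot>\<^bsub>P\<^esub> p) \<in> lin_maps K X P"
proof -
  interpret P: module K P by fact
  show ?thesis using assms(2) lin_closed[OF assms(3)]
    by (intro lin_mapsI) (simp_all add: ground_space_simps lin_add[OF assms(3)] lin_smult[OF assms(3)] P.smult_l_distr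
        P.smult_assoc1)
qed

text \<open>
  The order of two independent Sweedler sums can be exchanged, as for iterated finite sums.
\<close>

lemma tensor_lift_swap:
  assumes M: "module K M" and N: "module K N" and M': "module K M'" and N': "module K N'" and P: "module K P"
    and s: "s \<in> carrier (tensor K M N)" and t: "t \<in> carrier (tensor K M' N')"
    and b1: "\<And>a b. a \<in> carrier M \<Longrightarrow> b \<in> carrier N \<Longrightarrow> bilin K M' N' P (\<lambda>c d. \<beta> a b c d)"
    and b2: "\<And>c d. c \<in> carrier M' \<Longrightarrow> d \<in> carrier N' \<Longrightarrow> bilin K M N P (\<lambda>a b. \<beta> a b c d)"
  shows "tensor_lift K P (\<lambda>a b. tensor_lift K P (\<lambda>c d. \<beta> a b c d) t) s
       = tensor_lift K P (\<lambda>c d. tensor_lift K P (\<lambda>a b. \<beta> a b c d) s) t"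
proof (rule tensor_lift_unique[OF M N P _ _ _ s])
  show "bilin K M N P (\<lambda>a b. tensor_lift K P (\<lambda>c d. \<beta> a b c d) t)"
  proof (rule bilinI)
    show "(\<lambda>b. tensor_lift K P (\<lambda>c d. \<beta> a b c d) t) \<in> lin_maps K N P" if "a \<in> carrier M" for a
      by (rule lin_tensor_lift_param[OF M' N' P N t]) (use that b1 bilin_right[OF b2] in auto)
    show "(\<lambda>a. tensor_lift K P (\<lambda>c d. \<beta> a b c d) t) \<in> lin_maps K M P" if "b \<in> carrier N" for b
      by (rule lin_tensor_lift_param[OF M' N' P M t]) (use that b1 bilin_left[OF b2] in auto)
  qed
  have b3: "bilin K M' N' P (\<lambda>c d. tensor_lift K P (\<lambda>a b. \<beta> a b c d) s)" if s: "s \<in> carrier (tensor K M N)" for s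
  proof (rule bilinI)
    show "(\<lambda>d. tensor_lift K P (\<lambda>a b. \<beta> a b c d) s) \<in> lin_maps K N' P" if "c \<in> carrier M'" for c
      by (rule lin_tensor_lift_param[OF M N P N' s]) (use that b2 bilin_right[OF b1] in auto)
    show "(\<lambda>c. tensor_lift K P (\<lambda>a b. \<beta> a b c d) s) \<in> lin_maps K M' P" if "d \<in> carrier N'" for d
      by (rule lin_tensor_lift_param[OF M N P M' s]) (use that b2 bilin_left[OF b1] in auto)
  qed
  show "(\<lambda>s. tensor_lift K P (\<lambda>c d. tensor_lift K P (\<lambda>a b. \<beta> a b c d) s) t) \<in> lin_maps K (tensor K M N) P"
    by (rule lin_tensor_lift_param[OF M' N' P module_tensor[OF M N] t b3])
      (auto intro: tensor_lift_lin[OF M N P b2])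
  show "tensor_lift K P (\<lambda>c d. tensor_lift K P (\<lambda>a b. \<beta> a b c d) (pure_tensor K M N x y)) t
      = tensor_lift K P (\<lambda>c d. \<beta> x y c d) t" if "x \<in> carrier M" "y \<in> carrier N" for x y
    by (rule tensor_lift_cong[OF M' N' P b3 _ t]) (use that in \<open>auto simp: tensor_lift_pure[OF M N P b2] pure_tensor_closed[OF M N]\<close>)
qed

context assoc_algebra
begin

lemma module_H: "module K H" ..

lemma module_HH: "module K (tensor K H H)"
  by (rule module_tensor[OF module_H module_H])

lemma lin_mult_left:
  "c \<in> carrier H \<Longrightarrow> f \<in> lin_maps K X H \<Longrightarrow> (\<lambda>x. c \<otimes>\<^bsub>H\<^esub> f x) \<in> lin_maps K X H"
  using lin_closed[of f K X H]
  by (intro lin_mapsI) (simp_all add: lin_add[of f K X H] lin_smult[of f K X H] H.r_distr smult_mult_right)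

lemma lin_mult_right:
  "c \<in> carrier H \<Longrightarrow> f \<in> lin_maps K X H \<Longrightarrow> (\<lambda>x. f x \<otimes>\<^bsub>H\<^esub> c) \<in> lin_maps K X H"
  using lin_closed[of f K X H]
  by (intro lin_mapsI) (simp_all add: lin_add[of f K X H] lin_smult[of f K X H] H.l_distr smult_mult_left)

lemma tensor_mult_bilin:
  assumes P: "module K P" and t: "t \<in> carrier (tensor K H H)" and \<beta>: "bilin K H H P \<beta>"
  shows "bilin K H H P (\<lambda>a b. tensor_lift K P (\<lambda>c d. \<beta> (a \<otimes>\<^bsub>H\<^esub> c) (b \<otimes>\<^bsub>H\<^esub> d)) t)"
  by (intro bilinI lin_tensor_lift_param[OF module_H module_H P module_H t]
      lin_bilin_left[OF \<beta>] lin_bilin_right[OF \<beta>] lin_mult_left lin_mult_right lin_id) auto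

lemma tensor_lift_tensor_mult:
  assumes P: "module K P" and s: "s \<in> carrier (tensor K H H)" and t: "t \<in> carrier (tensor K H H)"
    and \<beta>: "bilin K H H P \<beta>"
  shows "tensor_lift K P \<beta> (tensor_mult K H s t)
    = tensor_lift K P (\<lambda>a b. tensor_lift K P (\<lambda>c d. \<beta> (a \<otimes>\<^bsub>H\<^esub> c) (b \<otimes>\<^bsub>H\<^esub> d)) t) s"
proof -
  note m = module_H module_HH
  note \<beta>l = tensor_lift_lin[OF m(1,1) P \<beta>]
  note p = pure_tensor_bilin[OF m(1,1)]
  have in_b: "bilin K H H (tensor K H H) (\<lambda>c d. pure_tensor K H H (a \<otimes>\<^bsub>H\<^esub> c) (b \<otimes>\<^bsub>H\<^esub> d))"
    if "a \<in> carrier H" "b \<in> carrier H" for a b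
    by (rule bilin_precomp[OF p]) (use that in \<open>auto intro: lin_mult_left lin_id\<close>)
  note ob = tensor_mult_bilin[OF m(2) t p]
  have "tensor_lift K P \<beta> (tensor_mult K H s t) = tensor_lift K P (\<lambda>a b. tensor_lift K P \<beta>
      (tensor_lift K (tensor K H H) (\<lambda>c d. pure_tensor K H H (a \<otimes>\<^bsub>H\<^esub> c) (b \<otimes>\<^bsub>H\<^esub> d)) t)) s"
    unfolding tensor_mult_def by (rule lin_tensor_lift[OF m(1,1) m(2) P ob \<beta>l s])
  also have "\<dots> = tensor_lift K P (\<lambda>a b. tensor_lift K P (\<lambda>c d. \<beta> (a \<otimes>\<^bsub>H\<^esub> c) (b \<otimes>\<^bsub>H\<^esub> d)) t) s"
  proof (rule tensor_lift_cong[OF m(1,1) P bilin_comp_lin[OF m(1,1) \<beta>l ob] _ s])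
    fix a b assume ab: "a \<in> carrier H" "b \<in> carrier H"
    show "tensor_lift K P \<beta> (tensor_lift K (tensor K H H) (\<lambda>c d. pure_tensor K H H (a \<otimes>\<^bsub>H\<^esub> c) (b \<otimes>\<^bsub>H\<^esub> d)) t)
      = tensor_lift K P (\<lambda>c d. \<beta> (a \<otimes>\<^bsub>H\<^esub> c) (b \<otimes>\<^bsub>H\<^esub> d)) t"
      using ab lin_tensor_lift[OF m(1,1) m(2) P in_b[OF ab] \<beta>l t]
        tensor_lift_cong[OF m(1,1) P bilin_comp_lin[OF m(1,1) \<beta>l in_b[OF ab]] _ t,
          of "\<lambda>c d. \<beta> (a \<otimes>\<^bsub>H\<^esub> c) (b \<otimes>\<^bsub>H\<^esub> d)"]
      by (simp add: tensor_lift_pure[OF m(1,1) P \<beta>])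
  qed
  finally show ?thesis .
qed

end

context hopf_algebra
begin

lemma module_K: "module K (ground_space K)"
  by (rule module_ground_space) (rule K.is_cring)

lemma comult_closed [simp]: "h \<in> carrier H \<Longrightarrow> comult H h \<in> carrier (tensor K H H)"
  by (rule lin_closed[OF comult_linear])

lemma counit_closed [simp]: "h \<in> carrier H \<Longrightarrow> counit H h \<in> carrier K"
  using lin_closed[OF counit_linear] by (simp add: ground_space_simps)

lemma antipode_closed [simp]: "h \<in> carrier H \<Longrightarrow> antipode H h \<in> carrier H"
  by (rule lin_closed[OF antipode_linear])

text \<open>The Sweedler sum of \<open>\<beta> h\<^sub>1 h\<^sub>2\<close>.\<close>

abbreviation sw :: "('k, 'p, 'c) module_scheme \<Rightarrow> ('h \<Rightarrow> 'h \<Rightarrow> 'p) \<Rightarrow> 'h \<Rightarrow> 'p"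
  where "sw P \<beta> h \<equiv> tensor_lift K P \<beta> (comult H h)"

lemma sw_lin: "module K P \<Longrightarrow> bilin K H H P \<beta> \<Longrightarrow> sw P \<beta> \<in> lin_maps K H P"
  by (rule lin_comp[OF tensor_lift_lin[OF module_H module_H] comult_linear])

lemma sw_closed: "module K P \<Longrightarrow> bilin K H H P \<beta> \<Longrightarrow> h \<in> carrier H \<Longrightarrow> sw P \<beta> h \<in> carrier P"
  by (rule lin_closed[OF sw_lin])

lemma lin_sw_arg:
  "module K P \<Longrightarrow> bilin K H H P \<beta> \<Longrightarrow> f \<in> lin_maps K X H \<Longrightarrow> (\<lambda>x. sw P \<beta> (f x)) \<in> lin_maps K X P"
  by (rule lin_comp[OF sw_lin])

lemma lin_sw_param:
  assumes "module K P" "module K X" "h \<in> carrier H"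
    and "\<And>x. x \<in> carrier X \<Longrightarrow> bilin K H H P (\<beta> x)"
    and "\<And>u v. u \<in> carrier H \<Longrightarrow> v \<in> carrier H \<Longrightarrow> (\<lambda>x. \<beta> x u v) \<in> lin_maps K X P"
  shows "(\<lambda>x. sw P (\<beta> x) h) \<in> lin_maps K X P"
  by (rule lin_tensor_lift_param[OF module_H module_H]) (use assms in auto)

text \<open>
  Backward chaining with these rules proves the linearity and bilinearity side conditions: each rule
  peels off the outermost operation that surrounds the variable.
\<close>

lemmas lin_rules = bilinI lin_id module_H lin_mult_left lin_mult_right
  lin_comp[OF antipode_linear] antipode_linear
  lin_comp[OF counit_linear] counit_linear
  lin_sw_arg lin_sw_param lin_smult_const lin_smult_vector sw_closed

lemma sw_cong:
  "module K P \<Longrightarrow> bilin K H H P \<beta> \<Longrightarrow> h \<in> carrier H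
    \<Longrightarrow> (\<And>x y. x \<in> carrier H \<Longrightarrow> y \<in> carrier H \<Longrightarrow> \<beta> x y = \<gamma> x y) \<Longrightarrow> sw P \<beta> h = sw P \<gamma> h"
  using tensor_lift_cong[OF module_H module_H, of P \<beta> \<gamma> "comult H h"] by simp

lemma lin_sw:
  "module K P \<Longrightarrow> module K Q \<Longrightarrow> bilin K H H P \<beta> \<Longrightarrow> f \<in> lin_maps K P Q \<Longrightarrow> h \<in> carrier H
    \<Longrightarrow> f (sw P \<beta> h) = sw Q (\<lambda>x y. f (\<beta> x y)) h"
  using lin_tensor_lift[OF module_H module_H, of P Q \<beta> f "comult H h"] by simp

lemma sw_swap:
  assumes "module K P" "x \<in> carrier H" "y \<in> carrier H"
    and "\<And>a b. a \<in> carrier H \<Longrightarrow> b \<in> carrier H \<Longrightarrow> bilin K H H P (\<lambda>c d. \<beta> a b c d)"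
    and "\<And>c d. c \<in> carrier H \<Longrightarrow> d \<in> carrier H \<Longrightarrow> bilin K H H P (\<lambda>a b. \<beta> a b c d)"
  shows "sw P (\<lambda>a b. sw P (\<lambda>c d. \<beta> a b c d) y) x = sw P (\<lambda>c d. sw P (\<lambda>a b. \<beta> a b c d) x) y"
  by (rule tensor_lift_swap[OF module_H module_H module_H module_H]) (use assms in auto)

lemma sw_counit_left:
  assumes "module K P" "f \<in> lin_maps K H P" "h \<in> carrier H"
  shows "sw P (\<lambda>x y. counit H x \<odot>\<^bsub>P\<^esub> f y) h = f h"
proof -
  have "f h = f (sw H (\<lambda>x y. counit H x \<odot>\<^bsub>H\<^esub> y) h)" using assms(3) by (simp add: counit_left)
  also have "\<dots> = sw P (\<lambda>x y. f (counit H x \<odot>\<^bsub>H\<^esub> y)) h"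
    by (rule lin_sw) (use assms in \<open>auto intro!: lin_rules\<close>)
  also have "\<dots> = sw P (\<lambda>x y. counit H x \<odot>\<^bsub>P\<^esub> f y) h"
    by (rule sw_cong) (use assms in \<open>auto intro!: lin_rules lin_comp[OF assms(2)] simp: lin_smult[OF assms(2)]\<close>)
  finally show ?thesis ..
qed

lemma sw_counit_right:
  assumes "module K P" "f \<in> lin_maps K H P" "h \<in> carrier H"
  shows "sw P (\<lambda>x y. counit H y \<odot>\<^bsub>P\<^esub> f x) h = f h"
proof -
  have "f h = f (sw H (\<lambda>x y. counit H y \<odot>\<^bsub>H\<^esub> x) h)" using assms(3) by (simp add: counit_right)
  also have "\<dots> = sw P (\<lambda>x y. f (counit H y \<odot>\<^bsub>H\<^esub> x)) h"
    by (rule lin_sw) (use assms in \<open>auto intro!: lin_rules\<close>)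
  also have "\<dots> = sw P (\<lambda>x y. counit H y \<odot>\<^bsub>P\<^esub> f x) h"
    by (rule sw_cong) (use assms in \<open>auto intro!: lin_rules lin_comp[OF assms(2)] simp: lin_smult[OF assms(2)]\<close>)
  finally show ?thesis ..
qed

lemma sw_antipode_left:
  assumes "module K P" "f \<in> lin_maps K H P" "h \<in> carrier H"
  shows "sw P (\<lambda>x y. f (antipode H x \<otimes>\<^bsub>H\<^esub> y)) h = counit H h \<odot>\<^bsub>P\<^esub> f \<one>\<^bsub>H\<^esub>"
proof -
  have "f (sw H (\<lambda>x y. antipode H x \<otimes>\<^bsub>H\<^esub> y) h) = sw P (\<lambda>x y. f (antipode H x \<otimes>\<^bsub>H\<^esub> y)) h"
    by (rule lin_sw) (use assms in \<open>auto intro!: lin_rules\<close>)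
  then show ?thesis using assms(3) by (simp add: antipode_left lin_smult[OF assms(2)])
qed

lemma sw_antipode_right:
  assumes "module K P" "f \<in> lin_maps K H P" "h \<in> carrier H"
  shows "sw P (\<lambda>x y. f (x \<otimes>\<^bsub>H\<^esub> antipode H y)) h = counit H h \<odot>\<^bsub>P\<^esub> f \<one>\<^bsub>H\<^esub>"
proof -
  have "f (sw H (\<lambda>x y. x \<otimes>\<^bsub>H\<^esub> antipode H y) h) = sw P (\<lambda>x y. f (x \<otimes>\<^bsub>H\<^esub> antipode H y)) h"
    by (rule lin_sw) (use assms in \<open>auto intro!: lin_rules\<close>)
  then show ?thesis using assms(3) by (simp add: antipode_right lin_smult[OF assms(2)])
qed

text \<open>
  Coassociativity for a trilinear \<open>\<tau>\<close>: the sum of \<open>\<tau> (h\<^sub>1\<^sub>1, h\<^sub>1\<^sub>2, h\<^sub>2)\<close> is that of \<open>\<tau> (h\<^sub>1, h\<^sub>2\<^sub>1, h\<^sub>2\<^sub>2)\<close>.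
  Both arise from the two sides of the coassociativity axiom by the linear map on \<open>H \<otimes> (H \<otimes> H)\<close> induced
  by \<open>\<tau>\<close>.
\<close>

lemma sw_coassoc:
  assumes P: "module K P" and h: "h \<in> carrier H"
    and yz: "\<And>x. x \<in> carrier H \<Longrightarrow> bilin K H H P (\<lambda>y z. \<tau> x y z)"
    and x: "\<And>y z. y \<in> carrier H \<Longrightarrow> z \<in> carrier H \<Longrightarrow> (\<lambda>x. \<tau> x y z) \<in> lin_maps K H P"
  shows "sw P (\<lambda>w z. sw P (\<lambda>x y. \<tau> x y z) w) h = sw P (\<lambda>x w. sw P (\<lambda>y z. \<tau> x y z) w) h"
proof -
  note m = module_H module_HH module_tensor[OF module_HH module_H] module_tensor[OF module_H module_HH]
  have xy: "bilin K H H P (\<lambda>x y. \<tau> x y z)" if "z \<in> carrier H" for z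
    by (rule bilinI) (use that x bilin_left[OF yz] in auto)
  let ?L = "tensor_lift K P (\<lambda>x t. tensor_lift K P (\<lambda>y z. \<tau> x y z) t)"
  have L: "bilin K H (tensor K H H) P (\<lambda>x t. tensor_lift K P (\<lambda>y z. \<tau> x y z) t)"
  proof (rule bilinI)
    show "(\<lambda>t. tensor_lift K P (\<lambda>y z. \<tau> x y z) t) \<in> lin_maps K (tensor K H H) P" if "x \<in> carrier H" for x
      by (rule tensor_lift_lin[OF m(1,1) P yz[OF that]])
    show "(\<lambda>x. tensor_lift K P (\<lambda>y z. \<tau> x y z) t) \<in> lin_maps K H P" if "t \<in> carrier (tensor K H H)" for t
      by (rule lin_tensor_lift_param[OF m(1,1) P m(1) that yz x])
  qed
  note Ll = tensor_lift_lin[OF m(1,2) P L]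
  have id: "id \<in> lin_maps K H H" by (simp add: id_def lin_id)
  have sxy: "bilin K H H P (\<lambda>w z. sw P (\<lambda>x y. \<tau> x y z) w)"
    by (rule bilinI) (use P h x yz xy bilin_right[OF yz] bilin_left[OF yz] in \<open>auto intro!: lin_rules\<close>)
  let ?D = "tensor_map K (tensor K H H) H (comult H) id"
  note Dl = tensor_map_lin[OF m(1,1,2,1) comult_linear id]
    and Dp = tensor_map_pure[OF m(1,1,2,1) comult_linear id]
  have pz: "?L (tensor_assoc K H H H (pure_tensor K (tensor K H H) H s z)) = tensor_lift K P (\<lambda>x y. \<tau> x y z) s"
    if s: "s \<in> carrier (tensor K H H)" and z: "z \<in> carrier H" for s z
  proof (rule tensor_lift_unique[symmetric, OF m(1,1) P xy[OF z] _ _ s])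
    show "(\<lambda>s. ?L (tensor_assoc K H H H (pure_tensor K (tensor K H H) H s z))) \<in> lin_maps K (tensor K H H) P"
      by (rule lin_comp[OF Ll lin_comp[OF tensor_assoc_lin[OF m(1,1,1)] lin_pure_left[OF m(2,1) lin_id z]]])
    show "?L (tensor_assoc K H H H (pure_tensor K (tensor K H H) H (pure_tensor K H H x y) z)) = \<tau> x y z"
      if "x \<in> carrier H" "y \<in> carrier H" for x y
      using that z by (simp add: tensor_assoc_pure[OF m(1,1,1)] tensor_lift_pure[OF m(1,2) P L]
          tensor_lift_pure[OF m(1,1) P yz] pure_tensor_closed[OF m(1,1)])
  qed
  have "?L (tensor_assoc K H H H (?D (comult H h))) = sw P (\<lambda>w z. sw P (\<lambda>x y. \<tau> x y z) w) h"
  proof (rule tensor_lift_unique[symmetric, OF m(1,1) P sxy])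
    show "(\<lambda>t. ?L (tensor_assoc K H H H (?D t))) \<in> lin_maps K (tensor K H H) P"
      by (rule lin_comp[OF Ll lin_comp[OF tensor_assoc_lin[OF m(1,1,1)] Dl]])
    show "?L (tensor_assoc K H H H (?D (pure_tensor K H H w z))) = sw P (\<lambda>x y. \<tau> x y z) w"
      if "w \<in> carrier H" "z \<in> carrier H" for w z
      using that by (subst Dp) (simp_all add: pz[OF comult_closed])
  qed (use h in simp)
  moreover have "?L (tensor_map K H (tensor K H H) id (comult H) (comult H h))
      = sw P (\<lambda>x w. sw P (\<lambda>y z. \<tau> x y z) w) h"
    using tensor_lift_map[OF m(1,1,1,2) id comult_linear P L comult_closed[OF h]] by simp
  ultimately show ?thesis using coassoc[OF h] by simp
qed

lemma sw_mult:
  assumes "module K P" "x \<in> carrier H" "y \<in> carrier H" "bilin K H H P \<beta>"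
  shows "sw P \<beta> (x \<otimes>\<^bsub>H\<^esub> y) = sw P (\<lambda>a b. sw P (\<lambda>c d. \<beta> (a \<otimes>\<^bsub>H\<^esub> c) (b \<otimes>\<^bsub>H\<^esub> d)) y) x"
  using assms by (simp add: comult_mult tensor_lift_tensor_mult)

text \<open>
  In Sweedler notation \<open>S(x\<^sub>1 y) x\<^sub>2 = S(x\<^sub>1 y\<^sub>1) x\<^sub>2 y\<^sub>2 S(y\<^sub>3) = \<epsilon>(x y\<^sub>1) S(y\<^sub>2) = \<epsilon>(x) S(y)\<close>: the factor
  \<open>y\<^sub>2 S(y\<^sub>3)\<close> is inserted by the antipode axiom, and then \<open>S(x\<^sub>1 y\<^sub>1) x\<^sub>2 y\<^sub>2\<close> is the antipode axiom for \<open>x y\<^sub>1\<close>.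
\<close>

lemma sw_antipode_mult:
  assumes x: "x \<in> carrier H" and y: "y \<in> carrier H"
  shows "sw H (\<lambda>p q. antipode H (p \<otimes>\<^bsub>H\<^esub> y) \<otimes>\<^bsub>H\<^esub> q) x = counit H x \<odot>\<^bsub>H\<^esub> antipode H y"
proof -
  let ?S = "antipode H" and ?e = "counit H"
  note m = module_H
  (* insertion of a S(b), with a and b the last two Sweedler factors of y *)
  have exp: "?S (p \<otimes>\<^bsub>H\<^esub> y) \<otimes>\<^bsub>H\<^esub> q
      = sw H (\<lambda>w b. sw H (\<lambda>u a. (?S (p \<otimes>\<^bsub>H\<^esub> u) \<otimes>\<^bsub>H\<^esub> (q \<otimes>\<^bsub>H\<^esub> a)) \<otimes>\<^bsub>H\<^esub> ?S b) w) y"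
    if pq: "p \<in> carrier H" "q \<in> carrier H" for p q
  proof -
    have "?S (p \<otimes>\<^bsub>H\<^esub> y) \<otimes>\<^bsub>H\<^esub> q = sw H (\<lambda>u v. ?e v \<odot>\<^bsub>H\<^esub> (?S (p \<otimes>\<^bsub>H\<^esub> u) \<otimes>\<^bsub>H\<^esub> q)) y"
      by (rule sw_counit_right[symmetric, where f = "\<lambda>u. ?S (p \<otimes>\<^bsub>H\<^esub> u) \<otimes>\<^bsub>H\<^esub> q"])
        (use pq y in \<open>auto intro!: lin_rules\<close>)
    also have "\<dots> = sw H (\<lambda>u v. sw H (\<lambda>a b. (?S (p \<otimes>\<^bsub>H\<^esub> u) \<otimes>\<^bsub>H\<^esub> (q \<otimes>\<^bsub>H\<^esub> a)) \<otimes>\<^bsub>H\<^esub> ?S b) v) y"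
    proof (rule sw_cong)
      fix u v assume uv: "u \<in> carrier H" "v \<in> carrier H"
      let ?f = "\<lambda>w. ?S (p \<otimes>\<^bsub>H\<^esub> u) \<otimes>\<^bsub>H\<^esub> (q \<otimes>\<^bsub>H\<^esub> w)"
      have "sw H (\<lambda>a b. ?f (a \<otimes>\<^bsub>H\<^esub> ?S b)) v = ?e v \<odot>\<^bsub>H\<^esub> ?f \<one>\<^bsub>H\<^esub>"
        by (rule sw_antipode_right) (use pq uv in \<open>auto intro!: lin_rules\<close>)
      moreover have "sw H (\<lambda>a b. ?f (a \<otimes>\<^bsub>H\<^esub> ?S b)) v
          = sw H (\<lambda>a b. (?S (p \<otimes>\<^bsub>H\<^esub> u) \<otimes>\<^bsub>H\<^esub> (q \<otimes>\<^bsub>H\<^esub> a)) \<otimes>\<^bsub>H\<^esub> ?S b) v"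
        by (rule sw_cong) (use pq uv in \<open>auto intro!: lin_rules simp: H.m_assoc\<close>)
      ultimately show "?e v \<odot>\<^bsub>H\<^esub> (?S (p \<otimes>\<^bsub>H\<^esub> u) \<otimes>\<^bsub>H\<^esub> q)
          = sw H (\<lambda>a b. (?S (p \<otimes>\<^bsub>H\<^esub> u) \<otimes>\<^bsub>H\<^esub> (q \<otimes>\<^bsub>H\<^esub> a)) \<otimes>\<^bsub>H\<^esub> ?S b) v"
        using pq uv by simp
    qed (use pq y in \<open>auto intro!: lin_rules\<close>)
    also have "\<dots> = sw H (\<lambda>w b. sw H (\<lambda>u a. (?S (p \<otimes>\<^bsub>H\<^esub> u) \<otimes>\<^bsub>H\<^esub> (q \<otimes>\<^bsub>H\<^esub> a)) \<otimes>\<^bsub>H\<^esub> ?S b) w) y"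
      by (rule sw_coassoc[symmetric]) (use pq y in \<open>auto intro!: lin_rules\<close>)
    finally show ?thesis .
  qed
  have "sw H (\<lambda>p q. ?S (p \<otimes>\<^bsub>H\<^esub> y) \<otimes>\<^bsub>H\<^esub> q) x
      = sw H (\<lambda>p q. sw H (\<lambda>w b. sw H (\<lambda>u a. (?S (p \<otimes>\<^bsub>H\<^esub> u) \<otimes>\<^bsub>H\<^esub> (q \<otimes>\<^bsub>H\<^esub> a)) \<otimes>\<^bsub>H\<^esub> ?S b) w) y) x"
    by (rule sw_cong) (use x y exp in \<open>auto intro!: lin_rules\<close>)
  also have "\<dots> = sw H (\<lambda>w b. sw H (\<lambda>p q. sw H (\<lambda>u a. (?S (p \<otimes>\<^bsub>H\<^esub> u) \<otimes>\<^bsub>H\<^esub> (q \<otimes>\<^bsub>H\<^esub> a)) \<otimes>\<^bsub>H\<^esub> ?S b) w) x) y"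
    by (rule sw_swap) (use x y in \<open>auto intro!: lin_rules\<close>)
  also have "\<dots> = sw H (\<lambda>w b. ?e w \<odot>\<^bsub>H\<^esub> (?e x \<odot>\<^bsub>H\<^esub> ?S b)) y"
  proof (rule sw_cong)
    fix w b assume wb: "w \<in> carrier H" "b \<in> carrier H"
    let ?f = "\<lambda>v. v \<otimes>\<^bsub>H\<^esub> ?S b"
    have "sw H (\<lambda>p q. sw H (\<lambda>u a. ?f (?S (p \<otimes>\<^bsub>H\<^esub> u) \<otimes>\<^bsub>H\<^esub> (q \<otimes>\<^bsub>H\<^esub> a))) w) x
        = sw H (\<lambda>r s. ?f (?S r \<otimes>\<^bsub>H\<^esub> s)) (x \<otimes>\<^bsub>H\<^esub> w)"
      by (rule sw_mult[symmetric]) (use x wb in \<open>auto intro!: lin_rules\<close>)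
    also have "\<dots> = ?e (x \<otimes>\<^bsub>H\<^esub> w) \<odot>\<^bsub>H\<^esub> ?f \<one>\<^bsub>H\<^esub>"
      by (rule sw_antipode_left) (use x wb in \<open>auto intro!: lin_rules\<close>)
    also have "\<dots> = ?e w \<odot>\<^bsub>H\<^esub> (?e x \<odot>\<^bsub>H\<^esub> ?S b)"
      using x wb by (simp add: counit_mult smult_assoc1[symmetric] K.m_comm)
    finally show "sw H (\<lambda>p q. sw H (\<lambda>u a. ?f (?S (p \<otimes>\<^bsub>H\<^esub> u) \<otimes>\<^bsub>H\<^esub> (q \<otimes>\<^bsub>H\<^esub> a))) w) x
        = ?e w \<odot>\<^bsub>H\<^esub> (?e x \<odot>\<^bsub>H\<^esub> ?S b)" .
  qed (use x y in \<open>auto intro!: lin_rules\<close>)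
  also have "\<dots> = ?e x \<odot>\<^bsub>H\<^esub> ?S y"
    by (rule sw_counit_left) (use x y in \<open>auto intro!: lin_rules\<close>)
  finally show ?thesis .
qed

text \<open>
  By the preceding lemma, \<open>S(xy) = S(x\<^sub>1 y) x\<^sub>2 S(x\<^sub>3) = \<epsilon>(x\<^sub>1) S(y) S(x\<^sub>2) = S(y) S(x)\<close>.
\<close>

theorem antipode_mult:
  assumes x: "x \<in> carrier H" and y: "y \<in> carrier H"
  shows "antipode H (x \<otimes>\<^bsub>H\<^esub> y) = antipode H y \<otimes>\<^bsub>H\<^esub> antipode H x"
proof -
  let ?S = "antipode H" and ?e = "counit H"
  have "?S (x \<otimes>\<^bsub>H\<^esub> y) = sw H (\<lambda>u v. ?e v \<odot>\<^bsub>H\<^esub> ?S (u \<otimes>\<^bsub>H\<^esub> y)) x"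
    by (rule sw_counit_right[symmetric]) (use x y in \<open>auto intro!: lin_rules\<close>)
  also have "\<dots> = sw H (\<lambda>u v. sw H (\<lambda>a b. (?S (u \<otimes>\<^bsub>H\<^esub> y) \<otimes>\<^bsub>H\<^esub> a) \<otimes>\<^bsub>H\<^esub> ?S b) v) x"
  proof (rule sw_cong)
    fix u v assume uv: "u \<in> carrier H" "v \<in> carrier H"
    let ?f = "\<lambda>w. ?S (u \<otimes>\<^bsub>H\<^esub> y) \<otimes>\<^bsub>H\<^esub> w"
    have "sw H (\<lambda>a b. ?f (a \<otimes>\<^bsub>H\<^esub> ?S b)) v = ?e v \<odot>\<^bsub>H\<^esub> ?f \<one>\<^bsub>H\<^esub>"
      by (rule sw_antipode_right) (use y uv in \<open>auto intro!: lin_rules\<close>)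
    moreover have "sw H (\<lambda>a b. ?f (a \<otimes>\<^bsub>H\<^esub> ?S b)) v = sw H (\<lambda>a b. (?S (u \<otimes>\<^bsub>H\<^esub> y) \<otimes>\<^bsub>H\<^esub> a) \<otimes>\<^bsub>H\<^esub> ?S b) v"
      by (rule sw_cong) (use y uv in \<open>auto intro!: lin_rules simp: H.m_assoc\<close>)
    ultimately show "?e v \<odot>\<^bsub>H\<^esub> ?S (u \<otimes>\<^bsub>H\<^esub> y) = sw H (\<lambda>a b. (?S (u \<otimes>\<^bsub>H\<^esub> y) \<otimes>\<^bsub>H\<^esub> a) \<otimes>\<^bsub>H\<^esub> ?S b) v"
      using y uv by simp
  qed (use x y in \<open>auto intro!: lin_rules\<close>)
  also have "\<dots> = sw H (\<lambda>w b. sw H (\<lambda>u a. (?S (u \<otimes>\<^bsub>H\<^esub> y) \<otimes>\<^bsub>H\<^esub> a) \<otimes>\<^bsub>H\<^esub> ?S b) w) x"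
    by (rule sw_coassoc[symmetric]) (use x y in \<open>auto intro!: lin_rules\<close>)
  also have "\<dots> = sw H (\<lambda>w b. ?e w \<odot>\<^bsub>H\<^esub> (?S y \<otimes>\<^bsub>H\<^esub> ?S b)) x"
  proof (rule sw_cong)
    fix w b assume wb: "w \<in> carrier H" "b \<in> carrier H"
    have "sw H (\<lambda>u a. (?S (u \<otimes>\<^bsub>H\<^esub> y) \<otimes>\<^bsub>H\<^esub> a) \<otimes>\<^bsub>H\<^esub> ?S b) w
        = sw H (\<lambda>u a. ?S (u \<otimes>\<^bsub>H\<^esub> y) \<otimes>\<^bsub>H\<^esub> a) w \<otimes>\<^bsub>H\<^esub> ?S b"
      by (rule lin_sw[symmetric, where f = "\<lambda>v. v \<otimes>\<^bsub>H\<^esub> ?S b"]) (use y wb in \<open>auto intro!: lin_rules\<close>)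
    then show "sw H (\<lambda>u a. (?S (u \<otimes>\<^bsub>H\<^esub> y) \<otimes>\<^bsub>H\<^esub> a) \<otimes>\<^bsub>H\<^esub> ?S b) w = ?e w \<odot>\<^bsub>H\<^esub> (?S y \<otimes>\<^bsub>H\<^esub> ?S b)"
      using y wb by (simp add: sw_antipode_mult smult_mult_left)
  qed (use x y in \<open>auto intro!: lin_rules\<close>)
  also have "\<dots> = ?S y \<otimes>\<^bsub>H\<^esub> ?S x"
    by (rule sw_counit_left) (use x y in \<open>auto intro!: lin_rules\<close>)
  finally show ?thesis .
qed

text \<open>
  Apply \<open>\<epsilon>\<close> to \<open>S(x\<^sub>1) x\<^sub>2 = \<epsilon>(x) 1\<close> and use the counit axiom.
\<close>

lemma counit_antipode:
  assumes x: "x \<in> carrier H"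
  shows "counit H (antipode H x) = counit H x"
proof -
  let ?S = "antipode H" and ?e = "counit H" and ?G = "ground_space K"
  have "sw ?G (\<lambda>p q. ?e (?S p \<otimes>\<^bsub>H\<^esub> q)) x = ?e x \<odot>\<^bsub>?G\<^esub> ?e \<one>\<^bsub>H\<^esub>"
    by (rule sw_antipode_left[OF module_K counit_linear x])
  moreover have "sw ?G (\<lambda>p q. ?e (?S p \<otimes>\<^bsub>H\<^esub> q)) x = sw ?G (\<lambda>p q. ?e q \<odot>\<^bsub>?G\<^esub> ?e (?S p)) x"
    by (rule sw_cong) (use x in \<open>auto intro!: lin_rules module_K simp: counit_mult ground_space_simps K.m_comm\<close>)
  moreover have "\<dots> = ?e (?S x)"
    by (rule sw_counit_right) (use x in \<open>auto intro!: lin_rules module_K\<close>)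
  ultimately show ?thesis using x by (simp add: ground_space_simps counit_one)
qed

end

section \<open>Transport of Hopf algebra structures\<close>

text \<open>
  Quotients and subalgebras appear as records that differ only in fields irrelevant to the module or
  ring axioms.
\<close>

lemma module_cong:
  assumes M: "module K M"
    and eq: "carrier N = carrier M" "add N = add M" "\<zero>\<^bsub>N\<^esub> = \<zero>\<^bsub>M\<^esub>" "smult N = smult M"
  shows "module K N"
proof -
  interpret M: module K M by fact
  show ?thesis
  proof (rule moduleI)
    show "abelian_group N"
    proof (rule abelian_groupI)
      show "\<exists>y\<in>carrier N. y \<oplus>\<^bsub>N\<^esub> x = \<zero>\<^bsub>N\<^esub>" if "x \<in> carrier N" for x
        using that M.l_neg by (auto simp: eq intro!: bexI[of _ "\<ominus>\<^bsub>M\<^esub> x"])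
    qed (auto simp: eq M.a_ac)
  qed (auto simp: eq M.R.is_cring M.smult_l_distr M.smult_r_distr M.smult_assoc1)
qed

lemma ring_cong:
  assumes R: "ring R"
    and eq: "carrier S = carrier R" "add S = add R" "\<zero>\<^bsub>S\<^esub> = \<zero>\<^bsub>R\<^esub>" "mult S = mult R" "\<one>\<^bsub>S\<^esub> = \<one>\<^bsub>R\<^esub>"
  shows "ring S"
proof -
  interpret R: ring R by fact
  show ?thesis
  proof (rule ringI)
    show "abelian_group S"
    proof (rule abelian_groupI)
      show "\<exists>y\<in>carrier S. y \<oplus>\<^bsub>S\<^esub> x = \<zero>\<^bsub>S\<^esub>" if "x \<in> carrier S" for x
        using that R.l_neg by (auto simp: eq intro!: bexI[of _ "\<ominus>\<^bsub>R\<^esub> x"])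
    qed (auto simp: eq R.a_ac)
    show "monoid S" by (rule monoidI) (auto simp: eq R.m_assoc)
  qed (auto simp: eq R.l_distr R.r_distr)
qed

lemma lin_maps_cong:
  assumes "carrier M' = carrier M" "add M' = add M" "smult M' = smult M"
    and "carrier N' = carrier N" "add N' = add N" "smult N' = smult N"
  shows "lin_maps K M' N' = lin_maps K M N"
  unfolding lin_maps_def assms ..

lemma assoc_algebraI:
  assumes "field K" "module K H" "ring H"
    and "\<And>a x y. \<lbrakk>a \<in> carrier K; x \<in> carrier H; y \<in> carrier H\<rbrakk>
      \<Longrightarrow> (a \<odot>\<^bsub>H\<^esub> x) \<otimes>\<^bsub>H\<^esub> y = a \<odot>\<^bsub>H\<^esub> (x \<otimes>\<^bsub>H\<^esub> y)"
    and "\<And>a x y. \<lbrakk>a \<in> carrier K; x \<in> carrier H; y \<in> carrier H\<rbrakk>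
      \<Longrightarrow> x \<otimes>\<^bsub>H\<^esub> (a \<odot>\<^bsub>H\<^esub> y) = a \<odot>\<^bsub>H\<^esub> (x \<otimes>\<^bsub>H\<^esub> y)"
  shows "assoc_algebra K H"
  by (intro assoc_algebra.intro assoc_algebra_axioms.intro assms)

lemma (in assoc_algebra) subalg_assoc_algebra:
  assumes X: "subalg K H X"
    and eq: "carrier A = X" "add A = add H" "\<zero>\<^bsub>A\<^esub> = \<zero>\<^bsub>H\<^esub>" "mult A = mult H" "\<one>\<^bsub>A\<^esub> = \<one>\<^bsub>H\<^esub>" "smult A = smult H"
  shows "assoc_algebra K A"
proof -
  have sm: "submodule X K H" and sr: "subring X H" using X by (auto simp: subalg_def)
  note Xc = submodule_memD(1)[OF sm]
  show ?thesis
  proof (rule assoc_algebraI)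
    show "field K" by unfold_locales
    show "module K A"
      by (rule module_cong[OF submodule_module[OF module_H sm]]) (simp_all add: eq)
    show "ring A"
      by (rule ring_cong[OF H.subring_is_ring[OF sr]]) (simp_all add: eq)
  qed (use Xc in \<open>auto simp: eq smult_mult_left smult_mult_right\<close>)
qed

text \<open>
  A map of algebras compatible with linear operations of comultiplication, counit and antipode. Each Hopf
  axiom for \<open>C\<close> that involves these operations becomes, after applying \<open>\<phi>\<close> to both sides, the same axiom
  for \<open>D\<close> at a point of the image. Hence the axioms pass forward along a surjection and backward along
  an injection, which treats quotients and Hopf subalgebras together.
\<close>

locale structure_map =
  C: assoc_algebra K C + D: assoc_algebra K D
  for K :: "('k, 'z) ring_scheme" and C :: "('k, 'c, 'a) hopf_scheme" and D :: "('k, 'd, 'b) hopf_scheme" +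
  fixes \<phi> :: "'c \<Rightarrow> 'd"
  assumes \<phi>_lin: "\<phi> \<in> lin_maps K C D" and \<phi>_hom: "\<phi> \<in> ring_hom C D"
    and C_comult: "comult C \<in> lin_maps K C (tensor K C C)" and D_comult: "comult D \<in> lin_maps K D (tensor K D D)"
    and C_counit: "counit C \<in> lin_maps K C (ground_space K)" and D_counit: "counit D \<in> lin_maps K D (ground_space K)"
    and C_antipode: "antipode C \<in> lin_maps K C C" and D_antipode: "antipode D \<in> lin_maps K D D"
    and \<phi>_comult: "c \<in> carrier C \<Longrightarrow> comult D (\<phi> c) = tensor_map K D D \<phi> \<phi> (comult C c)"
    and \<phi>_counit: "c \<in> carrier C \<Longrightarrow> counit D (\<phi> c) = counit C c"
    and \<phi>_antipode: "c \<in> carrier C \<Longrightarrow> antipode D (\<phi> c) = \<phi> (antipode C c)"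
begin

lemma \<phi>_closed: "c \<in> carrier C \<Longrightarrow> \<phi> c \<in> carrier D"
  by (rule lin_closed[OF \<phi>_lin])

lemma \<phi>_mult: "x \<in> carrier C \<Longrightarrow> y \<in> carrier C \<Longrightarrow> \<phi> (x \<otimes>\<^bsub>C\<^esub> y) = \<phi> x \<otimes>\<^bsub>D\<^esub> \<phi> y"
  and \<phi>_one: "\<phi> \<one>\<^bsub>C\<^esub> = \<one>\<^bsub>D\<^esub>"
  using \<phi>_hom by (auto simp: ring_hom_mult ring_hom_one)

lemmas mC = C.module_H and mD = D.module_H
lemmas mCC = module_tensor[OF mC mC] and mDD = module_tensor[OF mD mD]
lemmas \<phi>\<phi>_lin = tensor_map_lin[OF mC mC mD mD \<phi>_lin \<phi>_lin]

lemma ids: "id \<in> lin_maps K C C" "id \<in> lin_maps K D D"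
  by (simp_all add: id_def lin_id)

lemma hopf_hom: "\<phi> \<in> hopf_hom K C D"
  unfolding hopf_hom_def using \<phi>_lin \<phi>_hom \<phi>_comult \<phi>_counit \<phi>_antipode by auto

lemma coassoc_left_transport:
  assumes c: "c \<in> carrier C"
  shows "tensor_assoc K D D D (tensor_map K (tensor K D D) D (comult D) id (comult D (\<phi> c)))
    = tensor_map K D (tensor K D D) \<phi> (tensor_map K D D \<phi> \<phi>)
        (tensor_assoc K C C C (tensor_map K (tensor K C C) C (comult C) id (comult C c)))"
proof -
  note t = lin_closed[OF C_comult c]
  have "tensor_map K (tensor K D D) D (comult D) id (comult D (\<phi> c))
    = tensor_map K (tensor K D D) D (\<lambda>x. comult D (\<phi> x)) (\<lambda>x. id (\<phi> x)) (comult C c)"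
    unfolding \<phi>_comult[OF c] by (rule tensor_map_comp[OF mC mC mD mD \<phi>_lin \<phi>_lin mDD mD D_comult ids(2) t])
  also have "\<dots> = tensor_map K (tensor K D D) D (\<lambda>x. tensor_map K D D \<phi> \<phi> (comult C x)) (\<lambda>x. \<phi> (id x)) (comult C c)"
    by (rule tensor_map_cong[OF mC mC mDD mD lin_comp[OF D_comult \<phi>_lin] lin_comp[OF ids(2) \<phi>_lin] _ _ t])
      (simp_all add: \<phi>_comult)
  also have "\<dots> = tensor_map K (tensor K D D) D (tensor_map K D D \<phi> \<phi>) \<phi>
      (tensor_map K (tensor K C C) C (comult C) id (comult C c))"
    by (rule tensor_map_comp[OF mC mC mCC mC C_comult ids(1) mDD mD \<phi>\<phi>_lin \<phi>_lin t, symmetric])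
  finally show ?thesis
    using tensor_assoc_natural[OF mC mC mC mD mD mD \<phi>_lin \<phi>_lin \<phi>_lin
        lin_closed[OF tensor_map_lin[OF mC mC mCC mC C_comult ids(1)] t]] by simp
qed

lemma coassoc_right_transport:
  assumes c: "c \<in> carrier C"
  shows "tensor_map K D (tensor K D D) id (comult D) (comult D (\<phi> c))
    = tensor_map K D (tensor K D D) \<phi> (tensor_map K D D \<phi> \<phi>)
        (tensor_map K C (tensor K C C) id (comult C) (comult C c))"
proof -
  note t = lin_closed[OF C_comult c]
  have "tensor_map K D (tensor K D D) id (comult D) (comult D (\<phi> c))
    = tensor_map K D (tensor K D D) (\<lambda>x. id (\<phi> x)) (\<lambda>x. comult D (\<phi> x)) (comult C c)"
    unfolding \<phi>_comult[OF c] by (rule tensor_map_comp[OF mC mC mD mD \<phi>_lin \<phi>_lin mD mDD ids(2) D_comult t])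
  also have "\<dots> = tensor_map K D (tensor K D D) (\<lambda>x. \<phi> (id x)) (\<lambda>x. tensor_map K D D \<phi> \<phi> (comult C x)) (comult C c)"
    by (rule tensor_map_cong[OF mC mC mD mDD lin_comp[OF ids(2) \<phi>_lin] lin_comp[OF D_comult \<phi>_lin] _ _ t])
      (simp_all add: \<phi>_comult)
  also have "\<dots> = tensor_map K D (tensor K D D) \<phi> (tensor_map K D D \<phi> \<phi>)
      (tensor_map K C (tensor K C C) id (comult C) (comult C c))"
    by (rule tensor_map_comp[OF mC mC mC mCC ids(1) C_comult mD mDD \<phi>_lin \<phi>\<phi>_lin t, symmetric])
  finally show ?thesis .
qed

lemma sweedler_transport:
  assumes c: "c \<in> carrier C" and P: "module K P" and Q: "module K Q" and f: "f \<in> lin_maps K P Q"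
    and \<beta>: "bilin K C C P \<beta>" and \<gamma>: "bilin K D D Q \<gamma>"
    and eq: "\<And>x y. x \<in> carrier C \<Longrightarrow> y \<in> carrier C \<Longrightarrow> f (\<beta> x y) = \<gamma> (\<phi> x) (\<phi> y)"
  shows "tensor_lift K Q \<gamma> (comult D (\<phi> c)) = f (tensor_lift K P \<beta> (comult C c))"
proof -
  note t = lin_closed[OF C_comult c]
  have "tensor_lift K Q \<gamma> (comult D (\<phi> c)) = tensor_lift K Q (\<lambda>x y. \<gamma> (\<phi> x) (\<phi> y)) (comult C c)"
    unfolding \<phi>_comult[OF c] by (rule tensor_lift_map[OF mC mC mD mD \<phi>_lin \<phi>_lin Q \<gamma> t])
  also have "\<dots> = tensor_lift K Q (\<lambda>x y. f (\<beta> x y)) (comult C c)"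
    by (rule tensor_lift_cong[OF mC mC Q bilin_precomp[OF \<gamma> \<phi>_lin \<phi>_lin] _ t]) (simp add: eq)
  also have "\<dots> = f (tensor_lift K P \<beta> (comult C c))"
    by (rule lin_tensor_lift[OF mC mC P Q \<beta> f t, symmetric])
  finally show ?thesis .
qed

lemma bilin_counits:
  "bilin K C C C (\<lambda>x y. counit C x \<odot>\<^bsub>C\<^esub> y)" "bilin K C C C (\<lambda>x y. counit C y \<odot>\<^bsub>C\<^esub> x)"
  "bilin K D D D (\<lambda>x y. counit D x \<odot>\<^bsub>D\<^esub> y)" "bilin K D D D (\<lambda>x y. counit D y \<odot>\<^bsub>D\<^esub> x)"
  using lin_closed[OF C_counit] lin_closed[OF D_counit]
  by (auto intro!: bilinI lin_smult_const[OF mC] lin_smult_vector[OF mC] lin_smult_const[OF mD]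
      lin_smult_vector[OF mD] lin_id C_counit D_counit simp: ground_space_simps)

lemma bilin_antipodes:
  "bilin K C C C (\<lambda>x y. antipode C x \<otimes>\<^bsub>C\<^esub> y)" "bilin K C C C (\<lambda>x y. x \<otimes>\<^bsub>C\<^esub> antipode C y)"
  "bilin K D D D (\<lambda>x y. antipode D x \<otimes>\<^bsub>D\<^esub> y)" "bilin K D D D (\<lambda>x y. x \<otimes>\<^bsub>D\<^esub> antipode D y)"
  using lin_closed[OF C_antipode] lin_closed[OF D_antipode]
  by (auto intro!: bilinI C.lin_mult_left C.lin_mult_right D.lin_mult_left D.lin_mult_right
      lin_id C_antipode D_antipode)

lemma counit_left_transport:
  "c \<in> carrier C \<Longrightarrow> tensor_lift K D (\<lambda>x y. counit D x \<odot>\<^bsub>D\<^esub> y) (comult D (\<phi> c))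
    = \<phi> (tensor_lift K C (\<lambda>x y. counit C x \<odot>\<^bsub>C\<^esub> y) (comult C c))"
  by (rule sweedler_transport[OF _ mC mD \<phi>_lin bilin_counits(1,3)])
    (use lin_closed[OF C_counit] in \<open>auto simp: \<phi>_counit lin_smult[OF \<phi>_lin] ground_space_simps\<close>)

lemma counit_right_transport:
  "c \<in> carrier C \<Longrightarrow> tensor_lift K D (\<lambda>x y. counit D y \<odot>\<^bsub>D\<^esub> x) (comult D (\<phi> c))
    = \<phi> (tensor_lift K C (\<lambda>x y. counit C y \<odot>\<^bsub>C\<^esub> x) (comult C c))"
  by (rule sweedler_transport[OF _ mC mD \<phi>_lin bilin_counits(2,4)])
    (use lin_closed[OF C_counit] in \<open>auto simp: \<phi>_counit lin_smult[OF \<phi>_lin] ground_space_simps\<close>)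

lemma antipode_left_transport:
  "c \<in> carrier C \<Longrightarrow> tensor_lift K D (\<lambda>x y. antipode D x \<otimes>\<^bsub>D\<^esub> y) (comult D (\<phi> c))
    = \<phi> (tensor_lift K C (\<lambda>x y. antipode C x \<otimes>\<^bsub>C\<^esub> y) (comult C c))"
  by (rule sweedler_transport[OF _ mC mD \<phi>_lin bilin_antipodes(1,3)])
    (use lin_closed[OF C_antipode] in \<open>auto simp: \<phi>_antipode \<phi>_mult\<close>)

lemma antipode_right_transport:
  "c \<in> carrier C \<Longrightarrow> tensor_lift K D (\<lambda>x y. x \<otimes>\<^bsub>D\<^esub> antipode D y) (comult D (\<phi> c))
    = \<phi> (tensor_lift K C (\<lambda>x y. x \<otimes>\<^bsub>C\<^esub> antipode C y) (comult C c))"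
  by (rule sweedler_transport[OF _ mC mD \<phi>_lin bilin_antipodes(2,4)])
    (use lin_closed[OF C_antipode] in \<open>auto simp: \<phi>_antipode \<phi>_mult\<close>)

lemma tensor_mult_transport:
  assumes s: "s \<in> carrier (tensor K C C)" and t: "t \<in> carrier (tensor K C C)"
  shows "tensor_mult K D (tensor_map K D D \<phi> \<phi> s) (tensor_map K D D \<phi> \<phi> t)
    = tensor_map K D D \<phi> \<phi> (tensor_mult K C s t)"
proof -
  note p = pure_tensor_bilin[OF mD mD]
  note bp = tensor_map_bilin[OF mD mD \<phi>_lin \<phi>_lin]
  note t' = lin_closed[OF \<phi>\<phi>_lin t]
  let ?DD = "tensor K D D"
  have in_b: "bilin K D D ?DD (\<lambda>c d. pure_tensor K D D (a \<otimes>\<^bsub>D\<^esub> c) (b \<otimes>\<^bsub>D\<^esub> d))"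
    if "a \<in> carrier D" "b \<in> carrier D" for a b
    by (rule bilin_precomp[OF p]) (use that in \<open>auto intro: D.lin_mult_left lin_id\<close>)
  have "tensor_mult K D (tensor_map K D D \<phi> \<phi> s) (tensor_map K D D \<phi> \<phi> t)
    = tensor_lift K ?DD (\<lambda>a b. tensor_lift K ?DD
        (\<lambda>c d. pure_tensor K D D (\<phi> a \<otimes>\<^bsub>D\<^esub> c) (\<phi> b \<otimes>\<^bsub>D\<^esub> d)) (tensor_map K D D \<phi> \<phi> t)) s"
    unfolding tensor_mult_def
    by (rule tensor_lift_map[OF mC mC mD mD \<phi>_lin \<phi>_lin mDD D.tensor_mult_bilin[OF mDD t' p] s])
  also have "\<dots> = tensor_lift K ?DD (\<lambda>a b. tensor_lift K ?DD
        (\<lambda>c d. pure_tensor K D D (\<phi> (a \<otimes>\<^bsub>C\<^esub> c)) (\<phi> (b \<otimes>\<^bsub>C\<^esub> d))) t) s"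
  proof (rule tensor_lift_cong[OF mC mC mDD bilin_precomp[OF D.tensor_mult_bilin[OF mDD t' p] \<phi>_lin \<phi>_lin] _ s])
    fix a b assume ab: "a \<in> carrier C" "b \<in> carrier C"
    note ib = in_b[OF \<phi>_closed[OF ab(1)] \<phi>_closed[OF ab(2)]]
    have "tensor_lift K ?DD (\<lambda>c d. pure_tensor K D D (\<phi> a \<otimes>\<^bsub>D\<^esub> c) (\<phi> b \<otimes>\<^bsub>D\<^esub> d)) (tensor_map K D D \<phi> \<phi> t)
      = tensor_lift K ?DD (\<lambda>c d. pure_tensor K D D (\<phi> a \<otimes>\<^bsub>D\<^esub> \<phi> c) (\<phi> b \<otimes>\<^bsub>D\<^esub> \<phi> d)) t"
      by (rule tensor_lift_map[OF mC mC mD mD \<phi>_lin \<phi>_lin mDD ib t])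
    also have "\<dots> = tensor_lift K ?DD (\<lambda>c d. pure_tensor K D D (\<phi> (a \<otimes>\<^bsub>C\<^esub> c)) (\<phi> (b \<otimes>\<^bsub>C\<^esub> d))) t"
      by (rule tensor_lift_cong[OF mC mC mDD bilin_precomp[OF ib \<phi>_lin \<phi>_lin] _ t]) (simp add: \<phi>_mult ab)
    finally show "tensor_lift K ?DD (\<lambda>c d. pure_tensor K D D (\<phi> a \<otimes>\<^bsub>D\<^esub> c) (\<phi> b \<otimes>\<^bsub>D\<^esub> d)) (tensor_map K D D \<phi> \<phi> t)
      = tensor_lift K ?DD (\<lambda>c d. pure_tensor K D D (\<phi> (a \<otimes>\<^bsub>C\<^esub> c)) (\<phi> (b \<otimes>\<^bsub>C\<^esub> d))) t" .
  qed
  also have "\<dots> = tensor_map K D D \<phi> \<phi> (tensor_mult K C s t)"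
    unfolding tensor_map_def by (rule C.tensor_lift_tensor_mult[OF mDD s t bp, symmetric])
  finally show ?thesis .
qed

lemma hopf_algebra_image:
  assumes "hopf_algebra K C" and surj: "\<phi> ` carrier C = carrier D"
  shows "hopf_algebra K D"
proof -
  interpret HC: hopf_algebra K C by fact
  have ex: "\<exists>c\<in>carrier C. d = \<phi> c" if "d \<in> carrier D" for d using that surj by auto
  show ?thesis
  proof (intro hopf_algebra.intro hopf_algebra_axioms.intro coalgebra.intro coalgebra_axioms.intro)
    show "assoc_algebra K D" "field K" "module K D" by unfold_locales
    show "comult D \<in> lin_maps K D (tensor K D D)" "counit D \<in> lin_maps K D (ground_space K)"
      "antipode D \<in> lin_maps K D D"
      by (rule D_comult D_counit D_antipode)+
  next
    fix d assume "d \<in> carrier D"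
    then obtain c where c: "c \<in> carrier C" "d = \<phi> c" using ex by auto
    show "tensor_assoc K D D D (tensor_map K (tensor K D D) D (comult D) id (comult D d))
        = tensor_map K D (tensor K D D) id (comult D) (comult D d)"
      using c by (simp add: coassoc_left_transport coassoc_right_transport HC.coassoc)
    show "tensor_lift K D (\<lambda>x y. counit D x \<odot>\<^bsub>D\<^esub> y) (comult D d) = d"
      "tensor_lift K D (\<lambda>x y. counit D y \<odot>\<^bsub>D\<^esub> x) (comult D d) = d"
      using c by (simp_all add: counit_left_transport counit_right_transport HC.counit_left HC.counit_right)
    show "tensor_lift K D (\<lambda>y z. antipode D y \<otimes>\<^bsub>D\<^esub> z) (comult D d) = counit D d \<odot>\<^bsub>D\<^esub> \<one>\<^bsub>D\<^esub>"
      "tensor_lift K D (\<lambda>y z. y \<otimes>\<^bsub>D\<^esub> antipode D z) (comult D d) = counit D d \<odot>\<^bsub>D\<^esub> \<one>\<^bsub>D\<^esub>"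
      using c by (simp_all add: antipode_left_transport antipode_right_transport HC.antipode_left HC.antipode_right
          lin_smult[OF \<phi>_lin] \<phi>_one \<phi>_counit)
  next
    fix d e assume "d \<in> carrier D" "e \<in> carrier D"
    then obtain x y where *: "x \<in> carrier C" "d = \<phi> x" "y \<in> carrier C" "e = \<phi> y" using ex by meson
    then have eq: "d \<otimes>\<^bsub>D\<^esub> e = \<phi> (x \<otimes>\<^bsub>C\<^esub> y)" by (simp add: \<phi>_mult)
    show "comult D (d \<otimes>\<^bsub>D\<^esub> e) = tensor_mult K D (comult D d) (comult D e)"
      using * unfolding eq by (simp add: \<phi>_comult HC.comult_mult tensor_mult_transport)
    show "counit D (d \<otimes>\<^bsub>D\<^esub> e) = counit D d \<otimes>\<^bsub>K\<^esub> counit D e"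
      using * unfolding eq by (simp add: \<phi>_counit HC.counit_mult)
  next
    show "comult D \<one>\<^bsub>D\<^esub> = pure_tensor K D D \<one>\<^bsub>D\<^esub> \<one>\<^bsub>D\<^esub>"
      using \<phi>_comult[of "\<one>\<^bsub>C\<^esub>"] by (simp add: \<phi>_one HC.comult_one tensor_map_pure[OF mC mC mD mD \<phi>_lin \<phi>_lin])
    show "counit D \<one>\<^bsub>D\<^esub> = \<one>\<^bsub>K\<^esub>"
      using \<phi>_counit[of "\<one>\<^bsub>C\<^esub>"] by (simp add: \<phi>_one HC.counit_one)
  qed
qed

text \<open>
  Coassociativity is an equation in \<open>C \<otimes> (C \<otimes> C)\<close>, so injectivity of \<open>\<phi> \<otimes> (\<phi> \<otimes> \<phi>)\<close> is what
  brings it back from \<open>D\<close>.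
\<close>

lemma hopf_algebra_preimage:
  assumes "hopf_algebra K D" and inj: "inj_on \<phi> (carrier C)"
  shows "hopf_algebra K C"
proof -
  interpret HD: hopf_algebra K D by fact
  have K: "field K" by unfold_locales
  note inj2 = tensor_map_inj[OF K mC mC mD mD \<phi>_lin inj \<phi>_lin inj]
  note inj3 = tensor_map_inj[OF K mC mCC mD mDD \<phi>_lin inj \<phi>\<phi>_lin inj2]
  note t = lin_closed[OF C_comult]
  show ?thesis
  proof (intro hopf_algebra.intro hopf_algebra_axioms.intro coalgebra.intro coalgebra_axioms.intro)
    show "assoc_algebra K C" "field K" "module K C" by unfold_locales
    show "comult C \<in> lin_maps K C (tensor K C C)" "counit C \<in> lin_maps K C (ground_space K)"
      "antipode C \<in> lin_maps K C C"
      by (rule C_comult C_counit C_antipode)+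
  next
    fix c assume c: "c \<in> carrier C"
    note d = \<phi>_closed[OF c]
    show "tensor_assoc K C C C (tensor_map K (tensor K C C) C (comult C) id (comult C c))
        = tensor_map K C (tensor K C C) id (comult C) (comult C c)"
    proof (rule inj_onD[OF inj3])
      show "tensor_map K D (tensor K D D) \<phi> (tensor_map K D D \<phi> \<phi>)
          (tensor_assoc K C C C (tensor_map K (tensor K C C) C (comult C) id (comult C c)))
        = tensor_map K D (tensor K D D) \<phi> (tensor_map K D D \<phi> \<phi>)
          (tensor_map K C (tensor K C C) id (comult C) (comult C c))"
        using HD.coassoc[OF d] by (simp add: coassoc_left_transport[OF c] coassoc_right_transport[OF c])
      show "tensor_assoc K C C C (tensor_map K (tensor K C C) C (comult C) id (comult C c)) \<in> carrier (tensor K C (tensor K C C))"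
        by (rule lin_closed[OF tensor_assoc_lin[OF mC mC mC]
              lin_closed[OF tensor_map_lin[OF mC mC mCC mC C_comult ids(1)] t[OF c]]])
      show "tensor_map K C (tensor K C C) id (comult C) (comult C c) \<in> carrier (tensor K C (tensor K C C))"
        by (rule lin_closed[OF tensor_map_lin[OF mC mC mC mCC ids(1) C_comult] t[OF c]])
    qed
    note cl = tensor_lift_closed[OF mC mC mC _ t[OF c]]
    note e = lin_closed[OF C_counit c, unfolded ground_space_simps]
    show "tensor_lift K C (\<lambda>x y. counit C x \<odot>\<^bsub>C\<^esub> y) (comult C c) = c"
      by (rule inj_onD[OF inj _ cl[OF bilin_counits(1)] c])
        (use HD.counit_left[OF d] counit_left_transport[OF c] in simp)
    show "tensor_lift K C (\<lambda>x y. counit C y \<odot>\<^bsub>C\<^esub> x) (comult C c) = c"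
      by (rule inj_onD[OF inj _ cl[OF bilin_counits(2)] c])
        (use HD.counit_right[OF d] counit_right_transport[OF c] in simp)
    show "tensor_lift K C (\<lambda>y z. antipode C y \<otimes>\<^bsub>C\<^esub> z) (comult C c) = counit C c \<odot>\<^bsub>C\<^esub> \<one>\<^bsub>C\<^esub>"
      by (rule inj_onD[OF inj _ cl[OF bilin_antipodes(1)]])
        (use HD.antipode_left[OF d] antipode_left_transport[OF c] e in
          \<open>simp_all add: lin_smult[OF \<phi>_lin] \<phi>_one \<phi>_counit[OF c]\<close>)
    show "tensor_lift K C (\<lambda>y z. y \<otimes>\<^bsub>C\<^esub> antipode C z) (comult C c) = counit C c \<odot>\<^bsub>C\<^esub> \<one>\<^bsub>C\<^esub>"
      by (rule inj_onD[OF inj _ cl[OF bilin_antipodes(2)]])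
        (use HD.antipode_right[OF d] antipode_right_transport[OF c] e in
          \<open>simp_all add: lin_smult[OF \<phi>_lin] \<phi>_one \<phi>_counit[OF c]\<close>)
  next
    fix x y assume xy: "x \<in> carrier C" "y \<in> carrier C"
    show "comult C (x \<otimes>\<^bsub>C\<^esub> y) = tensor_mult K C (comult C x) (comult C y)"
    proof (rule inj_onD[OF inj2])
      show "tensor_map K D D \<phi> \<phi> (comult C (x \<otimes>\<^bsub>C\<^esub> y)) = tensor_map K D D \<phi> \<phi> (tensor_mult K C (comult C x) (comult C y))"
        using xy HD.comult_mult[of "\<phi> x" "\<phi> y"]
        by (simp add: tensor_mult_transport[symmetric] t \<phi>_comult[symmetric] \<phi>_mult \<phi>_closed)
      show "tensor_mult K C (comult C x) (comult C y) \<in> carrier (tensor K C C)"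
        unfolding tensor_mult_def
        by (rule tensor_lift_closed[OF mC mC mCC C.tensor_mult_bilin[OF mCC t[OF xy(2)] pure_tensor_bilin[OF mC mC]] t[OF xy(1)]])
    qed (use xy t in auto)
    show "counit C (x \<otimes>\<^bsub>C\<^esub> y) = counit C x \<otimes>\<^bsub>K\<^esub> counit C y"
      using xy HD.counit_mult[of "\<phi> x" "\<phi> y"] by (simp add: \<phi>_mult[symmetric] \<phi>_counit \<phi>_closed)
  next
    show "comult C \<one>\<^bsub>C\<^esub> = pure_tensor K C C \<one>\<^bsub>C\<^esub> \<one>\<^bsub>C\<^esub>"
      by (rule inj_onD[OF inj2])
        (use HD.comult_one in \<open>simp_all add: \<phi>_comult[symmetric] \<phi>_one tensor_map_pure[OF mC mC mD mD \<phi>_lin \<phi>_lin]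
          pure_tensor_closed[OF mC mC] t\<close>)
    show "counit C \<one>\<^bsub>C\<^esub> = \<one>\<^bsub>K\<^esub>"
      using HD.counit_one \<phi>_counit[of "\<one>\<^bsub>C\<^esub>"] by (simp add: \<phi>_one)
  qed
qed

end

section \<open>The quotient by a right normal right coideal subalgebra\<close>

lemma ground_space_zero: "\<zero>\<^bsub>ground_space K\<^esub> = \<zero>\<^bsub>K\<^esub>"
  by (simp add: ground_space_def)

lemma tensor_lift_mem_submodule:
  assumes M: "module K M" and N: "module K N" and P: "module K P" and V: "submodule V K P"
    and \<beta>: "bilin K M N P \<beta>" and t: "t \<in> carrier (tensor K M N)"
    and mem: "\<And>x y. x \<in> carrier M \<Longrightarrow> y \<in> carrier N \<Longrightarrow> \<beta> x y \<in> V"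
  shows "tensor_lift K P \<beta> t \<in> V"
proof -
  have "t \<in> {t \<in> carrier (tensor K M N). tensor_lift K P \<beta> t \<in> V}"
    by (rule tensor_submodule_eqI[OF M N submodule_preimage[OF module_tensor[OF M N] P tensor_lift_lin[OF M N P \<beta>] V] _ t])
      (simp add: pure_tensor_closed[OF M N] tensor_lift_pure[OF M N P \<beta>] mem)
  then show ?thesis by simp
qed

lemma (in hopf_algebra) sw_mem:
  assumes "module K P" "submodule V K P" "bilin K H H P \<beta>" "h \<in> carrier H"
    and "\<And>x y. x \<in> carrier H \<Longrightarrow> y \<in> carrier H \<Longrightarrow> \<beta> x y \<in> V"
  shows "sw P \<beta> h \<in> V"
  using assms by (intro tensor_lift_mem_submodule[OF module_H module_H]) auto

locale normal_coideal = hopf_algebra K H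
  for K :: "('k, 'z) ring_scheme" and H :: "('k, 'h, 'a) hopf_scheme" +
  fixes X :: "'h set"
  assumes coideal: "right_coideal_subalgebra K H X" and normal: "right_normal K H X"
begin

lemma X_submodule: "submodule X K H" and X_subring: "subring X H"
  and X_comult: "b \<in> X \<Longrightarrow> comult H b \<in> tensor_sub K H H X (carrier H)"
  using coideal by (auto simp: right_coideal_subalgebra_def subalg_def)

lemma X_closed: "b \<in> X \<Longrightarrow> b \<in> carrier H"
  using submodule_memD(1)[OF X_submodule] .

lemma X_one: "\<one>\<^bsub>H\<^esub> \<in> X"
  using subringE(3)[OF X_subring] .

lemma H_submodule: "submodule (carrier H) K H"
  by (rule carrier_is_submodule)

text \<open>
  For \<open>b \<in> X\<close> the first Sweedler factor may be taken in \<open>X\<close>.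
\<close>

lemma sw_coideal:
  assumes "module K P" "bilin K H H P \<beta>" "bilin K H H P \<gamma>" "b \<in> X"
    and "\<And>x y. x \<in> X \<Longrightarrow> y \<in> carrier H \<Longrightarrow> \<beta> x y = \<gamma> x y"
  shows "sw P \<beta> b = sw P \<gamma> b"
  by (rule tensor_sub_lift_cong[OF module_H module_H X_submodule H_submodule assms(1-3) _ X_comult[OF assms(4)]])
    (rule assms(5))

abbreviation I where "I \<equiv> aug_ideal K H X"

lemma augD: "b \<in> augmentation K H X \<Longrightarrow> b \<in> X" "b \<in> augmentation K H X \<Longrightarrow> counit H b = \<zero>\<^bsub>K\<^esub>"
  "b \<in> augmentation K H X \<Longrightarrow> b \<in> carrier H"
  by (auto simp: augmentation_def X_closed)

lemma counit_zero: "counit H \<zero>\<^bsub>H\<^esub> = \<zero>\<^bsub>K\<^esub>"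
  using lin_zero[OF module_H module_K counit_linear] by (simp add: ground_space_zero)

lemma zero_aug: "\<zero>\<^bsub>H\<^esub> \<in> augmentation K H X"
  by (simp add: augmentation_def submodule_memD(2)[OF X_submodule] counit_zero)

lemma I_gen: "h \<in> carrier H \<Longrightarrow> b \<in> augmentation K H X \<Longrightarrow> h \<otimes>\<^bsub>H\<^esub> b \<in> I"
  unfolding aug_ideal_def by (rule ideal_prod.prod)

lemma I_closed: "x \<in> I \<Longrightarrow> x \<in> carrier H"
  unfolding aug_ideal_def by (induction rule: ideal_prod.induct) (auto simp: augD)

lemma I_submodule: "submodule I K H"
proof (rule submodule_by_closure[OF module_H])
  show "I \<subseteq> carrier H" using I_closed by auto
  show "\<zero>\<^bsub>H\<^esub> \<in> I" using I_gen[OF module_zero_closed[OF module_H] zero_aug] by simp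
  show "x \<oplus>\<^bsub>H\<^esub> y \<in> I" if "x \<in> I" "y \<in> I" for x y
    using that unfolding aug_ideal_def by (rule ideal_prod.sum)
  show "a \<odot>\<^bsub>H\<^esub> x \<in> I" if a: "a \<in> carrier K" and "x \<in> I" for a x
    using that(2) unfolding aug_ideal_def
  proof (induction rule: ideal_prod.induct)
    case (prod h b)
    then show ?case using a ideal_prod.prod[of "a \<odot>\<^bsub>H\<^esub> h" "carrier H" b "augmentation K H X" H] by (simp add: smult_mult_left augD)
  next
    case (sum x y)
    then have "x \<in> carrier H" "y \<in> carrier H" using I_closed unfolding aug_ideal_def by auto
    then show ?case using sum a by (simp add: smult_r_distr ideal_prod.sum)
  qed
qed

lemma I_least:
  assumes "submodule V K H" "\<And>h b. h \<in> carrier H \<Longrightarrow> b \<in> augmentation K H X \<Longrightarrow> h \<otimes>\<^bsub>H\<^esub> b \<in> V" "x \<in> I"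
  shows "x \<in> V"
  using assms(3) unfolding aug_ideal_def
  by (induction rule: ideal_prod.induct) (auto simp: assms(2) submodule_memD(3)[OF assms(1)])

lemma I_kernel:
  assumes "module K P" "f \<in> lin_maps K H P"
    and "\<And>h b. h \<in> carrier H \<Longrightarrow> b \<in> augmentation K H X \<Longrightarrow> f (h \<otimes>\<^bsub>H\<^esub> b) = \<zero>\<^bsub>P\<^esub>" and "x \<in> I"
  shows "f x = \<zero>\<^bsub>P\<^esub>"
proof -
  have "x \<in> {x \<in> carrier H. f x \<in> {\<zero>\<^bsub>P\<^esub>}}"
    by (rule I_least[OF submodule_preimage[OF module_H assms(1,2) submodule_zero[OF assms(1)]] _ assms(4)])
      (use assms(3) in \<open>auto simp: augD\<close>)
  then show ?thesis by simp
qed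

text \<open>
  So every \<open>b \<in> X\<close> equals the scalar \<open>\<epsilon>(b)\<close> modulo \<open>X\<^sup>+\<close>.
\<close>

lemma sub_counit_mem:
  assumes "b \<in> X"
  shows "b \<ominus>\<^bsub>H\<^esub> counit H b \<odot>\<^bsub>H\<^esub> \<one>\<^bsub>H\<^esub> \<in> augmentation K H X"
proof -
  have e: "counit H b \<in> carrier K" using assms X_closed by simp
  have "counit H (b \<ominus>\<^bsub>H\<^esub> counit H b \<odot>\<^bsub>H\<^esub> \<one>\<^bsub>H\<^esub>)
      = counit H b \<ominus>\<^bsub>ground_space K\<^esub> counit H (counit H b \<odot>\<^bsub>H\<^esub> \<one>\<^bsub>H\<^esub>)"
    by (rule lin_minus[OF module_H module_K counit_linear]) (use assms X_closed e in auto)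
  also have "counit H (counit H b \<odot>\<^bsub>H\<^esub> \<one>\<^bsub>H\<^esub>) = counit H b"
    using e lin_smult[OF counit_linear, of "counit H b" "\<one>\<^bsub>H\<^esub>"] by (simp add: ground_space_simps counit_one)
  also have "counit H b \<ominus>\<^bsub>ground_space K\<^esub> counit H b = \<zero>\<^bsub>K\<^esub>"
    using module_eq_iff_minus[OF module_K, of "counit H b" "counit H b"] e by (simp add: ground_space_zero ground_space_simps)
  finally show ?thesis
    using assms e X_one submodule_memD(4,6)[OF X_submodule] by (simp add: augmentation_def)
qed

lemma I_left: "h \<in> carrier H \<Longrightarrow> x \<in> I \<Longrightarrow> h \<otimes>\<^bsub>H\<^esub> x \<in> I"
proof -
  assume h: "h \<in> carrier H" and x: "x \<in> I"
  have "x \<in> {x \<in> carrier H. h \<otimes>\<^bsub>H\<^esub> x \<in> I}"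
    by (rule I_least[OF submodule_preimage[OF module_H module_H lin_mult_left[OF h lin_id] I_submodule] _ x])
      (use h I_gen in \<open>auto simp: augD H.m_assoc[symmetric]\<close>)
  then show ?thesis by simp
qed

text \<open>
  The identity \<open>b g = g\<^sub>1 (S(g\<^sub>2) b g\<^sub>3)\<close> holds because \<open>g\<^sub>1 S(g\<^sub>2)\<close> contracts to \<open>\<epsilon>(g\<^sub>1)\<close>. The bracket
  belongs to \<open>X\<close> by right normality and has counit \<open>\<epsilon>(g\<^sub>2) \<epsilon>(b) \<epsilon>(g\<^sub>3) = 0\<close>.
\<close>

lemma aug_mult_mem:
  assumes b: "b \<in> augmentation K H X" and g: "g \<in> carrier H"
  shows "b \<otimes>\<^bsub>H\<^esub> g \<in> I"
proof -
  note bH = augD(3)[OF b]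
  let ?S = "antipode H" and ?e = "counit H"
  (* summand of x (S(u) b v), to be summed over the three Sweedler factors x, u, v of g *)
  let ?\<tau> = "\<lambda>x u v. x \<otimes>\<^bsub>H\<^esub> (?S u \<otimes>\<^bsub>H\<^esub> b \<otimes>\<^bsub>H\<^esub> v)"
  have "b \<otimes>\<^bsub>H\<^esub> g = sw H (\<lambda>z v. ?e z \<odot>\<^bsub>H\<^esub> (b \<otimes>\<^bsub>H\<^esub> v)) g"
    by (rule sw_counit_left[symmetric]) (use bH g in \<open>auto intro!: lin_rules\<close>)
  also have "\<dots> = sw H (\<lambda>z v. sw H (\<lambda>x u. ?\<tau> x u v) z) g"
  proof (rule sw_cong)
    fix z v assume zv: "z \<in> carrier H" "v \<in> carrier H"
    let ?f = "\<lambda>w. w \<otimes>\<^bsub>H\<^esub> (b \<otimes>\<^bsub>H\<^esub> v)"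
    have "sw H (\<lambda>x u. ?f (x \<otimes>\<^bsub>H\<^esub> ?S u)) z = ?e z \<odot>\<^bsub>H\<^esub> ?f \<one>\<^bsub>H\<^esub>"
      by (rule sw_antipode_right) (use bH zv in \<open>auto intro!: lin_rules\<close>)
    moreover have "sw H (\<lambda>x u. ?f (x \<otimes>\<^bsub>H\<^esub> ?S u)) z = sw H (\<lambda>x u. ?\<tau> x u v) z"
      by (rule sw_cong) (use bH zv in \<open>auto intro!: lin_rules simp: H.m_assoc\<close>)
    ultimately show "?e z \<odot>\<^bsub>H\<^esub> (b \<otimes>\<^bsub>H\<^esub> v) = sw H (\<lambda>x u. ?\<tau> x u v) z" using bH zv by simp
  qed (use bH g in \<open>auto intro!: lin_rules\<close>)
  also have "\<dots> = sw H (\<lambda>x w. sw H (\<lambda>u v. ?\<tau> x u v) w) g"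
    by (rule sw_coassoc) (use bH g in \<open>auto intro!: lin_rules\<close>)
  also have "\<dots> \<in> I"
  proof (rule sw_mem[OF module_H I_submodule])
    fix x w assume xw: "x \<in> carrier H" "w \<in> carrier H"
    let ?q = "sw H (\<lambda>u v. ?S u \<otimes>\<^bsub>H\<^esub> b \<otimes>\<^bsub>H\<^esub> v) w"
    have "?q \<in> X" using normal augD(1)[OF b] xw unfolding right_normal_def by auto
    moreover have "?e ?q = \<zero>\<^bsub>K\<^esub>"
    proof -
      have "?e ?q = sw (ground_space K) (\<lambda>u v. ?e (?S u \<otimes>\<^bsub>H\<^esub> b \<otimes>\<^bsub>H\<^esub> v)) w"
        by (rule lin_sw[OF module_H module_K _ counit_linear]) (use bH xw in \<open>auto intro!: lin_rules\<close>)
      also have "\<dots> \<in> {\<zero>\<^bsub>ground_space K\<^esub>}"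
        by (rule sw_mem[OF module_K submodule_zero[OF module_K]])
          (use bH xw augD(2)[OF b] in \<open>auto intro!: lin_rules simp: counit_mult ground_space_zero\<close>)
      finally show ?thesis by (simp add: ground_space_zero)
    qed
    ultimately have "x \<otimes>\<^bsub>H\<^esub> ?q \<in> I" using xw by (intro I_gen) (auto simp: augmentation_def)
    also have "x \<otimes>\<^bsub>H\<^esub> ?q = sw H (\<lambda>u v. ?\<tau> x u v) w"
      by (rule lin_sw[OF module_H module_H]) (use bH xw in \<open>auto intro!: lin_rules\<close>)
    finally show "sw H (\<lambda>u v. ?\<tau> x u v) w \<in> I" .
  qed (use bH g in \<open>auto intro!: lin_rules\<close>)
  finally show ?thesis .
qed

lemma I_right: "h \<in> carrier H \<Longrightarrow> x \<in> I \<Longrightarrow> x \<otimes>\<^bsub>H\<^esub> h \<in> I"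
proof -
  assume h: "h \<in> carrier H" and x: "x \<in> I"
  have "x \<in> {x \<in> carrier H. x \<otimes>\<^bsub>H\<^esub> h \<in> I}"
    by (rule I_least[OF submodule_preimage[OF module_H module_H lin_mult_right[OF h lin_id] I_submodule] _ x])
      (use h in \<open>auto simp: augD H.m_assoc I_left aug_mult_mem\<close>)
  then show ?thesis by simp
qed

lemma I_ideal: "ideal I H"
  by (rule idealI) (use I_submodule I_left I_right in \<open>auto simp: submodule_def H.ring_axioms\<close>)

lemma I_counit: "x \<in> I \<Longrightarrow> counit H x = \<zero>\<^bsub>K\<^esub>"
  using I_kernel[OF module_K counit_linear, of x] by (simp add: counit_mult augD ground_space_zero)

abbreviation Q where "Q \<equiv> quot_hopf K H X"
abbreviation \<pi> where "\<pi> \<equiv> quot_map K H X"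

lemma quot_hopf_simps:
  "carrier Q = carrier (quot_space H I)" "mult Q = mult (quot_space H I)" "\<one>\<^bsub>Q\<^esub> = \<one>\<^bsub>quot_space H I\<^esub>"
  "\<zero>\<^bsub>Q\<^esub> = \<zero>\<^bsub>quot_space H I\<^esub>" "add Q = add (quot_space H I)" "smult Q = smult (quot_space H I)"
  by (simp_all add: quot_hopf_def Let_def)

lemma quot_hopf_carrier: "carrier Q = \<pi> ` carrier H"
  by (simp add: quot_hopf_simps quot_space_carrier quot_map_def[abs_def])

lemma module_quot: "module K Q"
  by (rule module_cong[OF module_quot_space[OF module_H I_submodule]]) (simp_all add: quot_hopf_simps)

lemma ring_quot: "ring Q"
  by (rule ring_cong[OF ideal.quotient_is_ring[OF I_ideal]]) (simp_all add: quot_hopf_simps quot_space_def)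

lemma quot_map_lin: "\<pi> \<in> lin_maps K H Q"
  using coset_lin[OF module_H I_submodule] lin_maps_cong[of H H Q "quot_space H I" K]
  by (simp add: quot_hopf_simps quot_map_def[abs_def])

lemma quot_map_ring_hom: "\<pi> \<in> ring_hom H Q"
  using ideal.rcos_ring_hom[OF I_ideal]
  by (simp add: ring_hom_def quot_hopf_simps quot_space_def quot_map_def[abs_def])

lemma quot_map_zero_iff: "x \<in> carrier H \<Longrightarrow> \<pi> x = \<zero>\<^bsub>Q\<^esub> \<longleftrightarrow> x \<in> I"
  by (simp add: quot_map_def quot_hopf_simps quot_space_zero coset_zero_iff[OF module_H I_submodule])

lemma quot_map_eq_iff: "x \<in> carrier H \<Longrightarrow> y \<in> carrier H \<Longrightarrow> \<pi> x = \<pi> y \<longleftrightarrow> x \<ominus>\<^bsub>H\<^esub> y \<in> I"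
  by (simp add: quot_map_def coset_eq_iff[OF module_H I_submodule])

lemma quot_map_closed: "x \<in> carrier H \<Longrightarrow> \<pi> x \<in> carrier Q"
  by (rule lin_closed[OF quot_map_lin])

lemma quot_map_mult: "x \<in> carrier H \<Longrightarrow> y \<in> carrier H \<Longrightarrow> \<pi> (x \<otimes>\<^bsub>H\<^esub> y) = \<pi> x \<otimes>\<^bsub>Q\<^esub> \<pi> y"
  using quot_map_ring_hom by (simp add: ring_hom_mult)

lemma quot_algebra: "assoc_algebra K Q"
proof (rule assoc_algebraI[OF _ module_quot ring_quot])
  show "field K" by unfold_locales
  fix a x y assume a: "a \<in> carrier K" and "x \<in> carrier Q" "y \<in> carrier Q"
  then obtain g h where *: "x = \<pi> g" "g \<in> carrier H" "y = \<pi> h" "h \<in> carrier H"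
    by (auto simp: quot_hopf_carrier)
  show "a \<odot>\<^bsub>Q\<^esub> x \<otimes>\<^bsub>Q\<^esub> y = a \<odot>\<^bsub>Q\<^esub> (x \<otimes>\<^bsub>Q\<^esub> y)" "x \<otimes>\<^bsub>Q\<^esub> (a \<odot>\<^bsub>Q\<^esub> y) = a \<odot>\<^bsub>Q\<^esub> (x \<otimes>\<^bsub>Q\<^esub> y)"
    unfolding * using a *(2,4)
    by (simp_all add: lin_smult[OF quot_map_lin, symmetric] quot_map_mult[symmetric] smult_mult_left smult_mult_right)
qed

lemma quot_map_augmented:
  assumes "b \<in> X" "f \<in> lin_maps K H H" "\<And>z. z \<in> augmentation K H X \<Longrightarrow> f z \<in> I"
  shows "\<pi> (f b) = counit H b \<odot>\<^bsub>Q\<^esub> \<pi> (f \<one>\<^bsub>H\<^esub>)"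
proof -
  have e: "counit H b \<in> carrier K" "b \<in> carrier H" using X_closed[OF assms(1)] by auto
  have "\<pi> (f b) = \<pi> (counit H b \<odot>\<^bsub>H\<^esub> f \<one>\<^bsub>H\<^esub>)"
    using assms(3)[OF sub_counit_mem[OF assms(1)]] e lin_closed[OF assms(2)]
    by (simp add: quot_map_eq_iff lin_minus[OF module_H module_H assms(2)] lin_smult[OF assms(2)])
  then show ?thesis using e lin_closed[OF assms(2)] by (simp add: lin_smult[OF quot_map_lin])
qed

text \<open>
  Apply \<open>\<pi>\<close> to \<open>b\<^sub>1 S(b\<^sub>2) = \<epsilon>(b) 1 = 0\<close>. Since \<open>b\<^sub>1 \<in> X\<close> acts as the scalar \<open>\<epsilon>(b\<^sub>1)\<close> modulo the ideal, the
  left side becomes \<open>\<pi>(S(b))\<close>. Here it matters that the ideal is also a right ideal.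
\<close>

lemma antipode_aug:
  assumes b: "b \<in> augmentation K H X"
  shows "antipode H b \<in> I"
proof -
  let ?S = "antipode H" and ?e = "counit H"
  note bH = augD(3)[OF b]
  have "sw Q (\<lambda>x y. \<pi> (x \<otimes>\<^bsub>H\<^esub> ?S y)) b = ?e b \<odot>\<^bsub>Q\<^esub> \<pi> \<one>\<^bsub>H\<^esub>"
    by (rule sw_antipode_right[OF module_quot quot_map_lin bH])
  also have "\<dots> = \<zero>\<^bsub>Q\<^esub>"
    using augD(2)[OF b] module.smult_l_null[OF module_quot] quot_map_closed by simp
  also have "sw Q (\<lambda>x y. \<pi> (x \<otimes>\<^bsub>H\<^esub> ?S y)) b = sw Q (\<lambda>x y. ?e x \<odot>\<^bsub>Q\<^esub> \<pi> (?S y)) b"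
  proof (rule sw_coideal[OF module_quot _ _ augD(1)[OF b]])
    show "\<pi> (x \<otimes>\<^bsub>H\<^esub> ?S y) = ?e x \<odot>\<^bsub>Q\<^esub> \<pi> (?S y)" if "x \<in> X" "y \<in> carrier H" for x y
      using quot_map_augmented[OF that(1), of "\<lambda>x. x \<otimes>\<^bsub>H\<^esub> ?S y"] that by (simp add: lin_mult_right lin_id aug_mult_mem)
  qed (auto intro!: lin_rules lin_comp[OF quot_map_lin] simp: module_quot quot_map_closed)
  also have "\<dots> = \<pi> (?S b)"
    by (rule sw_counit_left[OF module_quot _ bH]) (auto intro!: lin_rules lin_comp[OF quot_map_lin])
  finally show ?thesis using bH by (simp add: quot_map_zero_iff)
qed

lemma I_antipode: "x \<in> I \<Longrightarrow> antipode H x \<in> I"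
proof -
  assume x: "x \<in> I"
  have "x \<in> {x \<in> carrier H. antipode H x \<in> I}"
    by (rule I_least[OF submodule_preimage[OF module_H module_H antipode_linear I_submodule] _ x])
      (auto simp: augD antipode_mult I_right antipode_aug)
  then show ?thesis by simp
qed

lemma quot_comult_lin: "(\<lambda>h. tensor_map K Q Q \<pi> \<pi> (comult H h)) \<in> lin_maps K H (tensor K Q Q)"
  by (rule lin_comp[OF tensor_map_lin[OF module_H module_H module_quot module_quot quot_map_lin quot_map_lin] comult_linear])

text \<open>
  For \<open>x = h b\<close> the value is the sum of \<open>\<pi>(h\<^sub>1 b\<^sub>1) \<otimes> \<pi>(h\<^sub>2 b\<^sub>2)\<close>, and replacing \<open>b\<^sub>1 \<in> X\<close> by its counit turns it
  into \<open>\<pi>(h\<^sub>1) \<otimes> \<pi>(h\<^sub>2 b) = 0\<close>.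
\<close>

lemma I_comult:
  assumes "x \<in> I"
  shows "tensor_map K Q Q \<pi> \<pi> (comult H x) = \<zero>\<^bsub>tensor K Q Q\<^esub>"
proof -
  let ?T = "tensor K Q Q"
  note mT = module_tensor[OF module_quot module_quot]
  note pb = pure_tensor_bilin[OF module_quot module_quot]
  note pl = lin_bilin_left[OF pb lin_comp[OF quot_map_lin]] lin_bilin_right[OF pb _ lin_comp[OF quot_map_lin]]
  note \<beta> = tensor_map_bilin[OF module_quot module_quot quot_map_lin quot_map_lin]
  show ?thesis
  proof (rule I_kernel[OF mT quot_comult_lin _ assms])
    fix h b assume h: "h \<in> carrier H" and b: "b \<in> augmentation K H X"
    note bH = augD(3)[OF b]
    have inner: "sw ?T (\<lambda>c d. pure_tensor K Q Q (\<pi> (u \<otimes>\<^bsub>H\<^esub> c)) (\<pi> (v \<otimes>\<^bsub>H\<^esub> d))) b = \<zero>\<^bsub>?T\<^esub>"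
      if uv: "u \<in> carrier H" "v \<in> carrier H" for u v
    proof -
      have "sw ?T (\<lambda>c d. pure_tensor K Q Q (\<pi> (u \<otimes>\<^bsub>H\<^esub> c)) (\<pi> (v \<otimes>\<^bsub>H\<^esub> d))) b
        = sw ?T (\<lambda>c d. counit H c \<odot>\<^bsub>?T\<^esub> pure_tensor K Q Q (\<pi> u) (\<pi> (v \<otimes>\<^bsub>H\<^esub> d))) b"
      proof (rule sw_coideal[OF mT _ _ augD(1)[OF b]])
        fix c d assume cd: "c \<in> X" "d \<in> carrier H"
        have "\<pi> (u \<otimes>\<^bsub>H\<^esub> c) = counit H c \<odot>\<^bsub>Q\<^esub> \<pi> u"
          using quot_map_augmented[OF cd(1), of "\<lambda>c. u \<otimes>\<^bsub>H\<^esub> c"] uv by (simp add: lin_mult_left lin_id I_gen)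
        then show "pure_tensor K Q Q (\<pi> (u \<otimes>\<^bsub>H\<^esub> c)) (\<pi> (v \<otimes>\<^bsub>H\<^esub> d))
            = counit H c \<odot>\<^bsub>?T\<^esub> pure_tensor K Q Q (\<pi> u) (\<pi> (v \<otimes>\<^bsub>H\<^esub> d))"
          using uv cd X_closed lin_smult[OF bilin_left[OF pb]] by (simp add: quot_map_closed)
      qed (use uv in \<open>auto intro!: lin_rules pl lin_bilin_right[OF pb] lin_comp[OF quot_map_lin] mT simp: quot_map_closed bilin_closed[OF pb]\<close>)
      also have "\<dots> = pure_tensor K Q Q (\<pi> u) (\<pi> (v \<otimes>\<^bsub>H\<^esub> b))"
        by (rule sw_counit_left[OF mT _ bH])
          (use uv in \<open>auto intro!: lin_rules lin_bilin_right[OF pb] lin_comp[OF quot_map_lin] simp: quot_map_closed\<close>)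
      also have "\<pi> (v \<otimes>\<^bsub>H\<^esub> b) = \<zero>\<^bsub>Q\<^esub>"
        using I_gen[OF uv(2) b] bH uv by (simp add: quot_map_zero_iff)
      also have "pure_tensor K Q Q (\<pi> u) \<zero>\<^bsub>Q\<^esub> = \<zero>\<^bsub>?T\<^esub>"
        by (rule lin_zero[OF module_quot mT bilin_right[OF pb]]) (simp add: uv quot_map_closed)
      finally show ?thesis .
    qed
    have "tensor_map K Q Q \<pi> \<pi> (comult H (h \<otimes>\<^bsub>H\<^esub> b))
      = sw ?T (\<lambda>u v. sw ?T (\<lambda>c d. pure_tensor K Q Q (\<pi> (u \<otimes>\<^bsub>H\<^esub> c)) (\<pi> (v \<otimes>\<^bsub>H\<^esub> d))) b) h"
      unfolding tensor_map_def by (rule sw_mult[OF mT h bH \<beta>])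
    also have "\<dots> \<in> {\<zero>\<^bsub>?T\<^esub>}"
      by (rule sw_mem[OF mT submodule_zero[OF mT] tensor_mult_bilin[OF mT comult_closed[OF bH] \<beta>] h])
        (simp add: inner)
    finally show "tensor_map K Q Q \<pi> \<pi> (comult H (h \<otimes>\<^bsub>H\<^esub> b)) = \<zero>\<^bsub>?T\<^esub>" by simp
  qed
qed

lemma lin_maps_quot: "lin_maps K (quot_space H I) P = lin_maps K Q P"
  by (rule lin_maps_cong) (simp_all add: quot_hopf_simps)

lemma quot_lift:
  assumes "module K P" "f \<in> lin_maps K H P" "\<And>x. x \<in> I \<Longrightarrow> f x = \<zero>\<^bsub>P\<^esub>"
  shows quot_lift_lin: "coset_lift f \<in> lin_maps K Q P"
    and quot_lift_value: "h \<in> carrier H \<Longrightarrow> coset_lift f (\<pi> h) = f h"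
  using lin_coset_lift[OF module_H I_submodule assms] lin_maps_quot[of P] by (simp_all add: quot_map_def)

lemma quot_hopf_structure:
  "comult Q = coset_lift (\<lambda>h. tensor_map K Q Q \<pi> \<pi> (comult H h))"
  "counit Q = coset_lift (counit H)"
  "antipode Q = coset_lift (\<lambda>h. \<pi> (antipode H h))"
proof -
  have "tensor_map K Q Q \<pi> \<pi> = tensor_map K (quot_space H I) (quot_space H I) \<pi> \<pi>"
    by (rule tensor_map_structure_cong) (simp_all add: quot_hopf_simps)
  then show "comult Q = coset_lift (\<lambda>h. tensor_map K Q Q \<pi> \<pi> (comult H h))"
    by (simp add: quot_hopf_def Let_def)
qed (simp_all add: quot_hopf_def Let_def)

sublocale quot: structure_map K H Q \<pi>
proof (intro structure_map.intro structure_map_axioms.intro)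
  note mT = module_tensor[OF module_quot module_quot]
  note c = quot_lift[OF mT quot_comult_lin I_comult]
  note e = quot_lift[OF module_K counit_linear]
  note s = quot_lift[OF module_quot lin_comp[OF quot_map_lin antipode_linear]]
  have e0: "counit H x = \<zero>\<^bsub>ground_space K\<^esub>" if "x \<in> I" for x
    using I_counit[OF that] by (simp add: ground_space_zero)
  have s0: "\<pi> (antipode H x) = \<zero>\<^bsub>Q\<^esub>" if "x \<in> I" for x
    using I_antipode[OF that] I_closed[OF that] by (simp add: quot_map_zero_iff)
  show "assoc_algebra K H" by unfold_locales
  show "assoc_algebra K Q" by (rule quot_algebra)
  show "comult Q \<in> lin_maps K Q (tensor K Q Q)" "counit Q \<in> lin_maps K Q (ground_space K)"
    "antipode Q \<in> lin_maps K Q Q"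
    unfolding quot_hopf_structure by (rule c e s; simp add: e0 s0)+
  show "comult Q (\<pi> h) = tensor_map K Q Q \<pi> \<pi> (comult H h)" "counit Q (\<pi> h) = counit H h"
    "antipode Q (\<pi> h) = \<pi> (antipode H h)" if "h \<in> carrier H" for h
    unfolding quot_hopf_structure using that by (simp_all add: c e s e0 s0)
qed (rule quot_map_lin quot_map_ring_hom comult_linear counit_linear antipode_linear)+

lemma hopf_algebra_quot: "hopf_algebra K Q"
  by (rule quot.hopf_algebra_image) (simp_all add: hopf_algebra_axioms quot_hopf_carrier)

end

section \<open>Hopf subalgebras\<close>

locale hopf_sub = hopf_algebra K H
  for K :: "('k, 'z) ring_scheme" and H :: "('k, 'h) hopf" +
  fixes A :: "'h set"
  assumes hopf_sub: "hopf_subalgebra K H A"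
begin

abbreviation SA where "SA \<equiv> sub_hopf K H A"

lemma A_subalg: "subalg K H A" and A_submodule: "submodule A K H" and A_subring: "subring A H"
  and A_comult: "a \<in> A \<Longrightarrow> comult H a \<in> tensor_sub K H H A A"
  and A_antipode: "a \<in> A \<Longrightarrow> antipode H a \<in> A"
  using hopf_sub by (auto simp: hopf_subalgebra_def subalg_def)

lemma A_closed: "a \<in> A \<Longrightarrow> a \<in> carrier H"
  using submodule_memD(1)[OF A_submodule] .

lemma sub_hopf_simps:
  "carrier SA = A" "add SA = add H" "\<zero>\<^bsub>SA\<^esub> = \<zero>\<^bsub>H\<^esub>" "mult SA = mult H" "\<one>\<^bsub>SA\<^esub> = \<one>\<^bsub>H\<^esub>" "smult SA = smult H"
  "counit SA = counit H" "antipode SA = antipode H"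
  by (simp_all add: sub_hopf_def)

lemma sub_algebra: "assoc_algebra K SA"
  by (rule subalg_assoc_algebra[OF A_subalg]) (simp_all add: sub_hopf_simps)

lemma module_sub: "module K SA"
  using sub_algebra by (simp add: assoc_algebra_def)

text \<open>
  The comultiplication of \<^const>\<open>sub_hopf\<close> is defined through the tensor square of a record that still
  carries the comultiplication of \<open>H\<close>; the two tensor squares coincide.
\<close>

lemma tensor_SA: "tensor K SA SA = tensor K (H\<lparr>carrier := A\<rparr>) (H\<lparr>carrier := A\<rparr>)"
  by (rule tensor_cong) (simp_all add: sub_hopf_simps)

lemma inclusion: "id \<in> lin_maps K SA H"
  by (rule lin_mapsI) (simp_all add: sub_hopf_simps A_closed)

lemma tensor_sub_eq_image: "tensor_sub K H H A A = tensor_map K H H id id ` carrier (tensor K SA SA)"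
  by (simp add: tensor_sub_def tensor_SA)

lemma inclusion_inj2: "inj_on (tensor_map K H H id id) (carrier (tensor K SA SA))"
proof (rule tensor_map_inj[OF _ module_sub module_sub module_H module_H inclusion _ inclusion])
  show "field K" by unfold_locales
qed simp_all

lemma comult_SA: "comult SA a = inv_into (carrier (tensor K SA SA)) (tensor_map K H H id id) (comult H a)"
  unfolding tensor_SA by (simp add: sub_hopf_def)

lemma sub_comult_closed: "a \<in> A \<Longrightarrow> comult SA a \<in> carrier (tensor K SA SA)"
  and sub_comult: "a \<in> A \<Longrightarrow> tensor_map K H H id id (comult SA a) = comult H a"
  using A_comult[of a] unfolding comult_SA tensor_sub_eq_image by (simp_all add: inv_into_into f_inv_into_f)

sublocale sub: structure_map K SA H id
proof (intro structure_map.intro structure_map_axioms.intro)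
  show "assoc_algebra K H" by unfold_locales
  show "assoc_algebra K SA" by (rule sub_algebra)
  note mT = module_tensor[OF module_sub module_sub]
  note il = tensor_map_lin[OF module_sub module_sub module_H module_H inclusion inclusion]
  show "comult SA \<in> lin_maps K SA (tensor K SA SA)"
  proof (rule lin_mapsI)
    fix x y assume "x \<in> carrier SA" "y \<in> carrier SA"
    then have xy: "x \<in> A" "y \<in> A" by (auto simp: sub_hopf_simps)
    then have xyA: "x \<oplus>\<^bsub>H\<^esub> y \<in> A" by (rule submodule_memD(3)[OF A_submodule])
    show "comult SA (x \<oplus>\<^bsub>SA\<^esub> y) = comult SA x \<oplus>\<^bsub>tensor K SA SA\<^esub> comult SA y"
      by (rule inj_onD[OF inclusion_inj2])
        (use xy xyA in \<open>simp_all add: sub_hopf_simps sub_comult sub_comult_closed lin_add[OF il] lin_add[OF comult_linear] A_closed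
          module_add_closed[OF mT]\<close>)
  next
    fix c x assume c: "c \<in> carrier K" and "x \<in> carrier SA"
    then have x: "x \<in> A" by (auto simp: sub_hopf_simps)
    then have cxA: "c \<odot>\<^bsub>H\<^esub> x \<in> A" by (rule submodule_memD(4)[OF A_submodule c])
    show "comult SA (c \<odot>\<^bsub>SA\<^esub> x) = c \<odot>\<^bsub>tensor K SA SA\<^esub> comult SA x"
      by (rule inj_onD[OF inclusion_inj2])
        (use c x cxA in \<open>simp_all add: sub_hopf_simps sub_comult sub_comult_closed lin_smult[OF il] lin_smult[OF comult_linear] A_closed
          module_smult_closed[OF mT]\<close>)
  qed (simp add: sub_hopf_simps sub_comult_closed)
  show "id \<in> ring_hom SA H" by (rule ring_hom_memI) (simp_all add: sub_hopf_simps A_closed)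
  show "counit SA \<in> lin_maps K SA (ground_space K)"
    using lin_comp[OF counit_linear inclusion] by (simp add: sub_hopf_simps)
  show "antipode SA \<in> lin_maps K SA SA"
    by (rule lin_mapsI) (simp_all add: sub_hopf_simps A_closed A_antipode lin_add[OF antipode_linear] lin_smult[OF antipode_linear])
qed (simp_all add: inclusion comult_linear counit_linear antipode_linear sub_hopf_simps sub_comult)

lemma hopf_algebra_sub: "hopf_algebra K SA"
  by (rule sub.hopf_algebra_preimage) (simp_all add: hopf_algebra_axioms)

end

section \<open>Isomorphisms of Hopf algebras\<close>

lemma structure_map_comp:
  assumes "structure_map K C D \<phi>" "structure_map K D E \<psi>"
  shows "structure_map K C E (\<lambda>c. \<psi> (\<phi> c))"
proof -
  interpret P: structure_map K C D \<phi> by fact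
  interpret S: structure_map K D E \<psi> by fact
  show ?thesis
  proof (intro structure_map.intro structure_map_axioms.intro)
    show "assoc_algebra K C" "assoc_algebra K E" by unfold_locales
    show "(\<lambda>c. \<psi> (\<phi> c)) \<in> lin_maps K C E" by (rule lin_comp[OF S.\<phi>_lin P.\<phi>_lin])
    show "(\<lambda>c. \<psi> (\<phi> c)) \<in> ring_hom C E"
      using ring_hom_trans[OF P.\<phi>_hom S.\<phi>_hom] by (simp add: comp_def)
    show "comult E (\<psi> (\<phi> c)) = tensor_map K E E (\<lambda>c. \<psi> (\<phi> c)) (\<lambda>c. \<psi> (\<phi> c)) (comult C c)" if c: "c \<in> carrier C" for c
      using tensor_map_comp[OF P.mC P.mC P.mD P.mD P.\<phi>_lin P.\<phi>_lin S.mD S.mD S.\<phi>_lin S.\<phi>_lin lin_closed[OF P.C_comult c]]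
      by (simp add: c S.\<phi>_comult P.\<phi>_closed P.\<phi>_comult)
  qed (simp_all add: P.C_comult S.D_comult P.C_counit S.D_counit P.C_antipode S.D_antipode
      S.\<phi>_counit S.\<phi>_antipode P.\<phi>_closed P.\<phi>_counit P.\<phi>_antipode lin_closed[OF P.C_antipode])
qed

text \<open>
  Each compatibility of \<open>\<psi>\<close> is checked after composing with the injection \<open>\<iota>\<close>, where it is one of \<open>\<chi>\<close>.
\<close>

lemma structure_map_factor:
  assumes \<chi>: "structure_map K C F \<chi>" and \<iota>: "structure_map K E F \<iota>" and inj: "inj_on \<iota> (carrier E)"
    and \<psi>: "\<And>c. c \<in> carrier C \<Longrightarrow> \<psi> c \<in> carrier E" "\<And>c. c \<in> carrier C \<Longrightarrow> \<iota> (\<psi> c) = \<chi> c"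
  shows "structure_map K C E \<psi>"
proof -
  interpret X: structure_map K C F \<chi> by fact
  interpret J: structure_map K E F \<iota> by fact
  interpret mC: module K C by (rule X.mC)
  interpret mE: module K E by (rule J.mC)
  have eqI: "\<iota> x = \<iota> y \<Longrightarrow> x \<in> carrier E \<Longrightarrow> y \<in> carrier E \<Longrightarrow> x = y" for x y
    using inj by (rule inj_onD)
  have lin: "\<psi> \<in> lin_maps K C E"
  proof (rule lin_mapsI)
    show "\<psi> (x \<oplus>\<^bsub>C\<^esub> y) = \<psi> x \<oplus>\<^bsub>E\<^esub> \<psi> y" if "x \<in> carrier C" "y \<in> carrier C" for x y
      by (rule eqI) (use that in \<open>simp_all add: \<psi> lin_add[OF X.\<phi>_lin] lin_add[OF J.\<phi>_lin]\<close>)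
    show "\<psi> (a \<odot>\<^bsub>C\<^esub> x) = a \<odot>\<^bsub>E\<^esub> \<psi> x" if "a \<in> carrier K" "x \<in> carrier C" for a x
      by (rule eqI) (use that in \<open>simp_all add: \<psi> lin_smult[OF X.\<phi>_lin] lin_smult[OF J.\<phi>_lin]\<close>)
  qed (rule \<psi>(1))
  have K: "field K" by unfold_locales
  note inj2 = tensor_map_inj[OF K J.mC J.mC J.mD J.mD J.\<phi>_lin inj J.\<phi>_lin inj]
  note \<psi>\<psi> = tensor_map_lin[OF X.mC X.mC J.mC J.mC lin lin]
  show ?thesis
  proof (intro structure_map.intro structure_map_axioms.intro lin)
    show "assoc_algebra K C" "assoc_algebra K E" by unfold_locales
    show "\<psi> \<in> ring_hom C E"
    proof (rule ring_hom_memI)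
      show "\<psi> (x \<otimes>\<^bsub>C\<^esub> y) = \<psi> x \<otimes>\<^bsub>E\<^esub> \<psi> y" if "x \<in> carrier C" "y \<in> carrier C" for x y
        by (rule eqI) (use that in \<open>simp_all add: \<psi> X.\<phi>_mult J.\<phi>_mult\<close>)
      show "\<psi> \<one>\<^bsub>C\<^esub> = \<one>\<^bsub>E\<^esub>"
        by (rule eqI) (simp_all add: \<psi> X.\<phi>_one J.\<phi>_one)
    qed (simp_all add: \<psi> lin_add[OF lin])
    fix c assume c: "c \<in> carrier C"
    note t = lin_closed[OF X.C_comult c]
    show "comult E (\<psi> c) = tensor_map K E E \<psi> \<psi> (comult C c)"
    proof (rule inj_onD[OF inj2])
      have "tensor_map K F F \<iota> \<iota> (tensor_map K E E \<psi> \<psi> (comult C c))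
        = tensor_map K F F (\<lambda>c. \<iota> (\<psi> c)) (\<lambda>c. \<iota> (\<psi> c)) (comult C c)"
        by (rule tensor_map_comp[OF X.mC X.mC J.mC J.mC lin lin J.mD J.mD J.\<phi>_lin J.\<phi>_lin t])
      also have "\<dots> = tensor_map K F F \<chi> \<chi> (comult C c)"
        by (rule tensor_map_cong[OF X.mC X.mC J.mD J.mD lin_comp[OF J.\<phi>_lin lin] lin_comp[OF J.\<phi>_lin lin] _ _ t])
          (simp_all add: \<psi>)
      finally show "tensor_map K F F \<iota> \<iota> (comult E (\<psi> c)) = tensor_map K F F \<iota> \<iota> (tensor_map K E E \<psi> \<psi> (comult C c))"
        using c by (simp add: J.\<phi>_comult[symmetric] X.\<phi>_comult[symmetric] \<psi>)
    qed (use c t in \<open>simp_all add: lin_closed[OF J.C_comult] \<psi> lin_closed[OF \<psi>\<psi>]\<close>)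
    show "counit E (\<psi> c) = counit C c"
      using c J.\<phi>_counit[OF \<psi>(1)[OF c]] X.\<phi>_counit[OF c] by (simp add: \<psi>)
    show "antipode E (\<psi> c) = \<psi> (antipode C c)"
      using c J.\<phi>_antipode[OF \<psi>(1)[OF c]] X.\<phi>_antipode[OF c]
      by (intro eqI) (simp_all add: \<psi> lin_closed[OF X.C_antipode] lin_closed[OF J.C_antipode])
  qed (rule X.C_comult J.C_comult X.C_counit J.C_counit X.C_antipode J.C_antipode)+
qed

text \<open>
  The isomorphism sends \<open>\<phi>(c)\<close> to \<open>\<psi>(c)\<close>. Equality of the kernels makes this well defined and
  injective.
\<close>

lemma hopf_iso_of_same_kernel:
  assumes \<phi>: "structure_map K C D \<phi>" and \<psi>: "structure_map K C E \<psi>"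
    and surj: "\<phi> ` carrier C = carrier D" "\<psi> ` carrier C = carrier E"
    and hopf: "hopf_algebra K D" "hopf_algebra K E"
    and ker: "\<And>c. c \<in> carrier C \<Longrightarrow> \<phi> c = \<zero>\<^bsub>D\<^esub> \<longleftrightarrow> \<psi> c = \<zero>\<^bsub>E\<^esub>"
  shows "\<exists>f\<in>hopf_iso K D E. \<forall>c\<in>carrier C. f (\<phi> c) = \<psi> c"
proof -
  interpret P: structure_map K C D \<phi> by fact
  interpret S: structure_map K C E \<psi> by fact
  interpret C: module K C by (rule P.mC)
  have eq: "\<phi> x = \<phi> y \<longleftrightarrow> \<psi> x = \<psi> y" if "x \<in> carrier C" "y \<in> carrier C" for x y
  proof -
    have "\<phi> x = \<phi> y \<longleftrightarrow> \<phi> (x \<ominus>\<^bsub>C\<^esub> y) = \<zero>\<^bsub>D\<^esub>"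
      unfolding lin_minus[OF P.mC P.mD P.\<phi>_lin that]
      by (rule module_eq_iff_minus[OF P.mD P.\<phi>_closed[OF that(1)] P.\<phi>_closed[OF that(2)]])
    also have "\<dots> \<longleftrightarrow> \<psi> (x \<ominus>\<^bsub>C\<^esub> y) = \<zero>\<^bsub>E\<^esub>"
      using that by (intro ker module_minus_closed[OF P.mC])
    also have "\<dots> \<longleftrightarrow> \<psi> x = \<psi> y"
      unfolding lin_minus[OF P.mC S.mD S.\<phi>_lin that]
      by (rule module_eq_iff_minus[OF S.mD S.\<phi>_closed[OF that(1)] S.\<phi>_closed[OF that(2)], symmetric])
    finally show ?thesis .
  qed  define f where "f y = \<psi> (inv_into (carrier C) \<phi> y)" for y
  have f: "f (\<phi> c) = \<psi> c" if c: "c \<in> carrier C" for c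
  proof -
    have "\<phi> (inv_into (carrier C) \<phi> (\<phi> c)) = \<phi> c" using c by (intro f_inv_into_f) auto
    moreover have "inv_into (carrier C) \<phi> (\<phi> c) \<in> carrier C" using c by (intro inv_into_into) auto
    ultimately show ?thesis unfolding f_def using c eq[THEN iffD1] by blast
  qed
  have ex: "\<exists>c\<in>carrier C. d = \<phi> c" if "d \<in> carrier D" for d using that surj(1) by auto
  have lin: "f \<in> lin_maps K D E"
  proof (rule lin_mapsI)
    show "f d \<in> carrier E" if "d \<in> carrier D" for d
      using ex[OF that] f S.\<phi>_closed by auto
    fix d e assume "d \<in> carrier D" "e \<in> carrier D"
    then obtain x y where "d = \<phi> x" "e = \<phi> y" "x \<in> carrier C" "y \<in> carrier C" using ex by meson
    then show "f (d \<oplus>\<^bsub>D\<^esub> e) = f d \<oplus>\<^bsub>E\<^esub> f e"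
      by (simp add: lin_add[OF P.\<phi>_lin, symmetric] f lin_add[OF S.\<phi>_lin])
  next
    fix a d assume "a \<in> carrier K" "d \<in> carrier D"
    moreover from ex[OF this(2)] obtain x where "d = \<phi> x" "x \<in> carrier C" by auto
    ultimately show "f (a \<odot>\<^bsub>D\<^esub> d) = a \<odot>\<^bsub>E\<^esub> f d"
      by (simp add: lin_smult[OF P.\<phi>_lin, symmetric] f lin_smult[OF S.\<phi>_lin])
  qed
  have ring: "f \<in> ring_hom D E"
  proof (rule ring_hom_memI)
    fix d e assume "d \<in> carrier D" "e \<in> carrier D"
    then obtain x y where "d = \<phi> x" "e = \<phi> y" "x \<in> carrier C" "y \<in> carrier C" using ex by meson
    then show "f (d \<otimes>\<^bsub>D\<^esub> e) = f d \<otimes>\<^bsub>E\<^esub> f e"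
      by (simp add: P.\<phi>_mult[symmetric] f S.\<phi>_mult P.C.H.m_closed)
  next
    show "f \<one>\<^bsub>D\<^esub> = \<one>\<^bsub>E\<^esub>" using f[of "\<one>\<^bsub>C\<^esub>"] by (simp add: P.\<phi>_one S.\<phi>_one)
  qed (simp_all add: lin_add[OF lin] lin_closed[OF lin])
  have "f \<in> hopf_hom K D E"
    unfolding hopf_hom_def
  proof (intro CollectI conjI ballI lin ring)
    fix d assume "d \<in> carrier D"
    then obtain c where c: "c \<in> carrier C" "d = \<phi> c" using ex by auto
    note t = lin_closed[OF P.C_comult c(1)]
    have "tensor_map K E E f f (tensor_map K D D \<phi> \<phi> (comult C c))
        = tensor_map K E E (\<lambda>x. f (\<phi> x)) (\<lambda>x. f (\<phi> x)) (comult C c)"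
      by (rule tensor_map_comp[OF P.mC P.mC P.mD P.mD P.\<phi>_lin P.\<phi>_lin S.mD S.mD lin lin t])
    also have "\<dots> = tensor_map K E E \<psi> \<psi> (comult C c)"
      by (rule tensor_map_cong[OF P.mC P.mC S.mD S.mD lin_comp[OF lin P.\<phi>_lin] lin_comp[OF lin P.\<phi>_lin] _ _ t])
        (simp_all add: f)
    finally show "comult E (f d) = tensor_map K E E f f (comult D d)"
      using c by (simp add: f P.\<phi>_comult S.\<phi>_comult)
    show "counit E (f d) = counit D d" using c by (simp add: f P.\<phi>_counit S.\<phi>_counit)
    show "antipode E (f d) = f (antipode D d)"
      using c by (simp add: f P.\<phi>_antipode S.\<phi>_antipode lin_closed[OF P.C_antipode])
  qed
  moreover have "bij_betw f (carrier D) (carrier E)"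
  proof (rule bij_betw_imageI)
    show "inj_on f (carrier D)"
    proof (rule inj_onI)
      fix d e assume "d \<in> carrier D" "e \<in> carrier D" and fe: "f d = f e"
      then obtain x y where *: "d = \<phi> x" "e = \<phi> y" "x \<in> carrier C" "y \<in> carrier C" using ex by meson
      then show "d = e" using fe eq[of x y] by (simp add: f)
    qed
    have "f ` carrier D = (\<lambda>c. f (\<phi> c)) ` carrier C" unfolding surj(1)[symmetric] by (rule image_image)
    also have "\<dots> = \<psi> ` carrier C" by (rule image_cong) (simp_all add: f)
    finally show "f ` carrier D = carrier E" using surj(2) by simp
  qed
  ultimately have "f \<in> hopf_iso K D E" using hopf by (simp add: hopf_iso_def)
  with f show ?thesis by blast
qed

section \<open>A right coideal subalgebra inside a Hopf subalgebra\<close>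

locale normal_pair = normal_coideal K H B + hopf_sub K H A
  for K :: "('k, 'z) ring_scheme" and H :: "('k, 'h) hopf" and B A :: "'h set" +
  assumes A_normal: "right_normal K H A" and B_sub_A: "B \<subseteq> A"
begin

lemma field_K: "field K" by unfold_locales

lemma normal_coideal_A: "normal_coideal K H A"
proof (intro normal_coideal.intro normal_coideal_axioms.intro)
  show "hopf_algebra K H" by unfold_locales
  have "tensor_sub K H H A A \<subseteq> tensor_sub K H H A (carrier H)"
    by (rule tensor_sub_least[OF module_H module_H A_submodule A_submodule
          tensor_sub_submodule[OF module_H module_H A_submodule H_submodule]])
      (rule tensor_sub_pure[OF module_H module_H A_submodule H_submodule], auto simp: A_closed)
  then show "right_coideal_subalgebra K H A"
    unfolding right_coideal_subalgebra_def using A_subalg A_comult by auto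
  show "right_normal K H A" by (rule A_normal)
qed

lemma image_submodule: "submodule (\<pi> ` A) K Q"
  by (rule submodule_image[OF module_H module_quot quot_map_lin A_submodule])

lemma hopf_subalgebra_image: "hopf_subalgebra K Q (\<pi> ` A)"
  unfolding hopf_subalgebra_def subalg_def
proof (intro conjI image_submodule)
  interpret R: ring_hom_ring H Q \<pi>
    by (rule ring_hom_ringI2[OF H.ring_axioms ring_quot quot_map_ring_hom])
  show "subring (\<pi> ` A) Q" by (rule R.img_is_subring[OF A_subring])
  note l = tensor_map_lin[OF module_H module_H module_quot module_quot quot_map_lin quot_map_lin]
  note sub = tensor_sub_submodule[OF module_quot module_quot image_submodule image_submodule]
  have "tensor_sub K H H A A \<subseteq> {t \<in> carrier (tensor K H H). tensor_map K Q Q \<pi> \<pi> t \<in> tensor_sub K Q Q (\<pi> ` A) (\<pi> ` A)}"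
    by (rule tensor_sub_least[OF module_H module_H A_submodule A_submodule
          submodule_preimage[OF module_HH module_tensor[OF module_quot module_quot] l sub]])
      (auto simp: A_closed pure_tensor_closed[OF module_H module_H]
        tensor_map_pure[OF module_H module_H module_quot module_quot quot_map_lin quot_map_lin]
        intro!: tensor_sub_pure[OF module_quot module_quot image_submodule image_submodule])
  then show "comult Q ` (\<pi> ` A) \<subseteq> tensor_sub K Q Q (\<pi> ` A) (\<pi> ` A)"
    using A_comult by (fastforce simp: quot.\<phi>_comult A_closed)
  show "antipode Q ` (\<pi> ` A) \<subseteq> \<pi> ` A"
    using A_antipode by (auto simp: quot.\<phi>_antipode A_closed)
qed

lemma right_normal_image: "right_normal K Q (\<pi> ` A)"
  unfolding right_normal_def
proof (intro conjI ballI image_submodule)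
  fix a' h' assume "a' \<in> \<pi> ` A" "h' \<in> carrier Q"
  then obtain a h where *: "a \<in> A" "a' = \<pi> a" "h \<in> carrier H" "h' = \<pi> h" by (auto simp: quot_hopf_carrier)
  note aH = A_closed[OF *(1)]
  have "tensor_lift K Q (\<lambda>x y. antipode Q x \<otimes>\<^bsub>Q\<^esub> a' \<otimes>\<^bsub>Q\<^esub> y) (comult Q (\<pi> h))
    = \<pi> (tensor_lift K H (\<lambda>x y. antipode H x \<otimes>\<^bsub>H\<^esub> a \<otimes>\<^bsub>H\<^esub> y) (comult H h))"
  proof (rule quot.sweedler_transport[OF *(3) module_H module_quot quot_map_lin])
    show "bilin K H H H (\<lambda>x y. antipode H x \<otimes>\<^bsub>H\<^esub> a \<otimes>\<^bsub>H\<^esub> y)" using aH by (auto intro!: lin_rules)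
    show "bilin K Q Q Q (\<lambda>x y. antipode Q x \<otimes>\<^bsub>Q\<^esub> a' \<otimes>\<^bsub>Q\<^esub> y)"
      using quot_map_closed[OF aH] lin_closed[OF quot.D_antipode] unfolding *(2)
      by (auto intro!: bilinI quot.D.lin_mult_left quot.D.lin_mult_right lin_id quot.D_antipode)
  qed (use aH *(2) in \<open>simp add: quot.\<phi>_antipode quot_map_mult\<close>)
  then show "tensor_lift K Q (\<lambda>x y. antipode Q x \<otimes>\<^bsub>Q\<^esub> a' \<otimes>\<^bsub>Q\<^esub> y) (comult Q h') \<in> \<pi> ` A"
    using A_normal *(1,3) unfolding right_normal_def *(4) by auto
qed

sublocale HA: normal_coideal K H A by (rule normal_coideal_A)

sublocale QA: hopf_sub K Q "\<pi> ` A"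
  by (intro hopf_sub.intro hopf_sub_axioms.intro hopf_algebra_quot hopf_subalgebra_image)

lemma normal_coideal_image: "normal_coideal K Q (\<pi> ` A)"
proof (intro normal_coideal.intro normal_coideal_axioms.intro hopf_algebra_quot right_normal_image)
  have "tensor_sub K Q Q (\<pi> ` A) (\<pi> ` A) \<subseteq> tensor_sub K Q Q (\<pi> ` A) (carrier Q)"
    by (rule tensor_sub_least[OF module_quot module_quot image_submodule image_submodule
          tensor_sub_submodule[OF module_quot module_quot image_submodule module.carrier_is_submodule[OF module_quot]]])
      (rule tensor_sub_pure[OF module_quot module_quot image_submodule module.carrier_is_submodule[OF module_quot]],
        auto intro: QA.A_closed)
  then show "right_coideal_subalgebra K Q (\<pi> ` A)"
    unfolding right_coideal_subalgebra_def using QA.A_subalg QA.A_comult by auto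
qed

sublocale QQ: normal_coideal K Q "\<pi> ` A" by (rule normal_coideal_image)

lemma I_sub_IA: "x \<in> I \<Longrightarrow> x \<in> aug_ideal K H A"
proof (rule I_least[OF HA.I_submodule])
  show "h \<otimes>\<^bsub>H\<^esub> b \<in> aug_ideal K H A" if "h \<in> carrier H" "b \<in> augmentation K H B" for h b
    by (rule HA.I_gen) (use that B_sub_A in \<open>auto simp: augmentation_def\<close>)
qed

text \<open>
  Counits are preserved by \<open>\<pi>\<close>, so \<open>\<pi>(A)\<^sup>+ = \<pi>(A\<^sup>+)\<close>, and \<open>\<pi>\<close> is onto.
\<close>

lemma image_aug_ideal: "aug_ideal K Q (\<pi> ` A) = \<pi> ` aug_ideal K H A"
proof
  note sub = submodule_image[OF module_H module_quot quot_map_lin HA.I_submodule]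
  show "aug_ideal K Q (\<pi> ` A) \<subseteq> \<pi> ` aug_ideal K H A"
  proof
    fix y assume "y \<in> aug_ideal K Q (\<pi> ` A)"
    then show "y \<in> \<pi> ` aug_ideal K H A"
    proof (rule QQ.I_least[OF sub, rotated])
      fix q b assume "q \<in> carrier Q" "b \<in> augmentation K Q (\<pi> ` A)"
      then obtain h a where *: "q = \<pi> h" "h \<in> carrier H" "b = \<pi> a" "a \<in> A" "counit Q b = \<zero>\<^bsub>K\<^esub>"
        by (auto simp: augmentation_def quot_hopf_carrier)
      then have "a \<in> augmentation K H A" by (simp add: augmentation_def quot.\<phi>_counit A_closed)
      then show "q \<otimes>\<^bsub>Q\<^esub> b \<in> \<pi> ` aug_ideal K H A"
        using * A_closed HA.I_gen by (simp add: quot_map_mult[symmetric])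
    qed
  qed
  show "\<pi> ` aug_ideal K H A \<subseteq> aug_ideal K Q (\<pi> ` A)"
  proof
    fix y assume "y \<in> \<pi> ` aug_ideal K H A"
    then obtain x where x: "x \<in> aug_ideal K H A" "y = \<pi> x" by auto
    have "x \<in> {x \<in> carrier H. \<pi> x \<in> aug_ideal K Q (\<pi> ` A)}"
    proof (rule HA.I_least[OF submodule_preimage[OF module_H module_quot quot_map_lin QQ.I_submodule] _ x(1)])
      fix h a assume h: "h \<in> carrier H" and a: "a \<in> augmentation K H A"
      have aA: "a \<in> A" "counit H a = \<zero>\<^bsub>K\<^esub>" using a by (auto simp: augmentation_def)
      then have "\<pi> a \<in> augmentation K Q (\<pi> ` A)" by (simp add: augmentation_def quot.\<phi>_counit A_closed)
      then show "h \<otimes>\<^bsub>H\<^esub> a \<in> {x \<in> carrier H. \<pi> x \<in> aug_ideal K Q (\<pi> ` A)}"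
        using h aA QQ.I_gen by (simp add: quot_map_mult A_closed quot_map_closed)
    qed
    then show "y \<in> aug_ideal K Q (\<pi> ` A)" using x by simp
  qed
qed

text \<open>
  If \<open>\<pi>(h) = \<pi>(x)\<close> with \<open>x \<in> HA\<^sup>+\<close>, then \<open>h - x \<in> HB\<^sup>+ \<subseteq> HA\<^sup>+\<close>.
\<close>

lemma quotient_in_stages_kernel:
  assumes h: "h \<in> carrier H"
  shows "\<pi> h \<in> aug_ideal K Q (\<pi> ` A) \<longleftrightarrow> h \<in> aug_ideal K H A"
proof
  assume "\<pi> h \<in> aug_ideal K Q (\<pi> ` A)"
  then obtain x where x: "x \<in> aug_ideal K H A" "\<pi> h = \<pi> x" unfolding image_aug_ideal by auto
  note xH = HA.I_closed[OF x(1)]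
  have "h \<ominus>\<^bsub>H\<^esub> x \<in> aug_ideal K H A" using x(2) h xH I_sub_IA by (simp add: quot_map_eq_iff)
  then have "(h \<ominus>\<^bsub>H\<^esub> x) \<oplus>\<^bsub>H\<^esub> x \<in> aug_ideal K H A" using x(1) submodule_memD(3)[OF HA.I_submodule] by blast
  then show "h \<in> aug_ideal K H A" using module_diff_add[OF module_H h xH] by simp
qed (simp add: image_aug_ideal)

theorem quotient_in_stages:
  "\<exists>f \<in> hopf_iso K (quot_hopf K Q (\<pi> ` A)) (quot_hopf K H A).
     \<forall>h\<in>carrier H. f (quot_map K Q (\<pi> ` A) (\<pi> h)) = quot_map K H A h"
proof (rule hopf_iso_of_same_kernel[OF structure_map_comp[OF quot.structure_map_axioms QQ.quot.structure_map_axioms]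
      HA.quot.structure_map_axioms])
  show "(\<lambda>h. quot_map K Q (\<pi> ` A) (\<pi> h)) ` carrier H = carrier (quot_hopf K Q (\<pi> ` A))"
    unfolding QQ.quot_hopf_carrier quot_hopf_carrier by (simp add: image_image)
  show "quot_map K H A ` carrier H = carrier (quot_hopf K H A)" by (simp add: HA.quot_hopf_carrier)
qed (simp_all add: QQ.hopf_algebra_quot HA.hopf_algebra_quot QQ.quot_map_zero_iff HA.quot_map_zero_iff
    quot_map_closed quotient_in_stages_kernel)

text \<open>
  The point is that \<open>\<Delta>(b) \<in> (B \<otimes> H) \<inter> (A \<otimes> A)\<close> lies in \<open>B \<otimes> A\<close>. A linear retraction \<open>r\<close> of \<open>H\<close> onto \<open>A\<close>
  gives \<open>r \<otimes> r\<close>, which fixes elements of \<open>A \<otimes> A\<close> and maps \<open>B \<otimes> H\<close> into \<open>B \<otimes> A\<close>.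
\<close>

lemma normal_coideal_sub: "normal_coideal K SA B"
proof (intro normal_coideal.intro normal_coideal_axioms.intro hopf_algebra_sub)
  note Bm = submodule_memD[OF X_submodule]
  have B: "submodule B K SA"
    by (rule submodule_by_closure[OF module_sub]) (use B_sub_A Bm in \<open>auto simp: sub_hopf_simps\<close>)
  have "ring (SA\<lparr>carrier := B\<rparr>)"
    by (rule ring_cong[OF H.subring_is_ring[OF X_subring]]) (simp_all add: sub_hopf_simps)
  then have "subring B SA"
    using ring.ring_incl_imp_subring[of SA B] sub_algebra B_sub_A
    by (simp add: sub_hopf_simps assoc_algebra_def)
  moreover have "comult SA b \<in> tensor_sub K SA SA B (carrier SA)" if b: "b \<in> B" for b
  proof -
    have bA: "b \<in> A" using b B_sub_A by auto
    (* a linear retraction of H onto A *)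
    obtain r where r: "r \<in> lin_maps K H SA" "\<And>x. x \<in> carrier SA \<Longrightarrow> r (id x) = x"
      using lin_left_inverse[OF field_K module_sub module_H inclusion inj_on_id] by blast
    note rr = tensor_map_lin[OF module_H module_H module_sub module_sub r(1) r(1)]
    note cS = module.carrier_is_submodule[OF module_sub]
    have "tensor_map K SA SA r r (comult H b) = tensor_map K SA SA r r (tensor_map K H H id id (comult SA b))"
      by (simp add: sub_comult[OF bA])
    also have "\<dots> = tensor_map K SA SA (\<lambda>x. r (id x)) (\<lambda>x. r (id x)) (comult SA b)"
      by (rule tensor_map_comp[OF module_sub module_sub module_H module_H inclusion inclusion
            module_sub module_sub r(1) r(1) sub_comult_closed[OF bA]])
    also have "\<dots> = tensor_map K SA SA (\<lambda>x. x) (\<lambda>x. x) (comult SA b)"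
      by (rule tensor_map_cong[OF module_sub module_sub module_sub module_sub lin_comp[OF r(1) inclusion]
            lin_comp[OF r(1) inclusion] _ _ sub_comult_closed[OF bA]]) (rule r(2), assumption)+
    also have "\<dots> = comult SA b" by (rule tensor_map_ident[OF module_sub module_sub sub_comult_closed[OF bA]])
    finally have eq: "comult SA b = tensor_map K SA SA r r (comult H b)" by simp
    have "tensor_sub K H H B (carrier H)
      \<subseteq> {t \<in> carrier (tensor K H H). tensor_map K SA SA r r t \<in> tensor_sub K SA SA B (carrier SA)}"
    proof (rule tensor_sub_least[OF module_H module_H X_submodule H_submodule submodule_preimage[OF module_HH
            module_tensor[OF module_sub module_sub] rr tensor_sub_submodule[OF module_sub module_sub B cS]]])
      fix x y assume xy: "x \<in> B" "y \<in> carrier H"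
      then have "r x = x" using r(2)[of x] B_sub_A by (auto simp: sub_hopf_simps)
      then have "tensor_map K SA SA r r (pure_tensor K H H x y) = pure_tensor K SA SA x (r y)"
        using xy X_closed by (simp add: tensor_map_pure[OF module_H module_H module_sub module_sub r(1) r(1)])
      then show "pure_tensor K H H x y \<in> {t \<in> carrier (tensor K H H). tensor_map K SA SA r r t \<in> tensor_sub K SA SA B (carrier SA)}"
        using xy X_closed lin_closed[OF r(1)] tensor_sub_pure[OF module_sub module_sub B cS]
        by (simp add: pure_tensor_closed[OF module_H module_H])
    qed
    then show ?thesis using X_comult[OF b] unfolding eq by auto
  qed
  ultimately show "right_coideal_subalgebra K SA B"
    using B by (auto simp: right_coideal_subalgebra_def subalg_def)
  show "right_normal K SA B"
    unfolding right_normal_def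
  proof (intro conjI ballI B)
    fix b h assume b: "b \<in> B" and h: "h \<in> carrier SA"
    have bc: "b \<in> carrier SA" using b B_sub_A by (auto simp: sub_hopf_simps)
    have "tensor_lift K H (\<lambda>x y. antipode H x \<otimes>\<^bsub>H\<^esub> b \<otimes>\<^bsub>H\<^esub> y) (comult H (id h))
      = id (tensor_lift K SA (\<lambda>x y. antipode SA x \<otimes>\<^bsub>SA\<^esub> b \<otimes>\<^bsub>SA\<^esub> y) (comult SA h))"
    proof (rule sub.sweedler_transport[OF h module_sub module_H inclusion])
      show "bilin K H H H (\<lambda>x y. antipode H x \<otimes>\<^bsub>H\<^esub> b \<otimes>\<^bsub>H\<^esub> y)" using X_closed[OF b] by (auto intro!: lin_rules)
      show "bilin K SA SA SA (\<lambda>x y. antipode SA x \<otimes>\<^bsub>SA\<^esub> b \<otimes>\<^bsub>SA\<^esub> y)"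
        using bc lin_closed[OF sub.C_antipode]
        by (auto intro!: bilinI sub.C.lin_mult_left sub.C.lin_mult_right lin_id sub.C_antipode sub.C.H.m_closed)
    qed (simp add: sub_hopf_simps)
    moreover have "tensor_lift K H (\<lambda>x y. antipode H x \<otimes>\<^bsub>H\<^esub> b \<otimes>\<^bsub>H\<^esub> y) (comult H (id h)) \<in> B"
      using normal b h A_closed by (simp add: right_normal_def sub_hopf_simps)
    ultimately show "tensor_lift K SA (\<lambda>x y. antipode SA x \<otimes>\<^bsub>SA\<^esub> b \<otimes>\<^bsub>SA\<^esub> y) (comult SA h) \<in> B"
      by (simp only: id_apply)
  qed
qed

sublocale SB: normal_coideal K SA B by (rule normal_coideal_sub)

lemma sub_aug_ideal_subset:
  assumes "a \<in> aug_ideal K SA B"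
  shows "a \<in> I"
proof -
  have "a \<in> {x \<in> carrier SA. id x \<in> I}"
    by (rule SB.I_least[OF submodule_preimage[OF module_sub module_H inclusion I_submodule] _ assms])
      (use submodule_memD B_sub_A I_gen in \<open>auto simp: sub_hopf_simps augmentation_def A_closed intro!: subringE(6)[OF A_subring]\<close>)
  then show ?thesis by simp
qed

text \<open>
  The comultiplication of the sub-Hopf algebra is an inverse image, so compatibility is verified inside
  the ambient quotient, into which it embeds.
\<close>

lemma restricted_structure_map: "structure_map K SA (sub_hopf K Q (\<pi> ` A)) \<pi>"
  by (rule structure_map_factor[OF structure_map_comp[OF sub.structure_map_axioms quot.structure_map_axioms]
        QA.sub.structure_map_axioms]) (simp_all add: QA.sub_hopf_simps sub_hopf_simps)

theorem restricted_quotient_iso: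
  assumes ker: "\<And>a. a \<in> A \<Longrightarrow> a \<in> I \<Longrightarrow> a \<in> aug_ideal K SA B"
  shows "\<exists>f \<in> hopf_iso K (quot_hopf K SA B) (sub_hopf K Q (\<pi> ` A)). \<forall>a\<in>A. f (quot_map K SA B a) = \<pi> a"
proof -
  have "\<exists>f \<in> hopf_iso K (quot_hopf K SA B) (sub_hopf K Q (\<pi> ` A)).
      \<forall>a\<in>carrier SA. f (quot_map K SA B a) = \<pi> a"
  proof (rule hopf_iso_of_same_kernel[OF SB.quot.structure_map_axioms restricted_structure_map])
    show "quot_map K SA B a = \<zero>\<^bsub>quot_hopf K SA B\<^esub> \<longleftrightarrow> \<pi> a = \<zero>\<^bsub>sub_hopf K Q (\<pi> ` A)\<^esub>" if "a \<in> carrier SA" for a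
      using that ker[of a] sub_aug_ideal_subset[of a]
      by (auto simp: SB.quot_map_zero_iff QA.sub_hopf_simps quot_map_zero_iff sub_hopf_simps A_closed)
  qed (simp_all add: SB.quot_hopf_carrier QA.sub_hopf_simps sub_hopf_simps SB.hopf_algebra_quot QA.hopf_algebra_sub)
  then show ?thesis by (simp add: sub_hopf_simps)
qed

end

section \<open>Flatness over the coideal subalgebra\<close>

lemma module_of_right_module: "right_module K S M r \<Longrightarrow> module K M"
  by (simp add: right_module_def)

lemma right_action_closed: "right_module K S M r \<Longrightarrow> x \<in> carrier M \<Longrightarrow> s \<in> carrier S \<Longrightarrow> r x s \<in> carrier M"
  using lin_closed[OF right_module.act_linear_left] .

context
  fixes K :: "('k, 'z) ring_scheme" and S :: "('k, 's, 'a) module_scheme"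
    and M :: "('k, 'm, 'b) module_scheme" and r :: "'m \<Rightarrow> 's \<Rightarrow> 'm"
    and N :: "('k, 'n, 'c) module_scheme" and l :: "'s \<Rightarrow> 'n \<Rightarrow> 'n"
  assumes Mr: "right_module K S M r" and N: "module K N"
    and l: "\<forall>s\<in>carrier S. \<forall>y\<in>carrier N. l s y \<in> carrier N"
begin

lemma balanced_rel_gens_closed:
  "{pure_tensor K M N (r x s) y \<ominus>\<^bsub>tensor K M N\<^esub> pure_tensor K M N x (l s y) | x s y.
     x \<in> carrier M \<and> s \<in> carrier S \<and> y \<in> carrier N} \<subseteq> carrier (tensor K M N)"
  using l by (auto intro!: module_minus_closed[OF module_tensor] pure_tensor_closed module_of_right_module[OF Mr] N right_action_closed[OF Mr])

lemma balanced_rel_submodule: "submodule (balanced_rel K S M r N l) K (tensor K M N)"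
  unfolding balanced_rel_def
  by (rule submodule_span[OF module_tensor[OF module_of_right_module[OF Mr] N] balanced_rel_gens_closed])

lemma balanced_rel_kernel:
  assumes P: "module K P" and f: "f \<in> lin_maps K (tensor K M N) P"
    and eq: "\<And>x s y. x \<in> carrier M \<Longrightarrow> s \<in> carrier S \<Longrightarrow> y \<in> carrier N \<Longrightarrow>
      f (pure_tensor K M N (r x s) y) = f (pure_tensor K M N x (l s y))"
    and t: "t \<in> balanced_rel K S M r N l"
  shows "f t = \<zero>\<^bsub>P\<^esub>"
proof -
  note m = module_of_right_module[OF Mr] N
  note T = module_tensor[OF m]
  have "balanced_rel K S M r N l \<subseteq> {t \<in> carrier (tensor K M N). f t \<in> {\<zero>\<^bsub>P\<^esub>}}"
    unfolding balanced_rel_def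
  proof (rule span_minimal[OF _ submodule_preimage[OF T P f submodule_zero[OF P]]], rule subsetI)
    fix g assume g: "g \<in> {pure_tensor K M N (r x s) y \<ominus>\<^bsub>tensor K M N\<^esub> pure_tensor K M N x (l s y) | x s y.
        x \<in> carrier M \<and> s \<in> carrier S \<and> y \<in> carrier N}"
    then obtain x s y where *: "g = pure_tensor K M N (r x s) y \<ominus>\<^bsub>tensor K M N\<^esub> pure_tensor K M N x (l s y)"
      "x \<in> carrier M" "s \<in> carrier S" "y \<in> carrier N" by auto
    note c = pure_tensor_closed[OF m right_action_closed[OF Mr *(2,3)] *(4)] pure_tensor_closed[OF m *(2) l[rule_format, OF *(3,4)]]
    have "f g = \<zero>\<^bsub>P\<^esub>"
      using module_eq_iff_minus[OF P lin_closed[OF f c(1)] lin_closed[OF f c(2)]] eq[OF *(2-4)]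
      unfolding *(1) lin_minus[OF T P f c] by blast
    then show "g \<in> {t \<in> carrier (tensor K M N). f t \<in> {\<zero>\<^bsub>P\<^esub>}}"
      using g balanced_rel_gens_closed by auto
  qed
  then show ?thesis using t by auto
qed

lemma balanced_coset_lin:
  "(\<lambda>t. balanced_rel K S M r N l +>\<^bsub>tensor K M N\<^esub> t) \<in> lin_maps K (tensor K M N) (balanced_tensor K S M r N l)"
  unfolding balanced_tensor_def
  by (rule coset_lin[OF module_tensor[OF module_of_right_module[OF Mr] N] balanced_rel_submodule])

lemma module_balanced_tensor: "module K (balanced_tensor K S M r N l)"
  unfolding balanced_tensor_def
  by (rule module_quot_space[OF module_tensor[OF module_of_right_module[OF Mr] N] balanced_rel_submodule])

lemma balanced_zero: "\<zero>\<^bsub>balanced_tensor K S M r N l\<^esub> = balanced_rel K S M r N l"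
  by (simp add: balanced_tensor_def quot_space_zero)

lemma balanced_coset_zero_iff:
  "t \<in> carrier (tensor K M N) \<Longrightarrow>
    balanced_rel K S M r N l +>\<^bsub>tensor K M N\<^esub> t = balanced_rel K S M r N l \<longleftrightarrow> t \<in> balanced_rel K S M r N l"
  by (rule coset_zero_iff[OF module_tensor[OF module_of_right_module[OF Mr] N] balanced_rel_submodule])

lemma balanced_carrier:
  "carrier (balanced_tensor K S M r N l) = (\<lambda>t. balanced_rel K S M r N l +>\<^bsub>tensor K M N\<^esub> t) ` carrier (tensor K M N)"
  by (simp add: balanced_tensor_def quot_space_carrier)

lemma balanced_pure:
  assumes "x \<in> carrier M" "s \<in> carrier S" "y \<in> carrier N"
  shows "balanced_rel K S M r N l +>\<^bsub>tensor K M N\<^esub> pure_tensor K M N (r x s) y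
    = balanced_rel K S M r N l +>\<^bsub>tensor K M N\<^esub> pure_tensor K M N x (l s y)"
proof (rule iffD2[OF coset_eq_iff[OF module_tensor[OF module_of_right_module[OF Mr] N] balanced_rel_submodule]])
  show "pure_tensor K M N (r x s) y \<ominus>\<^bsub>tensor K M N\<^esub> pure_tensor K M N x (l s y) \<in> balanced_rel K S M r N l"
    unfolding balanced_rel_def by (rule subsetD[OF span_superset]) (use assms in auto)
qed (use assms l right_action_closed[OF Mr] in \<open>auto intro: pure_tensor_closed[OF module_of_right_module[OF Mr] N]\<close>)

end

text \<open>
  The map \<open>f \<otimes> id\<close> respects the balancing relations because \<open>f\<close> commutes with the right actions.
\<close>

lemma balanced_map_value:
  assumes Mr: "right_module K S M r" and Mr': "right_module K S M' r'" and N: "module K N"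
    and l: "\<forall>s\<in>carrier S. \<forall>y\<in>carrier N. l s y \<in> carrier N"
    and f: "f \<in> right_module_hom K S M r M' r'" and t: "t \<in> carrier (tensor K M N)"
  shows "balanced_map K S M' r' N l f (balanced_rel K S M r N l +>\<^bsub>tensor K M N\<^esub> t)
    = balanced_rel K S M' r' N l +>\<^bsub>tensor K M' N\<^esub> tensor_map K M' N f id t"
proof -
  note m = module_of_right_module[OF Mr] module_of_right_module[OF Mr']
  have fl: "f \<in> lin_maps K M M'" and fr: "\<And>x s. x \<in> carrier M \<Longrightarrow> s \<in> carrier S \<Longrightarrow> f (r x s) = r' (f x) s"
    using f by (auto simp: right_module_hom_def)
  have id: "id \<in> lin_maps K N N" by (simp add: id_def lin_id)
  let ?F = "\<lambda>t. balanced_rel K S M' r' N l +>\<^bsub>tensor K M' N\<^esub> tensor_map K M' N f id t"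
  note tm = tensor_map_lin[OF m(1) N m(2) N fl id]
  have F: "?F \<in> lin_maps K (tensor K M N) (balanced_tensor K S M' r' N l)"
    by (rule lin_comp[OF balanced_coset_lin[OF Mr' N l] tm])
  have k: "?F t = \<zero>\<^bsub>balanced_tensor K S M' r' N l\<^esub>" if "t \<in> balanced_rel K S M r N l" for t
  proof (rule balanced_rel_kernel[OF Mr N l module_balanced_tensor[OF Mr' N l] F _ that])
    fix x s y assume *: "x \<in> carrier M" "s \<in> carrier S" "y \<in> carrier N"
    then show "?F (pure_tensor K M N (r x s) y) = ?F (pure_tensor K M N x (l s y))"
      using balanced_pure[OF Mr' N l lin_closed[OF fl *(1)] *(2,3)] right_action_closed[OF Mr *(1,2)] l
      by (simp add: tensor_map_pure[OF m(1) N m(2) N fl id] fr)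
  qed
  show ?thesis
    unfolding balanced_map_def
    by (rule coset_lift_value[OF module_tensor[OF m(1) N] balanced_rel_submodule[OF Mr N l]
          module_balanced_tensor[OF Mr' N l] F k t])
qed

text \<open>
  The left end of the exact sequence \<open>0 \<rightarrow> M \<rightarrow> M'\<close>, realised in the type over which flatness quantifies.
\<close>

lemma zero_right_module:
  assumes "right_module K S M r"
  shows "right_module K S (M\<lparr>carrier := {\<zero>\<^bsub>M\<^esub>}\<rparr>) r"
proof -
  interpret R: right_module K S M r by fact
  have m: "module K M" by (rule module_of_right_module) fact
  have z: "r \<zero>\<^bsub>M\<^esub> s = \<zero>\<^bsub>M\<^esub>" if "s \<in> carrier S" for s
    by (rule lin_zero[OF m m R.act_linear_left[OF that]])
  interpret S: module K S by (rule R.S.module_H)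
  note zc = module_zero_closed[OF m]
  show ?thesis
  proof (intro right_module.intro right_module_axioms.intro)
    show "assoc_algebra K S" by unfold_locales
    show "module K (M\<lparr>carrier := {\<zero>\<^bsub>M\<^esub>}\<rparr>)" by (rule submodule_module[OF m submodule_zero[OF m]])
    show "(\<lambda>x. r x s) \<in> lin_maps K (M\<lparr>carrier := {\<zero>\<^bsub>M\<^esub>}\<rparr>) (M\<lparr>carrier := {\<zero>\<^bsub>M\<^esub>}\<rparr>)" if "s \<in> carrier S" for s
      using lin_add[OF R.act_linear_left[OF that]] lin_smult[OF R.act_linear_left[OF that]] z[OF that] zc
      by (intro lin_mapsI) auto
    show "r x \<in> lin_maps K S (M\<lparr>carrier := {\<zero>\<^bsub>M\<^esub>}\<rparr>)" if "x \<in> carrier (M\<lparr>carrier := {\<zero>\<^bsub>M\<^esub>}\<rparr>)" for x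
      using that lin_add[OF R.act_linear_right[OF zc]] lin_smult[OF R.act_linear_right[OF zc]] z
      by (intro lin_mapsI) auto
  qed (use zc in \<open>auto simp: R.act_mult R.act_one\<close>)
qed

text \<open>
  Flatness applied to the exact sequence \<open>0 \<rightarrow> M \<rightarrow> M'\<close>. The tensor product with the zero module is zero, so
  exactness in the middle says that \<open>M \<otimes>\<^sub>S N \<rightarrow> M' \<otimes>\<^sub>S N\<close> has trivial kernel.
\<close>

lemma faithfully_flat_injective:
  fixes M :: "('k, 'u) module" and M' :: "('k, 'u) module"
  assumes flat: "faithfully_flat_left TYPE('u) K S N l"
    and Mr: "right_module K S M r" and Mr': "right_module K S M' r'" and N: "module K N"
    and l: "\<forall>s\<in>carrier S. \<forall>y\<in>carrier N. l s y \<in> carrier N"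
    and f: "f \<in> right_module_hom K S M r M' r'" and inj: "inj_on f (carrier M)"
    and t: "t \<in> carrier (tensor K M N)" and ft: "tensor_map K M' N f id t \<in> balanced_rel K S M' r' N l"
  shows "t \<in> balanced_rel K S M r N l"
proof -
  let ?Z = "M\<lparr>carrier := {\<zero>\<^bsub>M\<^esub>}\<rparr>"
  note Zr = zero_right_module[OF Mr]
  note m = module_of_right_module[OF Mr] module_of_right_module[OF Mr'] module_of_right_module[OF Zr]
  have fl: "f \<in> lin_maps K M M'" using f by (simp add: right_module_hom_def)
  have id: "id \<in> lin_maps K N N" by (simp add: id_def lin_id)
  have jl: "(\<lambda>x. x) \<in> lin_maps K ?Z M" by (rule inclusion_lin[OF submodule_zero[OF m(1)]])
  then have j: "(\<lambda>x. x) \<in> right_module_hom K S ?Z r M r" by (simp add: right_module_hom_def)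
  have f0: "f \<zero>\<^bsub>M\<^esub> = \<zero>\<^bsub>M'\<^esub>" by (rule lin_zero[OF m(1,2) fl])
  have ex: "exact_at ?Z M M' (\<lambda>x. x) f"
  proof -
    have "{x \<in> carrier M. f x = \<zero>\<^bsub>M'\<^esub>} \<subseteq> {\<zero>\<^bsub>M\<^esub>}"
    proof
      fix x assume "x \<in> {x \<in> carrier M. f x = \<zero>\<^bsub>M'\<^esub>}"
      then have "f x = f \<zero>\<^bsub>M\<^esub>" "x \<in> carrier M" using f0 by auto
      then show "x \<in> {\<zero>\<^bsub>M\<^esub>}" using inj_onD[OF inj] module_zero_closed[OF m(1)] by blast
    qed
    moreover have "{\<zero>\<^bsub>M\<^esub>} \<subseteq> {x \<in> carrier M. f x = \<zero>\<^bsub>M'\<^esub>}" using f0 module_zero_closed[OF m(1)] by simp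
    ultimately have "{x \<in> carrier M. f x = \<zero>\<^bsub>M'\<^esub>} = {\<zero>\<^bsub>M\<^esub>}" by (rule subset_antisym)
    then show ?thesis by (simp add: exact_at_def)
  qed
  have "exact_at (balanced_tensor K S ?Z r N l) (balanced_tensor K S M r N l) (balanced_tensor K S M' r' N l)
      (balanced_map K S M r N l (\<lambda>x. x)) (balanced_map K S M' r' N l f)"
    using flat[unfolded faithfully_flat_left_def, rule_format, of ?Z r M r M' r' "\<lambda>x. x" f] Zr Mr Mr' j f ex by blast
  then have im: "balanced_map K S M r N l (\<lambda>x. x) ` carrier (balanced_tensor K S ?Z r N l)
    = {x \<in> carrier (balanced_tensor K S M r N l). balanced_map K S M' r' N l f x = balanced_rel K S M' r' N l}"
    unfolding exact_at_def balanced_zero[OF Mr' N l] .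
  let ?X = "balanced_rel K S M r N l +>\<^bsub>tensor K M N\<^esub> t"
  have "balanced_map K S M' r' N l f ?X = balanced_rel K S M' r' N l"
    unfolding balanced_map_value[OF Mr Mr' N l f t]
    using balanced_coset_zero_iff[OF Mr' N l lin_closed[OF tensor_map_lin[OF m(1) N m(2) N fl id] t]] ft by simp
  then have "?X \<in> balanced_map K S M r N l (\<lambda>x. x) ` carrier (balanced_tensor K S ?Z r N l)"
    unfolding im using t by (auto simp: balanced_carrier[OF Mr N l])
  then obtain u where u: "u \<in> carrier (tensor K ?Z N)"
    "?X = balanced_rel K S M r N l +>\<^bsub>tensor K M N\<^esub> tensor_map K M N (\<lambda>x. x) id u"
    by (auto simp: balanced_carrier[OF Zr N l] balanced_map_value[OF Zr Mr N l j])
  note T = module_tensor[OF m(1) N]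
  note jt = tensor_map_lin[OF m(3) N m(1) N jl id]
  have "u \<in> {u \<in> carrier (tensor K ?Z N). tensor_map K M N (\<lambda>x. x) id u \<in> {\<zero>\<^bsub>tensor K M N\<^esub>}}"
  proof (rule tensor_submodule_eqI[OF m(3) N submodule_preimage[OF module_tensor[OF m(3) N] T jt submodule_zero[OF T]] _ u(1)])
    fix x y assume xy: "x \<in> carrier ?Z" "y \<in> carrier N"
    have "pure_tensor K M N \<zero>\<^bsub>M\<^esub> y = \<zero>\<^bsub>tensor K M N\<^esub>"
      by (rule lin_zero[OF m(1) T bilin_left[OF pure_tensor_bilin[OF m(1) N] xy(2)]])
    then show "pure_tensor K ?Z N x y \<in> {u \<in> carrier (tensor K ?Z N). tensor_map K M N (\<lambda>x. x) id u \<in> {\<zero>\<^bsub>tensor K M N\<^esub>}}"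
      using xy pure_tensor_closed[OF m(3) N xy] by (simp add: tensor_map_pure[OF m(3) N m(1) N jl id])
  qed
  then have "?X = balanced_rel K S M r N l"
    unfolding u(2) using balanced_coset_zero_iff[OF Mr N l module_zero_closed[OF T]]
      submodule_memD(2)[OF balanced_rel_submodule[OF Mr N l]] by simp
  then show ?thesis using balanced_coset_zero_iff[OF Mr N l t] by simp
qed

text \<open>
  Flatness over \<open>B\<close> is tested on modules with elements in \<^typ>\<open>(nat \<Rightarrow> 'h) set\<close>; a vector is represented
  there by the singleton of the constant sequence.
\<close>

definition encode :: "'h \<Rightarrow> (nat \<Rightarrow> 'h) set"
  where "encode h = {\<lambda>_. h}"

definition decode :: "(nat \<Rightarrow> 'h) set \<Rightarrow> 'h"
  where "decode s = the_elem s 0"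

lemma decode_encode [simp]: "decode (encode h) = h"
  by (simp add: encode_def decode_def)

text \<open>
  Addition, zero and scalar multiplication do not depend on \<open>U\<close>, so an inclusion of subspaces becomes an inclusion of
  copies.
\<close>

definition copy_space :: "('k, 'h, 'a) module_scheme \<Rightarrow> 'h set \<Rightarrow> ('k, (nat \<Rightarrow> 'h) set) module"
  where "copy_space M U = \<lparr>carrier = encode ` U, mult = undefined, one = undefined, zero = encode \<zero>\<^bsub>M\<^esub>,
    add = (\<lambda>u v. encode (decode u \<oplus>\<^bsub>M\<^esub> decode v)), smult = (\<lambda>a u. encode (a \<odot>\<^bsub>M\<^esub> decode u))\<rparr>"

lemma copy_space_simps:
  "carrier (copy_space M U) = encode ` U" "\<zero>\<^bsub>copy_space M U\<^esub> = encode \<zero>\<^bsub>M\<^esub>"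
  "u \<oplus>\<^bsub>copy_space M U\<^esub> v = encode (decode u \<oplus>\<^bsub>M\<^esub> decode v)"
  "a \<odot>\<^bsub>copy_space M U\<^esub> u = encode (a \<odot>\<^bsub>M\<^esub> decode u)"
  by (simp_all add: copy_space_def)

lemma module_copy_space:
  assumes M: "module K M" and U: "submodule U K M"
  shows "module K (copy_space M U)"
proof -
  interpret M: module K M by fact
  note Um = submodule_memD[OF U]
  show ?thesis
  proof (rule moduleI)
    show "abelian_group (copy_space M U)"
    proof (rule abelian_groupI)
      show "\<exists>y\<in>carrier (copy_space M U). y \<oplus>\<^bsub>copy_space M U\<^esub> x = \<zero>\<^bsub>copy_space M U\<^esub>"
        if "x \<in> carrier (copy_space M U)" for x
        using that Um by (auto simp: copy_space_simps M.l_neg intro!: bexI[of _ "\<ominus>\<^bsub>M\<^esub> decode x"])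
    qed (use Um in \<open>auto simp: copy_space_simps M.a_ac\<close>)
  qed (use Um in \<open>auto simp: copy_space_simps M.R.is_cring M.smult_l_distr M.smult_r_distr M.smult_assoc1\<close>)
qed

context normal_pair
begin

abbreviation B_alg where "B_alg \<equiv> H\<lparr>carrier := B\<rparr>"
abbreviation copy where "copy U \<equiv> copy_space H U"
abbreviation act :: "(nat \<Rightarrow> 'h) set \<Rightarrow> 'h \<Rightarrow> (nat \<Rightarrow> 'h) set"
  where "act \<equiv> \<lambda>u b. encode (decode u \<otimes>\<^bsub>H\<^esub> b)"

lemma B_alg_algebra: "assoc_algebra K B_alg"
  by (rule subalg_assoc_algebra[of B]) (simp_all add: subalg_def X_submodule X_subring)

lemma copy_right_module:
  assumes U: "submodule U K H" and UB: "\<And>u b. u \<in> U \<Longrightarrow> b \<in> B \<Longrightarrow> u \<otimes>\<^bsub>H\<^esub> b \<in> U"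
  shows "right_module K B_alg (copy U) act"
proof (intro right_module.intro right_module_axioms.intro B_alg_algebra module_copy_space[OF module_H U])
  note Um = submodule_memD[OF U]
  show "(\<lambda>u. act u s) \<in> lin_maps K (copy U) (copy U)" if "s \<in> carrier B_alg" for s
    by (rule lin_mapsI) (use that Um UB X_closed in \<open>auto simp: copy_space_simps H.l_distr smult_mult_left\<close>)
  show "act u \<in> lin_maps K B_alg (copy U)" if "u \<in> carrier (copy U)" for u
    by (rule lin_mapsI) (use that Um UB X_closed in \<open>auto simp: copy_space_simps H.r_distr smult_mult_right\<close>)
qed (use submodule_memD(1)[OF U] X_closed in \<open>auto simp: copy_space_simps H.m_assoc\<close>)

lemma encode_lin: "submodule U K H \<Longrightarrow> encode \<in> lin_maps K (H\<lparr>carrier := U\<rparr>) (copy U)"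
  by (rule lin_mapsI) (auto simp: copy_space_simps)

text \<open>
  The element \<open>a\<^sub>1 \<otimes> S(a\<^sub>2)\<close> of \<open>A \<otimes>\<^sub>B H\<close> dies in \<open>H \<otimes>\<^sub>B H\<close> when \<open>a \<in> HB\<^sup>+\<close>, hence is zero by flatness,
  and \<open>\<epsilon>\<close> on the second factor turns it into the class of \<open>a\<close> modulo \<open>AB\<^sup>+\<close>.
\<close>

theorem flat_kernel:
  assumes flat: "faithfully_flat_over K H B" and a: "a \<in> A" and aI: "a \<in> I"
  shows "a \<in> aug_ideal K SA B"
proof -
  let ?S = "antipode H" and ?M = "copy A" and ?N = "copy (carrier H)"
  have Mr: "right_module K B_alg ?M act"
    by (rule copy_right_module[OF A_submodule]) (use B_sub_A subringE(6)[OF A_subring] in auto)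
  have Nr: "right_module K B_alg ?N act"
    by (rule copy_right_module[OF H_submodule]) (use X_closed in auto)
  note mM = module_of_right_module[OF Mr] and mN = module_of_right_module[OF Nr]
  have l: "\<forall>s\<in>carrier B_alg. \<forall>y\<in>carrier H. s \<otimes>\<^bsub>H\<^esub> y \<in> carrier H" using X_closed by auto
  have j: "(\<lambda>x. x) \<in> lin_maps K ?M ?N"
    by (rule lin_mapsI) (auto simp: copy_space_simps A_closed)
  then have jr: "(\<lambda>x. x) \<in> right_module_hom K B_alg ?M act ?N act"
    by (simp add: right_module_hom_def)
  have eM: "encode \<in> lin_maps K SA ?M"
    using encode_lin[OF A_submodule] lin_maps_cong[of SA "H\<lparr>carrier := A\<rparr>" ?M ?M K] by (simp add: sub_hopf_simps)
  have eN: "encode \<in> lin_maps K H ?N" using encode_lin[OF H_submodule] by simp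
  have sA: "?S \<in> lin_maps K SA H" using lin_comp[OF antipode_linear inclusion] by simp
  have idH: "id \<in> lin_maps K H H" by (simp add: id_def lin_id)
  note \<Delta>a = sub_comult_closed[OF a]
  let ?R = "balanced_rel K B_alg ?M act H (mult H)" and ?R' = "balanced_rel K B_alg ?N act H (mult H)"
  let ?T' = "balanced_tensor K B_alg ?N act H (mult H)"
  (* the element with entries the first factor of a and the antipode of the second, before passing to the quotient by ?R *)
  let ?t = "tensor_map K ?M H encode ?S (comult SA a)"
  note t = lin_closed[OF tensor_map_lin[OF module_sub module_sub mM module_H eM sA] \<Delta>a]
  define q where "q u = ?R' +>\<^bsub>tensor K ?N H\<^esub> u" for u
  have q: "q \<in> lin_maps K (tensor K ?N H) ?T'"
    using balanced_coset_lin[OF Nr module_H l] unfolding q_def .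
  have mT': "module K ?T'" by (rule module_balanced_tensor[OF Nr module_H l])
  have pb: "bilin K ?N H ?T' (\<lambda>m y. q (pure_tensor K ?N H m y))"
    by (rule bilin_comp_lin[OF mN module_H q pure_tensor_bilin[OF mN module_H]])
  define \<beta> where "\<beta> x y = q (pure_tensor K ?N H (encode x) (?S y))" for x y
  have \<beta>: "bilin K H H ?T' \<beta>"
    unfolding \<beta>_def by (rule bilin_precomp[OF pb eN antipode_linear])
  (* elements of B move across the balanced tensor sign *)
  have bal: "q (pure_tensor K ?N H (encode (u \<otimes>\<^bsub>H\<^esub> c)) y) = q (pure_tensor K ?N H (encode u) (c \<otimes>\<^bsub>H\<^esub> y))"
    if "u \<in> carrier H" "c \<in> B" "y \<in> carrier H" for u c y
    using balanced_pure[OF Nr module_H l, of "encode u" c y] that by (simp add: q_def copy_space_simps)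
  have "sw ?T' \<beta> x = \<zero>\<^bsub>?T'\<^esub>" if x: "x \<in> I" for x
  proof (rule I_kernel[OF mT' sw_lin[OF mT' \<beta>] _ x])
    fix h b assume h: "h \<in> carrier H" and b: "b \<in> augmentation K H B"
    note bH = augD(3)[OF b]
    have inner: "sw ?T' (\<lambda>c d. \<beta> (u \<otimes>\<^bsub>H\<^esub> c) (v \<otimes>\<^bsub>H\<^esub> d)) b = \<zero>\<^bsub>?T'\<^esub>"
      if uv: "u \<in> carrier H" "v \<in> carrier H" for u v
    proof -
      (* with c and d the Sweedler factors of b, the inner summand is ?f (c S(d)), which sums to a multiple of the counit of b *)
      let ?f = "\<lambda>w. q (pure_tensor K ?N H (encode u) (w \<otimes>\<^bsub>H\<^esub> ?S v))"
      have eu: "encode u \<in> carrier ?N" using uv by (simp add: copy_space_simps)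
      have f: "?f \<in> lin_maps K H ?T'"
        by (rule lin_bilin_right[OF pb eu]) (use uv in \<open>auto intro!: lin_rules\<close>)
      have "sw ?T' (\<lambda>c d. \<beta> (u \<otimes>\<^bsub>H\<^esub> c) (v \<otimes>\<^bsub>H\<^esub> d)) b = sw ?T' (\<lambda>c d. ?f (c \<otimes>\<^bsub>H\<^esub> ?S d)) b"
      proof (rule sw_coideal[OF mT' _ _ augD(1)[OF b]])
        show "bilin K H H ?T' (\<lambda>c d. \<beta> (u \<otimes>\<^bsub>H\<^esub> c) (v \<otimes>\<^bsub>H\<^esub> d))"
          by (rule bilin_precomp[OF \<beta>]) (use uv in \<open>auto intro!: lin_rules\<close>)
        show "bilin K H H ?T' (\<lambda>c d. ?f (c \<otimes>\<^bsub>H\<^esub> ?S d))"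
          by (rule bilin_comp_lin[OF module_H module_H f]) (auto intro!: lin_rules)
        fix c d assume cd: "c \<in> B" "d \<in> carrier H"
        show "\<beta> (u \<otimes>\<^bsub>H\<^esub> c) (v \<otimes>\<^bsub>H\<^esub> d) = ?f (c \<otimes>\<^bsub>H\<^esub> ?S d)"
          using uv cd X_closed[OF cd(1)] by (simp add: \<beta>_def antipode_mult bal H.m_assoc)
      qed
      also have "\<dots> = counit H b \<odot>\<^bsub>?T'\<^esub> ?f \<one>\<^bsub>H\<^esub>"
        by (rule sw_antipode_right[OF mT' f bH])
      also have "\<dots> = \<zero>\<^bsub>?T'\<^esub>"
        using augD(2)[OF b] module.smult_l_null[OF mT' lin_closed[OF f]] by simp
      finally show ?thesis .
    qed
    have "sw ?T' \<beta> (h \<otimes>\<^bsub>H\<^esub> b) = sw ?T' (\<lambda>u v. sw ?T' (\<lambda>c d. \<beta> (u \<otimes>\<^bsub>H\<^esub> c) (v \<otimes>\<^bsub>H\<^esub> d)) b) h"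
      by (rule sw_mult[OF mT' h bH \<beta>])
    also have "\<dots> \<in> {\<zero>\<^bsub>?T'\<^esub>}"
      by (rule sw_mem[OF mT' submodule_zero[OF mT'] tensor_mult_bilin[OF mT' comult_closed[OF bH] \<beta>] h]) (simp add: inner)
    finally show "sw ?T' \<beta> (h \<otimes>\<^bsub>H\<^esub> b) = \<zero>\<^bsub>?T'\<^esub>" by simp
  qed
  from this[OF aI] have za: "sw ?T' \<beta> a = \<zero>\<^bsub>?T'\<^esub>" .
  (* the image of ?t in the copy of H, rewritten through the comultiplication of H *)
  have jt: "tensor_map K ?N H (\<lambda>x. x) id ?t = tensor_map K ?N H encode ?S (comult H a)"
  proof -
    have "tensor_map K ?N H (\<lambda>x. x) id ?t = tensor_map K ?N H (\<lambda>x. encode x) (\<lambda>y. id (?S y)) (comult SA a)"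
      by (rule tensor_map_comp[OF module_sub module_sub mM module_H eM sA mN module_H j idH \<Delta>a])
    also have "\<dots> = tensor_map K ?N H (\<lambda>x. encode (id x)) (\<lambda>y. ?S (id y)) (comult SA a)" by simp
    also have "\<dots> = tensor_map K ?N H encode ?S (tensor_map K H H id id (comult SA a))"
      by (rule tensor_map_comp[OF module_sub module_sub module_H module_H inclusion inclusion mN module_H
            eN antipode_linear \<Delta>a, symmetric])
    finally show ?thesis by (simp add: sub_comult[OF a])
  qed
  have aH: "a \<in> carrier H" by (rule A_closed[OF a])
  have "q (tensor_map K ?N H encode ?S (comult H a)) = sw ?T' \<beta> a"
    unfolding tensor_map_def \<beta>_def
    by (rule lin_tensor_lift[OF module_H module_H module_tensor[OF mN module_H] mT'
          tensor_map_bilin[OF mN module_H eN antipode_linear] q comult_closed[OF aH]])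
  then have "q (tensor_map K ?N H (\<lambda>x. x) id ?t) = ?R'"
    unfolding jt za balanced_zero[OF Nr module_H l] .
  then have "tensor_map K ?N H (\<lambda>x. x) id ?t \<in> ?R'"
    unfolding q_def using balanced_coset_zero_iff[OF Nr module_H l
        lin_closed[OF tensor_map_lin[OF mM module_H mN module_H j idH] t]] by simp
  then have tR: "?t \<in> ?R"
    by (rule faithfully_flat_injective[OF flat[unfolded faithfully_flat_over_def] Mr Nr module_H l jr _ t, rotated]) simp
  (* the map from the tensor product to the quotient of A: counit on the second factor *)
  let ?Q' = "quot_hopf K SA B" and ?p = "quot_map K SA B"
  let ?\<gamma> = "\<lambda>m y. counit H y \<odot>\<^bsub>?Q'\<^esub> ?p (decode m)"
  note mQ = SB.module_quot
  have dl: "decode \<in> lin_maps K ?M SA"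
    by (rule lin_mapsI) (auto simp: copy_space_simps sub_hopf_simps)
  have pd: "(\<lambda>m. ?p (decode m)) \<in> lin_maps K ?M ?Q'" by (rule lin_comp[OF SB.quot_map_lin dl])
  have \<gamma>: "bilin K ?M H ?Q' ?\<gamma>"
    by (intro bilinI lin_smult_vector lin_smult_const mQ pd counit_linear lin_closed[OF pd]) auto
  note \<gamma>l = tensor_lift_lin[OF mM module_H mQ \<gamma>] and \<gamma>p = tensor_lift_pure[OF mM module_H mQ \<gamma>]
  have "tensor_lift K ?Q' ?\<gamma> ?t = \<zero>\<^bsub>?Q'\<^esub>"
  proof (rule balanced_rel_kernel[OF Mr module_H l mQ \<gamma>l _ tR])
    fix m s y assume "m \<in> carrier ?M" and s: "s \<in> carrier B_alg" and y: "y \<in> carrier H"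
    then obtain x where x: "x \<in> A" "m = encode x" by (auto simp: copy_space_simps)
    have sB: "s \<in> B" "s \<in> carrier H" "s \<in> A" using s X_closed B_sub_A by auto
    have xs: "x \<otimes>\<^bsub>H\<^esub> s \<in> A" using x sB subringE(6)[OF A_subring] by auto
    have xA: "x \<in> carrier SA" using x(1) by (simp add: sub_hopf_simps)
    have px: "?p x \<in> carrier ?Q'" using SB.quot_map_closed[of x] x by (simp add: sub_hopf_simps)
    have "?p (x \<otimes>\<^bsub>H\<^esub> s) = counit H s \<odot>\<^bsub>?Q'\<^esub> ?p x"
      using SB.quot_map_augmented[OF sB(1) sub.C.lin_mult_left[OF xA lin_id] SB.I_gen[OF xA]] x(1) A_closed
      by (simp add: sub_hopf_simps)
    then show "tensor_lift K ?Q' ?\<gamma> (pure_tensor K ?M H (act m s) y) = tensor_lift K ?Q' ?\<gamma> (pure_tensor K ?M H m (s \<otimes>\<^bsub>H\<^esub> y))"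
      using x xs sB y px by (simp add: \<gamma>p copy_space_simps counit_mult module.smult_assoc1[OF mQ, symmetric] K.m_comm)
  qed
  also have "tensor_lift K ?Q' ?\<gamma> ?t = tensor_lift K ?Q' (\<lambda>x y. ?\<gamma> (encode x) (?S y)) (comult SA a)"
    by (rule tensor_lift_map[OF module_sub module_sub mM module_H eM sA mQ \<gamma> \<Delta>a])
  also have "\<dots> = tensor_lift K ?Q' (\<lambda>x y. counit SA y \<odot>\<^bsub>?Q'\<^esub> ?p x) (comult SA a)"
    by (rule tensor_lift_cong[OF module_sub module_sub mQ bilin_precomp[OF \<gamma> eM sA] _ \<Delta>a])
      (simp add: sub_hopf_simps counit_antipode A_closed)
  also have "\<dots> = ?p a"
    by (rule SB.sw_counit_right[OF mQ SB.quot_map_lin]) (simp add: a sub_hopf_simps)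
  finally show ?thesis using a by (simp add: SB.quot_map_zero_iff sub_hopf_simps)
qed

end

theorem theorem3p6:
  fixes K :: "('k, 'z) ring_scheme" and H :: "('k, 'h) hopf" and A B :: "'h set"
  assumes "field K"
    and "hopf_algebra K H"
    and "hopf_subalgebra K H A" and "right_normal K H A"
    and "right_coideal_subalgebra K H B" and "right_normal K H B"
    and "B \<subseteq> A"
  shows "hopf_algebra K (quot_hopf K H B)
    \<and> hopf_subalgebra K (quot_hopf K H B) (quot_map K H B ` A)
    \<and> right_normal K (quot_hopf K H B) (quot_map K H B ` A)
    \<and> (\<exists>f \<in> hopf_iso K (quot_hopf K (quot_hopf K H B) (quot_map K H B ` A)) (quot_hopf K H A).
         \<forall>h\<in>carrier H.
           f (quot_map K (quot_hopf K H B) (quot_map K H B ` A) (quot_map K H B h)) = quot_map K H A h)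
    \<and> (faithfully_flat_over K H B \<and> faithfully_coflat_over_image K H A B \<longrightarrow>
         (\<exists>f \<in> hopf_iso K (quot_hopf K (sub_hopf K H A) B)
                  (sub_hopf K (quot_hopf K H B) (quot_map K H B ` A)).
            \<forall>a\<in>A. f (quot_map K (sub_hopf K H A) B a) = quot_map K H B a))"
proof -
  interpret P: normal_pair K H B A
    using assms by (intro normal_pair.intro normal_coideal.intro hopf_sub.intro normal_coideal_axioms.intro
        hopf_sub_axioms.intro normal_pair_axioms.intro)
  show ?thesis
    using P.hopf_algebra_quot P.hopf_subalgebra_image P.right_normal_image P.quotient_in_stages
      P.restricted_quotient_iso P.flat_kernel by blast
qed

end
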